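(* There is an algorithm which, given integers $k,\ell\ge 1$ and an $\ell$-sparse bimatrix game $(A,B)$ with $A,B\in\mathbb{Q}^{n\times n}$, computes a Nash equilibrium $(x,y)$ of the game with $|S(x)|\le k$ and $|S(y)|\le k$ if one exists, and otherwise correctly reports that no such equilibrium exists. Its running time is $\ell^{O(k\ell)}\cdot n^{O(1)}$.
   Context: A bimatrix game $(A,B)$ with $A,B\in\mathbb{Q}^{n\times n}$ has a row player with strategies the rows $[n]=\{1,\dots,n\}$ and a column player with strategies the columns $[n]$. A (mixed) strategy is a probability vector $x\in\mathbb{R}^n_{\ge 0}$ with $\sum_i x_i=1$; for strategies $x$ (row) and $y$ (column) the payoffs are $x^TAy$ for the row player and $x^TBy$ for the column player. $(x,y)$ is a Nash equilibrium if there is no strategy $x'$ with $x'^TAy>x^TAy$ and no strategy $y'$ with $x^TBy'>x^TBy$. The support of a strategy $x$ is $S(x)=\{i: x_i>0\}$. The game is $\ell$-sparse if every row and every column of $A$ and of $B$ has at most $\ell$ non-zero entries. *)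

theory Defs
  imports Jordan_Normal_Form.Matrix "HOL-Library.Log_Nat"
begin

section \<open>Bimatrix games\<close>

text \<open>Strategies of both players are indexed by \<open>{0..<n}\<close>.\<close>

definition strategy :: "nat \<Rightarrow> real vec \<Rightarrow> bool" where
  "strategy n x \<longleftrightarrow> x \<in> carrier_vec n \<and> (\<forall>i<n. 0 \<le> x $ i) \<and> (\<Sum>i<n. x $ i) = 1"

definition payoff :: "rat mat \<Rightarrow> real vec \<Rightarrow> real vec \<Rightarrow> real" where
  "payoff M x y = x \<bullet> (map_mat real_of_rat M *\<^sub>v y)"

definition nash :: "nat \<Rightarrow> rat mat \<Rightarrow> rat mat \<Rightarrow> real vec \<Rightarrow> real vec \<Rightarrow> bool" where
  "nash n A B x y \<longleftrightarrow>
     strategy n x \<and> strategy n y \<and>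
     \<not> (\<exists>x'. strategy n x' \<and> payoff A x' y > payoff A x y) \<and>
     \<not> (\<exists>y'. strategy n y' \<and> payoff B x y' > payoff B x y)"

definition support :: "real vec \<Rightarrow> nat set" where
  "support x = {i. i < dim_vec x \<and> x $ i > 0}"

definition small_nash :: "nat \<Rightarrow> nat \<Rightarrow> rat mat \<Rightarrow> rat mat \<Rightarrow> real vec \<Rightarrow> real vec \<Rightarrow> bool" where
  "small_nash k n A B x y \<longleftrightarrow>
     nash n A B x y \<and> card (support x) \<le> k \<and> card (support y) \<le> k"

definition sparse_mat :: "nat \<Rightarrow> rat mat \<Rightarrow> bool" where
  "sparse_mat l M \<longleftrightarrow>
     (\<forall>i<dim_row M. card {j. j < dim_col M \<and> M $$ (i, j) \<noteq> 0} \<le> l) \<and>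
     (\<forall>j<dim_col M. card {i. i < dim_row M \<and> M $$ (i, j) \<noteq> 0} \<le> l)"

section \<open>Model of computation\<close>

text \<open>
  An algorithm is a finite table of mutually recursive first-order functions over cells (ordered
  pairs) and rational numbers, evaluated call-by-value.  The primitives are those of a pointer
  machine (allocating a cell, following a pointer, testing for a cell) and of the ordered field of
  rationals (the four operations, comparison); there is no rounding, and no primitive inspects more
  than one cell.  Functions have one argument; several arguments are passed as nested cells.
  Variables are de Bruijn indices into the environment.
\<close>

datatype val = Null | Num rat | Cell val val

datatype arith_op = Add | Sub | Mul | Div

datatype expr =
    Var nat
  | Const rat
  | Empty
  | Mk_Cell expr expr
  | First expr
  | Second expr
  | Arith arith_op expr expr
  | If_Less expr expr expr expr
  | If_Cell expr expr expr
  | Bind expr expr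
  | Call nat expr

type_synonym program = "expr list"

fun arith :: "arith_op \<Rightarrow> rat \<Rightarrow> rat \<Rightarrow> rat" where
  "arith Add a b = a + b"
| "arith Sub a b = a - b"
| "arith Mul a b = a * b"
| "arith Div a b = a / b"

text \<open>Length of the binary encoding of a rational as a reduced fraction, without the sign.\<close>

definition rat_bits :: "rat \<Rightarrow> nat" where
  "rat_bits q = (case quotient_of q of (a, b) \<Rightarrow> floorlog 2 (nat \<bar>a\<bar>) + floorlog 2 (nat b))"

text \<open>
  \<open>eval P w env e v t\<close>: on a machine whose arithmetic yields numbers of at most \<open>w\<close> bits, the
  expression \<open>e\<close> evaluates to \<open>v\<close> in \<open>t\<close> elementary steps.  A computation that would exceed the
  precision \<open>w\<close>, divide by zero, or apply a primitive to a value of the wrong kind is stuck.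
  The bound \<open>w\<close> makes it legitimate to charge one step per operation: without it, repeated squaring
  would produce numbers of exponential length in linearly many steps.
\<close>

inductive eval :: "program \<Rightarrow> nat \<Rightarrow> val list \<Rightarrow> expr \<Rightarrow> val \<Rightarrow> nat \<Rightarrow> bool"
  for P :: program and w :: nat
where
  Var: "i < length env \<Longrightarrow> eval P w env (Var i) (env ! i) 1"
| Const: "eval P w env (Const q) (Num q) 1"
| Empty: "eval P w env Empty Null 1"
| Mk_Cell: "eval P w env e1 u s \<Longrightarrow> eval P w env e2 v t \<Longrightarrow>
    eval P w env (Mk_Cell e1 e2) (Cell u v) (1 + s + t)"
| First: "eval P w env e (Cell u v) t \<Longrightarrow> eval P w env (First e) u (1 + t)"
| Second: "eval P w env e (Cell u v) t \<Longrightarrow> eval P w env (Second e) v (1 + t)"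
| Arith: "eval P w env e1 (Num a) s \<Longrightarrow> eval P w env e2 (Num b) t \<Longrightarrow>
    \<not> (f = Div \<and> b = 0) \<Longrightarrow> rat_bits (arith f a b) \<le> w \<Longrightarrow>
    eval P w env (Arith f e1 e2) (Num (arith f a b)) (1 + s + t)"
| If_Less_True: "eval P w env e1 (Num a) r \<Longrightarrow> eval P w env e2 (Num b) s \<Longrightarrow> a < b \<Longrightarrow>
    eval P w env e3 v t \<Longrightarrow> eval P w env (If_Less e1 e2 e3 e4) v (1 + r + s + t)"
| If_Less_False: "eval P w env e1 (Num a) r \<Longrightarrow> eval P w env e2 (Num b) s \<Longrightarrow> \<not> a < b \<Longrightarrow>
    eval P w env e4 v t \<Longrightarrow> eval P w env (If_Less e1 e2 e3 e4) v (1 + r + s + t)"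
| If_Cell_True: "eval P w env e1 (Cell a b) s \<Longrightarrow> eval P w env e2 v t \<Longrightarrow>
    eval P w env (If_Cell e1 e2 e3) v (1 + s + t)"
| If_Cell_False: "eval P w env e1 u s \<Longrightarrow> (\<And>a b. u \<noteq> Cell a b) \<Longrightarrow> eval P w env e3 v t \<Longrightarrow>
    eval P w env (If_Cell e1 e2 e3) v (1 + s + t)"
| Bind: "eval P w env e1 u s \<Longrightarrow> eval P w (u # env) e2 v t \<Longrightarrow>
    eval P w env (Bind e1 e2) v (1 + s + t)"
| Call: "f < length P \<Longrightarrow> eval P w env e u s \<Longrightarrow> eval P w [u] (P ! f) v t \<Longrightarrow>
    eval P w env (Call f e) v (1 + s + t)"

text \<open>The main function of a program is the one with index \<open>0\<close>.\<close>

definition run :: "program \<Rightarrow> nat \<Rightarrow> val \<Rightarrow> val \<Rightarrow> nat \<Rightarrow> bool" where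
  "run P w inp out t \<longleftrightarrow> eval P w [inp] (Call 0 (Var 0)) out t"

section \<open>Encoding of instances and answers\<close>

fun list_val :: "val list \<Rightarrow> val" where
  "list_val [] = Null"
| "list_val (v # vs) = Cell v (list_val vs)"

definition vec_val :: "rat vec \<Rightarrow> val" where
  "vec_val x = list_val (map Num (list_of_vec x))"

definition mat_val :: "rat mat \<Rightarrow> val" where
  "mat_val M = list_val (map (\<lambda>r. list_val (map Num r)) (mat_to_list M))"

definition instance_val :: "nat \<Rightarrow> nat \<Rightarrow> rat mat \<Rightarrow> rat mat \<Rightarrow> val" where
  "instance_val k l A B =
     list_val [Num (of_nat k), Num (of_nat l), mat_val A, mat_val B]"

definition mat_bits :: "rat mat \<Rightarrow> nat" where
  "mat_bits M = (\<Sum>i<dim_row M. \<Sum>j<dim_col M. rat_bits (M $$ (i, j)))"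

definition instance_bits :: "nat \<Rightarrow> nat \<Rightarrow> rat mat \<Rightarrow> rat mat \<Rightarrow> nat" where
  "instance_bits k l A B =
     rat_bits (of_nat k) + rat_bits (of_nat l) + mat_bits A + mat_bits B"

text \<open>
  The answer \<open>Null\<close> reports that there is no equilibrium of the required kind; existence refers to
  real strategies, whereas the equilibrium that is output has rational coordinates.
\<close>

definition correct_answer :: "nat \<Rightarrow> nat \<Rightarrow> rat mat \<Rightarrow> rat mat \<Rightarrow> val \<Rightarrow> bool" where
  "correct_answer k n A B out \<longleftrightarrow>
     (if \<exists>x y. small_nash k n A B x y
      then \<exists>x y. out = Cell (vec_val x) (vec_val y) \<and>
             small_nash k n A B (map_vec real_of_rat x) (map_vec real_of_rat y)
      else out = Null)"

end

theory Submission
  imports Defs "Jordan_Normal_Form.Determinant" "HOL-Library.Sublist"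
begin

text \<open>
  Among the equilibria with supports of size at most \<open>k\<close> choose one that first minimises the total
  support size and then maximises the number of tight best-response constraints.  Neither strategy
  of it can be moved within the face it spans, so by Cramer's rule it is a normalised vector of
  minors: \<open>y\<close> is determined by its support \<open>J\<close> and \<open>|J|\<close> tight rows.  A nonzero minor has a
  nonzero transversal, hence all but one of these rows can be chosen among the nonzero entries of
  the columns in \<open>J\<close>, which leaves at most \<open>n \<cdot> l\<^bsup>|J|\<^esup>\<close> choices, and expanding the minors along
  their columns costs \<open>l\<^bsup>|J|\<^esup>\<close> steps up to polynomial factors.

  It remains to enumerate the supports.  If \<open>n > k \<cdot> l\<close>, some row vanishes on \<open>J\<close>, so both payoffs
  are nonnegative, and restricting the equilibrium to a connected component (of the relation
  ``at distance at most four in the bipartite graph of nonzero entries'') is again an equilibrium;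
  by minimality \<open>J\<close> is connected and is the vertex set of a walk of length at most \<open>2 \<cdot> k\<close> in a graph
  of degree at most \<open>16 \<cdot> l\<^sup>4\<close>.  If \<open>2 \<le> l\<close> and \<open>n \<le> k \<cdot> l\<close>, all subsets are tried.  For \<open>l = 1\<close> the time bound
  does not allow a factor exponential in \<open>k\<close>; there \<open>J\<close> is a single column, all columns, or a cycle of the
  map that follows the nonzero entry of \<open>A\<close> in a column and then that of \<open>B\<close> in the row so reached.

  Finally all pairs of candidates are tested.  Every number that occurs is a quotient of polynomially many
  sums and products of minors, which share a common denominator, hence it has polynomially many bits.
\<close>

section \<open>Determinants by expansion along columns\<close>

text \<open>One quantity, \<open>V = (n + 1) * l ^ (k * l)\<close>, is the unit of cost: all lengths
  and times are bounded by powers of \<open>V\<close>, so constant factors need no tracking. Only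
  for \<open>l = 1\<close>, where \<open>V = n + 1\<close>, is a constant to the power
  \<open>k\<close> too much.

  Minimality of the support is used through restriction: restricting both strategies to parts of
  their supports and rescaling gives an equilibrium again if payoffs inside the parts are kept and
  all others are kept or drop to zero, which is harmless when payoffs are nonnegative. Distance four
  arises because a deviation to a column outside the support must not see rows of two parts: the
  path column, row, deviating column, row, column has length four. Maximality of the tight
  constraints then removes the freedom that remains inside a fixed support.

  In Cramer's rule the unknown payoff contributes a column of ones. Its partner in the nonzero
  transversal is the one row that sparsity does not restrict; this is the origin of the factor
  \<open>n\<close>.\<close>

fun splits_of :: "'i list \<Rightarrow> ('a::comm_ring_1 \<times> 'i \<times> 'i list) list" where
  "splits_of [] = []"
| "splits_of (i # I) = (1, i, I) # map (\<lambda>(s, a, R). (- s, a, i # R)) (splits_of I)"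

fun laplace_det :: "('r \<Rightarrow> 'c \<Rightarrow> 'a::comm_ring_1) \<Rightarrow> 'r list \<Rightarrow> 'c list \<Rightarrow> 'a" where
  "laplace_det a I [] = 1"
| "laplace_det a I (j # J) = (\<Sum>(s, i, R)\<leftarrow>splits_of I. s * a i j * laplace_det a R J)"

text \<open>Each step past the head flips the sign, so position \<open>p\<close> carries the
  cofactor sign. The same list therefore serves for the expansion along a column, where rows are
  removed, and along a row, where columns are removed.\<close>

lemma splits_of_conv_upt:
  "splits_of I = map (\<lambda>p. ((-1) ^ p, I ! p, take p I @ drop (Suc p) I)) [0..<length I]"
proof (induction I)
  case (Cons i I)
  have "[0..<length (i # I)] = 0 # map Suc [0..<length I]"
    by (simp add: upt_conv_Cons map_Suc_upt del: upt_Suc)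
  then show ?case using Cons by (simp add: o_def)
qed simp

lemma length_splits_of [simp]: "length (splits_of I) = length I"
  by (simp add: splits_of_conv_upt)

lemma splits_of_elem:
  assumes "(s, i, R) \<in> set (splits_of I)"
  shows "s = 1 \<or> s = - 1" "mset I = add_mset i (mset R)" "length I = Suc (length R)"
    "set I = insert i (set R)" "distinct I \<Longrightarrow> distinct R" "distinct I \<Longrightarrow> i \<notin> set R"
proof -
  from assms show m: "mset I = add_mset i (mset R)"
    by (induction I arbitrary: s R) auto
  from assms show "s = 1 \<or> s = - 1"
    by (induction I arbitrary: s R) force+
  show "length I = Suc (length R)" using m by (metis size_mset size_add_mset)
  show "set I = insert i (set R)" using m by (metis set_mset_mset set_mset_add_mset_insert)
  show "distinct I \<Longrightarrow> distinct R" "distinct I \<Longrightarrow> i \<notin> set R"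
    using m by (metis distinct.simps(2) mset.simps(2) mset_eq_imp_distinct_iff)+
qed

lemma map_splits_of_index [simp]: "map (\<lambda>(s, i, R). i) (splits_of I) = I"
  by (simp add: splits_of_conv_upt o_def map_nth)

text \<open>In a distinct list every element is removed exactly once, so the data attached to the
  splits are a function \<open>z\<close> of the removed element. This turns a list of signed
  cofactors into a vector indexed by columns, and list sums into sums over
  \<open>set J\<close>.\<close>

lemma splits_of_function:
  fixes g :: "'a::comm_ring_1 \<Rightarrow> 'c list \<Rightarrow> 'b"
  assumes "distinct J"
  obtains z where "\<And>s j R. (s, j, R) \<in> set (splits_of J) \<Longrightarrow> z j = g s R"
    "\<And>F. (\<Sum>(s, j, R)\<leftarrow>splits_of J. F j (g s R)) = (\<Sum>j\<in>set J. F j (z j) :: 'd::comm_monoid_add)"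
proof -
  let ?S = "splits_of J :: ('a \<times> 'c \<times> 'c list) list"
  let ?K = "map (\<lambda>(s, j, R). (j, g s R)) ?S"
  define z where "z j = the (map_of ?K j)" for j
  have fst: "map fst ?K = J"
    by (simp only: map_map o_def case_prod_beta fst_conv snd_conv map_splits_of_index[unfolded case_prod_beta])
  have z: "z j = g s R" if "(s, j, R) \<in> set ?S" for s j R
  proof -
    have "(j, g s R) \<in> set ?K" using that by force
    then have "map_of ?K j = Some (g s R)"
      using assms fst by (metis map_of_eq_Some_iff)
    then show ?thesis by (simp add: z_def)
  qed
  have "(\<Sum>(s, j, R)\<leftarrow>?S. F j (g s R)) = (\<Sum>j\<in>set J. F j (z j))" for F :: "'c \<Rightarrow> 'b \<Rightarrow> 'd"
  proof -
    have "(\<Sum>j\<in>set J. F j (z j)) = (\<Sum>j\<leftarrow>J. F j (z j))"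
      using assms by (rule sum_list_distinct_conv_sum_set[symmetric])
    also have "\<dots> = (\<Sum>j\<leftarrow>map (\<lambda>(s, i, R). i) ?S. F j (z j))"
      unfolding map_splits_of_index ..
    also have "\<dots> = (\<Sum>(s, j, R)\<leftarrow>?S. F j (g s R))"
      unfolding map_map by (intro arg_cong[of _ _ sum_list] map_cong refl) (auto simp: z)
    finally show ?thesis by simp
  qed
  then show ?thesis using z that[of z] by simp
qed

lemma splits_of_map: "splits_of (map f J) = map (\<lambda>(s, j, R). (s, f j, map f R)) (splits_of J)"
  by (induction J) (auto simp: o_def case_prod_beta)

lemma laplace_det_conv_det:
  assumes "length I = length J"
  shows "laplace_det a I J = det (mat (length J) (length J) (\<lambda>(p, q). a (I ! p) (J ! q)))"
  using assms
proof (induction J arbitrary: I)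
  case Nil
  then show ?case by simp
next
  case (Cons j J)
  let ?n = "length J"
  let ?M = "mat (Suc ?n) (Suc ?n) (\<lambda>(p, q). a (I ! p) ((j # J) ! q))"
  have IH: "laplace_det a (take p I @ drop (Suc p) I) J = det (mat_delete ?M p 0)" if "p < Suc ?n" for p
  proof -
    have "mat_delete ?M p 0 = mat ?n ?n (\<lambda>(p', q). a ((take p I @ drop (Suc p) I) ! p') (J ! q))"
      using that Cons.prems by (intro eq_matI) (auto simp: mat_delete_def nth_append min_def)
    then show ?thesis using Cons.IH[of "take p I @ drop (Suc p) I"] that Cons.prems by simp
  qed
  have "laplace_det a I (j # J) = (\<Sum>p\<leftarrow>[0..<Suc ?n]. (-1) ^ p * a (I ! p) j * laplace_det a (take p I @ drop (Suc p) I) J)"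
    using Cons.prems by (simp add: splits_of_conv_upt o_def)
  also have "\<dots> = (\<Sum>p<Suc ?n. (-1) ^ p * a (I ! p) j * laplace_det a (take p I @ drop (Suc p) I) J)"
    by (simp add: sum_list_distinct_conv_sum_set atLeast0LessThan del: upt_Suc)
  also have "\<dots> = (\<Sum>p<Suc ?n. ?M $$ (p, 0) * cofactor ?M p 0)"
    by (intro sum.cong refl) (simp add: IH cofactor_def)
  also have "\<dots> = det ?M"
    by (rule laplace_expansion_column[symmetric]) auto
  finally show ?case by simp
qed

lemma laplace_det_row_expansion:
  assumes "length J = Suc (length I)"
  shows "laplace_det a (r # I) J = (\<Sum>(s, j, R)\<leftarrow>splits_of J. s * a r j * laplace_det a I R)"
proof -
  let ?n = "length I"
  let ?M = "mat (Suc ?n) (Suc ?n) (\<lambda>(p, q). a ((r # I) ! p) (J ! q))"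
  have minor: "laplace_det a I (take q J @ drop (Suc q) J) = det (mat_delete ?M 0 q)" if "q < Suc ?n" for q
  proof -
    have "mat_delete ?M 0 q = mat ?n ?n (\<lambda>(p, q'). a (I ! p) ((take q J @ drop (Suc q) J) ! q'))"
      using that assms by (intro eq_matI) (auto simp: mat_delete_def nth_append min_def)
    then show ?thesis using laplace_det_conv_det[of I "take q J @ drop (Suc q) J" a] that assms by simp
  qed
  have "laplace_det a (r # I) J = det ?M"
    using laplace_det_conv_det[of "r # I" J a] assms by simp
  also have "\<dots> = (\<Sum>q<Suc ?n. ?M $$ (0, q) * cofactor ?M 0 q)"
    by (rule laplace_expansion_row) auto
  also have "\<dots> = (\<Sum>q<Suc ?n. (-1) ^ q * a r (J ! q) * laplace_det a I (take q J @ drop (Suc q) J))"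
    by (intro sum.cong refl) (simp add: minor cofactor_def)
  also have "\<dots> = (\<Sum>q\<leftarrow>[0..<Suc ?n]. (-1) ^ q * a r (J ! q) * laplace_det a I (take q J @ drop (Suc q) J))"
    by (simp add: sum_list_distinct_conv_sum_set atLeast0LessThan del: upt_Suc)
  also have "\<dots> = (\<Sum>(s, j, R)\<leftarrow>splits_of J. s * a r j * laplace_det a I R)"
    using assms by (simp add: splits_of_conv_upt o_def)
  finally show ?thesis .
qed

text \<open>The kernel condition depends on the rows only through \<open>set I\<close>. It thus also
  shows that reordering the rows of a nonzero minor, as is done to put them in the order of a
  transversal, keeps it nonzero.\<close>

lemma laplace_det_eq_0_iff:
  fixes a :: "'r \<Rightarrow> 'c \<Rightarrow> 'a::field"
  assumes len: "length I = length J" and J: "distinct J"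
  shows "laplace_det a I J = 0 \<longleftrightarrow>
    (\<exists>z. (\<exists>j\<in>set J. z j \<noteq> 0) \<and> (\<forall>i\<in>set I. (\<Sum>j\<in>set J. a i j * z j) = 0))"
proof -
  let ?n = "length J"
  let ?M = "mat ?n ?n (\<lambda>(p, q). a (I ! p) (J ! q))"
  have sum_nth: "(\<Sum>j\<in>set J. f j) = (\<Sum>q<?n. f (J ! q))" for f :: "'c \<Rightarrow> 'a"
    using J by (simp add: sum_list_distinct_conv_sum_set[symmetric] sum_list_sum_nth atLeast0LessThan)
  have prod: "(?M *\<^sub>v v) $ p = (\<Sum>q<?n. a (I ! p) (J ! q) * v $ q)"
    if "p < ?n" "v \<in> carrier_vec ?n" for p v
    using that by (auto simp: scalar_prod_def atLeast0LessThan)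
  have "laplace_det a I J = 0 \<longleftrightarrow> (\<exists>v. v \<in> carrier_vec ?n \<and> v \<noteq> 0\<^sub>v ?n \<and> ?M *\<^sub>v v = 0\<^sub>v ?n)"
    unfolding laplace_det_conv_det[OF len] by (rule det_0_iff_vec_prod_zero_field) auto
  also have "\<dots> \<longleftrightarrow>
    (\<exists>z. (\<exists>j\<in>set J. z j \<noteq> 0) \<and> (\<forall>i\<in>set I. (\<Sum>j\<in>set J. a i j * z j) = 0))"
  proof
    assume "\<exists>v. v \<in> carrier_vec ?n \<and> v \<noteq> 0\<^sub>v ?n \<and> ?M *\<^sub>v v = 0\<^sub>v ?n"
    then obtain v where v: "v \<in> carrier_vec ?n" "v \<noteq> 0\<^sub>v ?n" "?M *\<^sub>v v = 0\<^sub>v ?n" by blast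
    define z where "z j = v $ (THE q. q < ?n \<and> J ! q = j)" for j
    have z: "z (J ! q) = v $ q" if "q < ?n" for q
    proof -
      have "(THE q'. q' < ?n \<and> J ! q' = J ! q) = q"
        using that J by (intro the_equality) (auto simp: nth_eq_iff_index_eq)
      then show ?thesis by (simp add: z_def)
    qed
    obtain q where "q < ?n" "v $ q \<noteq> 0"
      using v(1,2) by (metis carrier_vecD eq_vecI index_zero_vec(1) index_zero_vec(2))
    then have "\<exists>j\<in>set J. z j \<noteq> 0" using z by (metis nth_mem)
    moreover have "(\<Sum>j\<in>set J. a i j * z j) = 0" if i: "i \<in> set I" for i
    proof -
      obtain p where p: "p < ?n" "i = I ! p" using i len by (metis in_set_conv_nth)
      have "(\<Sum>j\<in>set J. a i j * z j) = (\<Sum>q<?n. a (I ! p) (J ! q) * v $ q)"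
        by (simp add: sum_nth z p)
      then show ?thesis using prod[OF p(1) v(1)] v(3) p(1) by simp
    qed
    ultimately show "\<exists>z. (\<exists>j\<in>set J. z j \<noteq> 0) \<and> (\<forall>i\<in>set I. (\<Sum>j\<in>set J. a i j * z j) = 0)" by blast
  next
    assume "\<exists>z. (\<exists>j\<in>set J. z j \<noteq> 0) \<and> (\<forall>i\<in>set I. (\<Sum>j\<in>set J. a i j * z j) = 0)"
    then obtain z where z: "\<exists>j\<in>set J. z j \<noteq> 0" "\<forall>i\<in>set I. (\<Sum>j\<in>set J. a i j * z j) = 0" by blast
    define v where "v = vec ?n (\<lambda>q. z (J ! q))"
    have v: "v \<in> carrier_vec ?n" by (simp add: v_def)
    obtain q where "q < ?n" "z (J ! q) \<noteq> 0" using z(1) by (metis in_set_conv_nth)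
    then have "v \<noteq> 0\<^sub>v ?n" by (metis v_def index_vec index_zero_vec(1))
    moreover have "?M *\<^sub>v v = 0\<^sub>v ?n"
    proof (rule eq_vecI)
      fix p assume "p < dim_vec (0\<^sub>v ?n :: 'a vec)"
      then have p: "p < ?n" by simp
      then have "(\<Sum>j\<in>set J. a (I ! p) j * z j) = 0" using z(2) len by simp
      then show "(?M *\<^sub>v v) $ p = 0\<^sub>v ?n $ p"
        unfolding prod[OF p v] sum_nth using p by (simp add: v_def)
    qed auto
    ultimately show "\<exists>v. v \<in> carrier_vec ?n \<and> v \<noteq> 0\<^sub>v ?n \<and> ?M *\<^sub>v v = 0\<^sub>v ?n" using v by blast
  qed
  finally show ?thesis .
qed

text \<open>Cofactors of a nonzero minor of the columns \<open>J\<close> form a dependency of \<open>j # J\<close>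
  unless some further row enlarges the minor.\<close>

lemma independent_columns_minor:
  fixes a :: "'r \<Rightarrow> 'c \<Rightarrow> 'a::field"
  assumes "distinct J"
    and "\<And>z. (\<And>r. r \<in> T \<Longrightarrow> (\<Sum>j\<in>set J. a r j * z j) = 0) \<Longrightarrow> (\<forall>j\<in>set J. z j = 0)"
  shows "\<exists>I. length I = length J \<and> set I \<subseteq> T \<and> laplace_det a I J \<noteq> 0"
  using assms
proof (induction J)
  case Nil
  then show ?case by (intro exI[of _ "[]"]) simp
next
  case (Cons j J)
  have "\<exists>I. length I = length J \<and> set I \<subseteq> T \<and> laplace_det a I J \<noteq> 0"
  proof (rule Cons.IH)
    show "distinct J" using Cons.prems(1) by simp
    fix z assume z: "\<And>r. r \<in> T \<Longrightarrow> (\<Sum>j\<in>set J. a r j * z j) = 0"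
    have "\<forall>j'\<in>set (j # J). (z(j := 0)) j' = 0"
    proof (rule Cons.prems(2))
      fix r assume r: "r \<in> T"
      have "(\<Sum>j'\<in>set J. a r j' * (z(j := 0)) j') = (\<Sum>j'\<in>set J. a r j' * z j')"
        using Cons.prems(1) by (intro sum.cong) auto
      then show "(\<Sum>j'\<in>set (j # J). a r j' * (z(j := 0)) j') = 0"
        using Cons.prems(1) z[OF r] by simp
    qed
    then show "\<forall>j\<in>set J. z j = 0" using Cons.prems(1)
      by (metis distinct.simps(2) fun_upd_other list.set_intros(2))
  qed
  then obtain I where I: "length I = length J" "set I \<subseteq> T" "laplace_det a I J \<noteq> 0" by blast
  show ?case
  proof (rule ccontr)
    assume neg: "\<not> ?thesis"
    \<comment> \<open>\<open>neg\<close> applies to every \<open>r\<close> in \<open>T\<close>, even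
      one in \<open>I\<close>, as the row lists of the claim may have repetitions; so the cofactor
      vector is annihilated by all of \<open>T\<close>.\<close>
    have zero: "(\<Sum>(s, j', R)\<leftarrow>splits_of (j # J). s * a r j' * laplace_det a I R) = 0" if "r \<in> T" for r
    proof -
      have "laplace_det a (r # I) (j # J) = 0" using neg I(1,2) that
        by (metis insert_subset length_Cons list.simps(15))
      then show ?thesis using laplace_det_row_expansion[of "j # J" I a r] I(1) by simp
    qed
    obtain z where z: "\<And>s j' R. (s, j', R) \<in> set (splits_of (j # J)) \<Longrightarrow> z j' = s * laplace_det a I R"
      "\<And>F. (\<Sum>(s, j', R)\<leftarrow>splits_of (j # J). F j' (s * laplace_det a I R)) = (\<Sum>j'\<in>set (j # J). F j' (z j') :: 'a)"
      by (rule splits_of_function[OF Cons.prems(1), of "\<lambda>s R. s * laplace_det a I R"]) (rule that)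
    have "\<forall>j'\<in>set (j # J). z j' = 0"
    proof (rule Cons.prems(2))
      fix r assume r: "r \<in> T"
      have "(\<Sum>j'\<in>set (j # J). a r j' * z j') = (\<Sum>(s, j', R)\<leftarrow>splits_of (j # J). a r j' * (s * laplace_det a I R))"
        using z(2)[of "\<lambda>j' c. a r j' * c"] by simp
      also have "\<dots> = (\<Sum>(s, j', R)\<leftarrow>splits_of (j # J). s * a r j' * laplace_det a I R)"
        by (simp add: mult_ac del: splits_of.simps)
      finally show "(\<Sum>j'\<in>set (j # J). a r j' * z j') = 0" using zero[OF r] by simp
    qed
    moreover have "z j = laplace_det a I J" using z(1)[of 1 j J] by simp
    ultimately show False using I(3) by simp
  qed
qed

lemma laplace_det_distinct:
  fixes a :: "'r \<Rightarrow> 'c \<Rightarrow> 'a::comm_ring_1"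
  assumes "length I = length J" "laplace_det a I J \<noteq> 0"
  shows "distinct I"
proof (rule ccontr)
  assume "\<not> distinct I"
  then obtain p q where pq: "p < length I" "q < length I" "p \<noteq> q" "I ! p = I ! q"
    by (auto simp: distinct_conv_nth)
  have "det (mat (length J) (length J) (\<lambda>(p, q). a (I ! p) (J ! q))) = 0"
    by (rule det_identical_rows[of _ "length J" p q]) (use pq assms in \<open>auto intro!: eq_vecI\<close>)
  then show False using assms laplace_det_conv_det[of I J a] by simp
qed

text \<open>A nonzero sum has a nonzero summand; following one such summand through the column
  expansion selects a row for each column. The selected rows are those of \<open>I\<close> in
  another order, which is why \<open>I'\<close> is compared as a multiset.\<close>

lemma laplace_det_matching:
  fixes a :: "'r \<Rightarrow> 'c \<Rightarrow> 'a::comm_ring_1"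
  assumes "length I = length J" "laplace_det a I J \<noteq> 0"
  shows "\<exists>I'. mset I' = mset I \<and> list_all2 (\<lambda>i j. a i j \<noteq> 0) I' J"
  using assms
proof (induction J arbitrary: I)
  case Nil
  then show ?case by simp
next
  case (Cons j J)
  have "\<exists>(s, i, R)\<in>set (splits_of I). s * a i j * laplace_det a R J \<noteq> 0"
  proof (rule ccontr)
    assume "\<not> ?thesis"
    then have eq: "map (\<lambda>(s, i, R). s * a i j * laplace_det a R J) (splits_of I) = map (\<lambda>_. 0) (splits_of I :: ('a \<times> 'r \<times> 'r list) list)"
      by (intro map_cong refl) auto
    have "laplace_det a I (j # J) = 0" unfolding laplace_det.simps eq by (rule sum_list_0)
    then show False using Cons.prems(2) by simp
  qed
  then obtain s i R where R: "(s, i, R) \<in> set (splits_of I)" "s * a i j * laplace_det a R J \<noteq> 0" by blast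
  then have "length R = length J" "laplace_det a R J \<noteq> 0" "a i j \<noteq> 0"
    using splits_of_elem(3)[OF R(1)] Cons.prems(1) by auto
  then obtain I' where I': "mset I' = mset R" "list_all2 (\<lambda>i j. a i j \<noteq> 0) I' J"
    using Cons.IH by blast
  then show ?case
    using \<open>a i j \<noteq> 0\<close> splits_of_elem(2)[OF R(1)] by (intro exI[of _ "i # I'"]) simp
qed

section \<open>Minimal equilibria\<close>

text \<open>The minor of the columns \<open>J\<close> extended by a leading column of ones, as
  \<open>laplace_det_bordered_None\<close> confirms. The ones are the coefficients of the unknown
  payoff in the equations of the tight rows.\<close>

definition det1 :: "('r \<Rightarrow> 'c \<Rightarrow> 'a::comm_ring_1) \<Rightarrow> 'r list \<Rightarrow> 'c list \<Rightarrow> 'a" where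
  "det1 a I J = (\<Sum>(s, i, R)\<leftarrow>splits_of I. s * laplace_det a R J)"

text \<open>The column \<open>None\<close> belongs to the payoff: a row is tight exactly if it
  annihilates the vector with entry \<open>- u\<close> at \<open>None\<close> and the entries of
  \<open>y\<close> elsewhere.\<close>

fun bordered :: "('r \<Rightarrow> 'c \<Rightarrow> 'a::comm_ring_1) \<Rightarrow> 'r \<Rightarrow> 'c option \<Rightarrow> 'a" where
  "bordered a i None = 1"
| "bordered a i (Some j) = a i j"

lemma laplace_det_bordered_Some: "laplace_det (bordered a) I (map Some J) = laplace_det a I J"
  by (induction J arbitrary: I) auto

lemma laplace_det_bordered_None: "laplace_det (bordered a) I (None # map Some J) = det1 a I J"
  by (simp add: det1_def laplace_det_bordered_Some)

definition best :: "nat \<Rightarrow> (nat \<Rightarrow> nat \<Rightarrow> real) \<Rightarrow> (nat \<Rightarrow> real) \<Rightarrow> (nat \<Rightarrow> real) \<Rightarrow> real \<Rightarrow> bool" where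
  "best n a y x u \<longleftrightarrow>
     (\<forall>i<n. (\<Sum>j<n. a i j * y j) \<le> u \<and> (0 < x i \<longrightarrow> (\<Sum>j<n. a i j * y j) = u))"

text \<open>The column player's matrix is passed transposed, so that the two players are interchangeable.\<close>

definition eqm :: "nat \<Rightarrow> (nat \<Rightarrow> nat \<Rightarrow> real) \<Rightarrow> (nat \<Rightarrow> nat \<Rightarrow> real) \<Rightarrow>
    (nat \<Rightarrow> real) \<Rightarrow> (nat \<Rightarrow> real) \<Rightarrow> real \<Rightarrow> real \<Rightarrow> bool" where
  "eqm n a b x y u v \<longleftrightarrow>
     (\<forall>i<n. 0 \<le> x i) \<and> (\<forall>j<n. 0 \<le> y j) \<and> (\<Sum>i<n. x i) = 1 \<and> (\<Sum>j<n. y j) = 1 \<and>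
     best n a y x u \<and> best n b x y v"

definition supp :: "nat \<Rightarrow> (nat \<Rightarrow> real) \<Rightarrow> nat set" where
  "supp n x = {i. i < n \<and> 0 < x i}"

definition tight :: "nat \<Rightarrow> (nat \<Rightarrow> nat \<Rightarrow> real) \<Rightarrow> (nat \<Rightarrow> real) \<Rightarrow> real \<Rightarrow> nat set" where
  "tight n a y u = {i. i < n \<and> (\<Sum>j<n. a i j * y j) = u}"

text \<open>Support size and missing tight rows, compared lexicographically by one number: the
  second summand stays below the factor \<open>2 * n + 1\<close>.\<close>

definition eqm_weight :: "nat \<Rightarrow> (nat \<Rightarrow> nat \<Rightarrow> real) \<Rightarrow> (nat \<Rightarrow> nat \<Rightarrow> real) \<Rightarrow>
    (nat \<Rightarrow> real) \<Rightarrow> (nat \<Rightarrow> real) \<Rightarrow> real \<Rightarrow> real \<Rightarrow> nat" where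
  "eqm_weight n a b x y u v = (card (supp n x) + card (supp n y)) * (2 * n + 1) +
     (2 * n - (card (tight n a y u) + card (tight n b x v)))"

definition min_eqm :: "nat \<Rightarrow> nat \<Rightarrow> (nat \<Rightarrow> nat \<Rightarrow> real) \<Rightarrow> (nat \<Rightarrow> nat \<Rightarrow> real) \<Rightarrow>
    (nat \<Rightarrow> real) \<Rightarrow> (nat \<Rightarrow> real) \<Rightarrow> real \<Rightarrow> real \<Rightarrow> bool" where
  "min_eqm k n a b x y u v \<longleftrightarrow> eqm n a b x y u v \<and> card (supp n x) \<le> k \<and> card (supp n y) \<le> k \<and>
     (\<forall>x' y' u' v'. eqm n a b x' y' u' v' \<longrightarrow> card (supp n x') \<le> k \<longrightarrow> card (supp n y') \<le> k \<longrightarrow>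
        eqm_weight n a b x y u v \<le> eqm_weight n a b x' y' u' v')"

lemma eqm_swap: "eqm n a b x y u v \<longleftrightarrow> eqm n b a y x v u"
  unfolding eqm_def by auto

lemma eqm_weight_swap: "eqm_weight n a b x y u v = eqm_weight n b a y x v u"
  unfolding eqm_weight_def by (simp add: add.commute)

lemma min_eqm_swap: "min_eqm k n a b x y u v \<longleftrightarrow> min_eqm k n b a y x v u"
  unfolding min_eqm_def eqm_swap[of n a b] eqm_weight_swap[of n a b] by blast

lemma finite_supp [simp]: "finite (supp n x)" by (simp add: supp_def)

lemma finite_tight [simp]: "finite (tight n a y u)" by (simp add: tight_def)

lemma min_eqm_exists:
  assumes "eqm n a b x y u v" "card (supp n x) \<le> k" "card (supp n y) \<le> k"
  obtains x' y' u' v' where "min_eqm k n a b x' y' u' v'"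
proof -
  let ?P = "\<lambda>(x, y, u, v). eqm n a b x y u v \<and> card (supp n x) \<le> k \<and> card (supp n y) \<le> k"
  have "?P (x, y, u, v)" using assms by simp
  from ex_has_least_nat[of ?P, OF this, of "\<lambda>(x, y, u, v). eqm_weight n a b x y u v"]
  obtain q where "?P q" "\<forall>q'. ?P q' \<longrightarrow>
      (\<lambda>(x, y, u, v). eqm_weight n a b x y u v) q \<le> (\<lambda>(x, y, u, v). eqm_weight n a b x y u v) q'"
    by blast
  moreover obtain x' y' u' v' where "q = (x', y', u', v')" by (cases q)
  ultimately have "min_eqm k n a b x' y' u' v'" by (auto simp: min_eqm_def)
  then show ?thesis by (rule that)
qed

lemma sum_supp:
  assumes "\<forall>j<n. 0 \<le> y j"
  shows "(\<Sum>j<n. (f j :: real) * y j) = (\<Sum>j\<in>supp n y. f j * y j)"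
  unfolding supp_def by (rule sum.mono_neutral_right) (use assms in \<open>auto simp: order.order_iff_strict\<close>)

lemma eqm_supp:
  assumes "eqm n a b x y u v"
  shows "supp n x \<noteq> {}" "supp n y \<noteq> {}" "supp n x \<subseteq> {..<n}" "supp n y \<subseteq> {..<n}"
    "supp n x \<subseteq> tight n a y u" "supp n y \<subseteq> tight n b x v"
proof -
  have ne: "supp n z \<noteq> {}" if "(\<Sum>i<n. z i) = 1" "\<forall>i<n. 0 \<le> z i" for z :: "nat \<Rightarrow> real"
    using sum_supp[OF that(2), of "\<lambda>_. 1"] that(1) by auto
  show "supp n x \<noteq> {}" "supp n y \<noteq> {}" using assms ne unfolding eqm_def by blast+
  show "supp n x \<subseteq> {..<n}" "supp n y \<subseteq> {..<n}" by (auto simp: supp_def)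
  show "supp n x \<subseteq> tight n a y u" "supp n y \<subseteq> tight n b x v"
    using assms unfolding eqm_def best_def tight_def supp_def by auto
qed

text \<open>A smaller support would save at least \<open>2 * n + 1\<close> in the weight, more than
  a loss of tight constraints can give back.\<close>

lemma min_eqm_supp_eq:
  assumes m: "min_eqm k n a b x y u v" and e: "eqm n a b x' y' u' v'"
    and s: "supp n x' \<subseteq> supp n x" "supp n y' \<subseteq> supp n y"
  shows "supp n x' = supp n x" "supp n y' = supp n y"
proof -
  have c: "card (supp n x') \<le> card (supp n x)" "card (supp n y') \<le> card (supp n y)"
    using s by (auto intro: card_mono)
  then have w: "eqm_weight n a b x y u v \<le> eqm_weight n a b x' y' u' v'"
    using m e unfolding min_eqm_def by (meson le_trans)
  have "card (supp n x) + card (supp n y) \<le> card (supp n x') + card (supp n y')"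
  proof (rule ccontr)
    assume "\<not> ?thesis"
    then have "(card (supp n x') + card (supp n y') + 1) * (2 * n + 1) \<le>
        (card (supp n x) + card (supp n y)) * (2 * n + 1)"
      by (intro mult_right_mono) auto
    then show False using w unfolding eqm_weight_def by (simp add: algebra_simps)
  qed
  with c have "card (supp n x') = card (supp n x)" "card (supp n y') = card (supp n y)" by auto
  with s show "supp n x' = supp n x" "supp n y' = supp n y" using card_subset_eq[OF finite_supp] by blast+
qed

lemma restrict_sum:
  assumes "C \<subseteq> supp n y"
  shows "(\<Sum>j<n. f j * (if j \<in> C then y j / s else 0)) = (\<Sum>j\<in>C. f j * y j) / (s :: real)"
proof -
  have C: "C \<subseteq> {..<n}" using assms by (auto simp: supp_def)
  have "(\<Sum>j<n. f j * (if j \<in> C then y j / s else 0)) = (\<Sum>j\<in>C. f j * (y j / s))"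
    by (rule sum.mono_neutral_cong_right) (use C in auto)
  then show ?thesis by (simp add: sum_divide_distrib)
qed

text \<open>Rescaling to total weight one divides the restricted payoffs by \<open>t\<close> and
  \<open>s\<close>, so the equations and inequalities survive with \<open>u / t\<close> and
  \<open>v / s\<close> in place of \<open>u\<close> and \<open>v\<close>. The result is an
  equilibrium with supports \<open>K\<close> and \<open>C\<close>, which minimality forces to be the
  original ones.\<close>

lemma min_eqm_restrict:
  assumes m: "min_eqm k n a b x y u v"
    and K: "K \<subseteq> supp n x" "K \<noteq> {}" and C: "C \<subseteq> supp n y" "C \<noteq> {}"
    and a: "\<And>i. i < n \<Longrightarrow> (\<Sum>j\<in>C. a i j * y j) \<le> u" "\<And>i. i \<in> K \<Longrightarrow> (\<Sum>j\<in>C. a i j * y j) = u"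
    and b: "\<And>j. j < n \<Longrightarrow> (\<Sum>i\<in>K. b j i * x i) \<le> v" "\<And>j. j \<in> C \<Longrightarrow> (\<Sum>i\<in>K. b j i * x i) = v"
  shows "K = supp n x" "C = supp n y"
proof -
  have e: "eqm n a b x y u v" using m by (simp add: min_eqm_def)
  define s where "s = (\<Sum>i\<in>K. x i)"
  define t where "t = (\<Sum>j\<in>C. y j)"
  define x' where "x' i = (if i \<in> K then x i / s else 0)" for i
  define y' where "y' j = (if j \<in> C then y j / t else 0)" for j
  have fin: "finite K" "finite C" using K(1) C(1) by (meson finite_subset finite_supp)+
  have s: "s > 0" unfolding s_def
    by (rule sum_pos) (use K fin in \<open>auto simp: supp_def\<close>)
  have t: "t > 0" unfolding t_def
    by (rule sum_pos) (use C fin in \<open>auto simp: supp_def\<close>)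
  have sx: "supp n x' = K" and sy: "supp n y' = C"
    using K C s t by (auto simp: supp_def x'_def y'_def)
  have ay: "(\<Sum>j<n. f j * y' j) = (\<Sum>j\<in>C. f j * y j) / t" for f
    unfolding y'_def by (rule restrict_sum[OF C(1)])
  have bx: "(\<Sum>i<n. f i * x' i) = (\<Sum>i\<in>K. f i * x i) / s" for f
    unfolding x'_def by (rule restrict_sum[OF K(1)])
  have "eqm n a b x' y' (u / t) (v / s)"
    unfolding eqm_def best_def
  proof (intro conjI allI impI)
    show "(\<Sum>i<n. x' i) = 1" using bx[of "\<lambda>_. 1"] s by (simp add: s_def)
    show "(\<Sum>i<n. y' i) = 1" using ay[of "\<lambda>_. 1"] t by (simp add: t_def)
    show "0 \<le> x' i" if "i < n" for i using that s K by (auto simp: x'_def supp_def)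
    show "0 \<le> y' i" if "i < n" for i using that t C by (auto simp: y'_def supp_def)
    show "(\<Sum>j<n. a i j * y' j) \<le> u / t" if "i < n" for i
      unfolding ay using a(1)[OF that] t by (simp add: divide_right_mono)
    show "(\<Sum>j<n. a i j * y' j) = u / t" if "i < n" "0 < x' i" for i
      unfolding ay using a(2)[of i] that by (auto simp: x'_def split: if_splits)
    show "(\<Sum>j<n. b i j * x' j) \<le> v / s" if "i < n" for i
      unfolding bx using b(1)[OF that] s by (simp add: divide_right_mono)
    show "(\<Sum>j<n. b i j * x' j) = v / s" if "i < n" "0 < y' i" for i
      unfolding bx using b(2)[of i] that by (auto simp: y'_def split: if_splits)
  qed
  from min_eqm_supp_eq[OF m this] sx sy K C show "K = supp n x" "C = supp n y" by auto
qed

text \<open>Moving along \<open>d\<close> until a coordinate vanishes or a further row becomes tight decreases the weight.\<close>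

lemma min_eqm_vertex:
  assumes m: "min_eqm k n a b x y u v"
    and d0: "\<And>j. j \<notin> supp n y \<Longrightarrow> d j = 0" and d1: "(\<Sum>j<n. d j) = 0"
    and de: "\<And>i. i \<in> tight n a y u \<Longrightarrow> (\<Sum>j<n. a i j * d j) = e"
  shows "d j = 0"
proof (rule ccontr)
  assume "d j \<noteq> 0"
  have eq: "eqm n a b x y u v" using m by (simp add: min_eqm_def)
  note eqs = eq[unfolded eqm_def best_def]
  \<comment> \<open>While moving along \<open>d\<close>, the equilibrium payoff drifts at rate
    \<open>e\<close>; \<open>r i\<close> is the rate at which row \<open>i\<close> gains on it and
    \<open>q i\<close> its present slack.\<close>
  define r where "r i = (\<Sum>j<n. a i j * d j) - e" for i
  define q where "q i = u - (\<Sum>j<n. a i j * y j)" for i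
  define N where "N = {j\<in>supp n y. d j < 0}"
  define F where "F = {i. i < n \<and> i \<notin> tight n a y u \<and> r i > 0}"
  \<comment> \<open>A nonzero vector of sum zero has a negative coordinate, necessarily on the
    support; so the movement is stopped by some constraint and the minimum \<open>t\<close>
    exists.\<close>
  have "N \<noteq> {}"
  proof
    assume "N = {}"
    then have nn: "\<forall>j<n. 0 \<le> d j" unfolding N_def using d0
      by (metis (no_types, lifting) empty_Collect_eq le_less_linear order_refl)
    then have "\<forall>j<n. d j = 0" using d1 sum_nonneg_eq_0_iff[of "{..<n}" d] by auto
    moreover have "j < n" using \<open>d j \<noteq> 0\<close> d0[of j] by (auto simp: supp_def)
    ultimately show False using \<open>d j \<noteq> 0\<close> by simp
  qed
  define R where "R = (\<lambda>j. y j / (- d j)) ` N \<union> (\<lambda>i. q i / r i) ` F"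
  have R: "finite R" "R \<noteq> {}" using \<open>N \<noteq> {}\<close> by (auto simp: R_def N_def F_def)
  define t where "t = Min R"
  have q_pos: "q i > 0" if "i \<in> F" for i
    using that eqs unfolding F_def q_def tight_def by fastforce
  have "t > 0" unfolding t_def using R q_pos
    by (subst Min_gr_iff) (auto simp: R_def N_def F_def supp_def intro!: divide_pos_pos divide_pos_neg)
  have tle: "t \<le> c" if "c \<in> R" for c using that R by (simp add: t_def)
  have tR: "t \<in> R" using R by (simp add: t_def)
  define y' where "y' j = y j + t * d j" for j
  define u' where "u' = u + t * e"
  have row: "(\<Sum>j<n. a i j * y' j) = u' - q i + t * r i" for i
    by (simp add: y'_def u'_def q_def r_def algebra_simps sum.distrib sum_distrib_left)
  have y0: "y' j = y j" if "j \<notin> supp n y" for j using d0[OF that] by (simp add: y'_def)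
  have ynn: "0 \<le> y' j" if "j < n" for j
  proof (cases "d j < 0")
    case True
    then have "j \<in> N" using d0[of j] by (auto simp: N_def)
    then have "t \<le> y j / (- d j)" by (intro tle) (auto simp: R_def)
    then show ?thesis using True by (simp add: y'_def field_simps)
  next
    case False
    then show ?thesis using eqs that \<open>t > 0\<close> by (simp add: y'_def)
  qed
  have qt: "q i = 0 \<and> r i = 0" if "i \<in> tight n a y u" for i
    using that de by (auto simp: tight_def q_def r_def)
  have rle: "t * r i \<le> q i" if "i < n" for i
  proof (cases "i \<in> F")
    case True
    then have "t \<le> q i / r i" by (intro tle) (auto simp: R_def)
    then show ?thesis using True by (simp add: F_def field_simps)
  next
    case False
    then consider "i \<in> tight n a y u" | "r i \<le> 0" using \<open>i < n\<close> by (auto simp: F_def)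
    then show ?thesis
    proof cases
      case 2
      have "q i \<ge> 0" using eqs that by (simp add: q_def)
      then show ?thesis using mult_nonneg_nonpos[of t "r i"] 2 \<open>t > 0\<close> by linarith
    qed (use qt in simp)
  qed
  have supp: "supp n y' \<subseteq> supp n y"
  proof
    fix j assume "j \<in> supp n y'"
    then show "j \<in> supp n y" using y0[of j] by (auto simp: supp_def)
  qed
  have eq': "eqm n a b x y' u' v"
    unfolding eqm_def best_def
  proof (intro conjI allI impI)
    show "(\<Sum>j<n. y' j) = 1" using eqs d1 by (simp add: y'_def sum.distrib flip: sum_distrib_left)
    show "(\<Sum>j<n. a i j * y' j) \<le> u'" if "i < n" for i using rle[OF that] by (simp add: row)
    show "(\<Sum>j<n. a i j * y' j) = u'" if "i < n" "0 < x i" for i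
      using qt[of i] eqm_supp(5)[OF eq] that by (auto simp: row supp_def)
    show "(\<Sum>j<n. b i j * x j) = v" if "i < n" "0 < y' i" for i
      using supp that eqs by (auto simp: supp_def)
  qed (use eqs ynn in auto)
  have sy: "supp n y' = supp n y" using min_eqm_supp_eq[OF m eq'] supp by simp
  \<comment> \<open>The obstacle met first is not a coordinate: one that reached zero would leave
    the support, against \<open>sy\<close>. So a new row becomes tight while all old tight rows stay
    tight.\<close>
  have "t \<notin> (\<lambda>j. y j / (- d j)) ` N"
  proof
    assume "t \<in> (\<lambda>j. y j / (- d j)) ` N"
    then obtain j where "j \<in> N" "t = y j / (- d j)" by blast
    then have "y' j = 0" "j \<in> supp n y" by (auto simp: N_def y'_def)
    then have "j \<in> supp n y'" using sy by simp
    then show False using \<open>y' j = 0\<close> unfolding supp_def by simp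
  qed
  then obtain i where i: "i \<in> F" "t = q i / r i" using tR unfolding R_def by blast
  have "insert i (tight n a y u) \<subseteq> tight n a y' u'"
  proof
    fix i' assume "i' \<in> insert i (tight n a y u)"
    then show "i' \<in> tight n a y' u'" using i qt[of i'] row[of i'] unfolding tight_def F_def by auto
  qed
  then have "card (insert i (tight n a y u)) \<le> card (tight n a y' u')" by (rule card_mono[rotated]) simp
  moreover have "i \<notin> tight n a y u" using i by (simp add: F_def)
  ultimately have "card (tight n a y u) < card (tight n a y' u')" by simp
  moreover have "card (tight n a y' u') \<le> card {..<n}" "card (tight n b x v) \<le> card {..<n}"
    by (intro card_mono; auto simp: tight_def)+
  ultimately have "eqm_weight n a b x y' u' v < eqm_weight n a b x y u v"
    unfolding eqm_weight_def sy by simp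
  then show False using m eq' sy unfolding min_eqm_def by (metis leD)
qed

text \<open>By \<open>min_eqm_vertex\<close> the tight rows have, up to a factor, only the kernel
  vector formed by \<open>y\<close> and the payoff. Omitting one column of the support leaves
  independent columns, so there are \<open>length J\<close> tight rows with a nonzero bordered
  minor, and the cofactors recover \<open>y\<close> up to the factor \<open>c\<close>. The list
  \<open>tl J\<close> appears because the head of \<open>J\<close> is the omitted column;
  \<open>r\<close> is the row that the transversal assigns to the column of ones.\<close>

lemma min_eqm_cramer:
  assumes m: "min_eqm k n a b x y u v" and J: "distinct J" "set J = supp n y"
  shows "\<exists>r I c. distinct (r # I) \<and> r < n \<and> set I \<subseteq> {..<n} \<and> list_all2 (\<lambda>i j. a i j \<noteq> 0) I (tl J) \<and>
    c \<noteq> 0 \<and> (\<Sum>(s, j, R)\<leftarrow>splits_of J. s * det1 a (r # I) R) = c \<and>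
    (\<forall>(s, j, R)\<in>set (splits_of J). s * det1 a (r # I) R = c * y j)"
proof -
  have eq: "eqm n a b x y u v" using m by (simp add: min_eqm_def)
  note eqs = eq[unfolded eqm_def best_def]
  let ?T = "tight n a y u"
  have Jn: "set J \<subseteq> {..<n}" using J by (auto simp: supp_def)
  have T: "?T \<noteq> {}" using eqm_supp[OF eq] by blast
  obtain j0 J0 where J0: "J = j0 # J0" using J eqm_supp(2)[OF eq] by (cases J) auto
  have yJ: "(\<Sum>j<n. f j * y j) = (\<Sum>j\<in>set J. f j * y j)" for f
    unfolding J(2) using eqs by (intro sum_supp) blast
  have ext: "(\<Sum>j<n. f j * (if j \<in> S then z j else 0)) = (\<Sum>j\<in>S. f j * z j)"
    if "S \<subseteq> set J" for f z :: "nat \<Rightarrow> real" and S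
    by (rule sum.mono_neutral_cong_right) (use that Jn in auto)
  \<comment> \<open>The solutions of the tight rows are the multiples of \<open>y\<close>.\<close>
  have kernel: "z j = (\<Sum>j\<in>S. z j) * y j"
    if S: "S \<subseteq> set J" "j \<in> S" and z: "\<And>r. r \<in> ?T \<Longrightarrow> (\<Sum>j\<in>S. a r j * z j) = e" for S z e j
  proof -
    let ?s = "\<Sum>j\<in>S. z j"
    \<comment> \<open>Subtracting the multiple of \<open>y\<close> with the same total gives a
      vector of sum zero, as \<open>min_eqm_vertex\<close> requires. The factor
      \<open>of_bool\<close> clears \<open>y\<close> beyond \<open>n\<close>, where nothing is known
      about it.\<close>
    define d where "d j = (if j \<in> S then z j else 0) - ?s * y j * of_bool (j < n)" for j
    have "d j = 0"
    proof (rule min_eqm_vertex[OF m, of d "e - ?s * u"])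
      show "d j = 0" if "j \<notin> supp n y" for j
      proof -
        have "j < n \<Longrightarrow> y j = 0" using that eqs by (force simp: supp_def)
        moreover have "j \<notin> S" using that S J by auto
        ultimately show ?thesis by (auto simp: d_def)
      qed
      have sd: "(\<Sum>j<n. f j * d j) = (\<Sum>j\<in>S. f j * z j) - ?s * (\<Sum>j<n. f j * y j)" for f
      proof -
        have "(\<Sum>j<n. f j * d j) = (\<Sum>j<n. f j * (if j \<in> S then z j else 0) - ?s * (f j * y j))"
          by (intro sum.cong) (auto simp: d_def algebra_simps)
        also have "\<dots> = (\<Sum>j<n. f j * (if j \<in> S then z j else 0)) - ?s * (\<Sum>j<n. f j * y j)"
          by (simp only: sum_subtractf sum_distrib_left)
        finally show ?thesis unfolding ext[OF S(1)] .
      qed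
      show "(\<Sum>j<n. d j) = 0" using sd[of "\<lambda>_. 1"] eqs by simp
      show "(\<Sum>j<n. a i j * d j) = e - ?s * u" if "i \<in> ?T" for i
        unfolding sd using z[OF that] that by (simp add: tight_def)
    qed
    then show ?thesis using S Jn by (auto simp: d_def)
  qed
  have y0: "y j0 > 0" using J J0 by (auto simp: supp_def)
  let ?B = "bordered a"
  \<comment> \<open>A dependency of the columns without \<open>j0\<close> is a multiple of
    \<open>y\<close> vanishing at \<open>j0\<close>; since \<open>y j0 > 0\<close>, it is
    zero.\<close>
  have "\<exists>I. length I = length (None # map Some J0) \<and> set I \<subseteq> ?T \<and> laplace_det ?B I (None # map Some J0) \<noteq> 0"
  proof (rule independent_columns_minor)
    show "distinct (None # map Some J0)" using J J0 by (auto simp: distinct_map)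
    fix z assume z: "\<And>r. r \<in> ?T \<Longrightarrow> (\<Sum>c\<in>set (None # map Some J0). ?B r c * z c) = 0"
    define z' where "z' j = (if j \<in> set J0 then z (Some j) else 0)" for j
    have sp: "(\<Sum>c\<in>set (None # map Some J0). ?B r c * z c) = z None + (\<Sum>j\<in>set J0. a r j * z (Some j))" for r
      by (simp add: sum.reindex image_iff)
    have "(\<Sum>j\<in>set J. a r j * z' j) = - z None" if "r \<in> ?T" for r
    proof -
      have "(\<Sum>j\<in>set J. a r j * z' j) = (\<Sum>j\<in>set J0. a r j * z (Some j))"
        by (rule sum.mono_neutral_cong_right) (auto simp: J0 z'_def)
      then show ?thesis using z[OF that] sp[of r] by linarith
    qed
    from kernel[OF subset_refl _ this] have k: "z' j = (\<Sum>j\<in>set J. z' j) * y j" if "j \<in> set J" for j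
      using that by blast
    have "z' j0 = 0" using J J0 by (simp add: z'_def)
    then have "(\<Sum>j\<in>set J. z' j) = 0" using k[of j0] y0 J0 by simp
    then have "z' j = 0" if "j \<in> set J" for j using k[OF that] by simp
    then have zs: "z (Some j) = 0" if "j \<in> set J0" for j using that J0 by (force simp: z'_def)
    obtain r where "r \<in> ?T" using T by blast
    then have "z None = 0" using z[of r] sp[of r] zs by simp
    then show "\<forall>c\<in>set (None # map Some J0). z c = 0" using zs by auto
  qed
  then obtain I0 where I0: "length I0 = length (None # map Some J0)" "set I0 \<subseteq> ?T"
    "laplace_det ?B I0 (None # map Some J0) \<noteq> 0" by blast
  obtain I' where I': "mset I' = mset I0" "list_all2 (\<lambda>i c. ?B i c \<noteq> 0) I' (None # map Some J0)"
    using laplace_det_matching[OF I0(1,3)] by blast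
  have set_I': "set I' = set I0" using I'(1) by (metis set_mset_mset)
  have len_I': "length I' = length (None # map Some J0)" using I'(2) by (rule list_all2_lengthD)
  have dJ: "distinct (None # map Some J0)" using J J0 by (auto simp: distinct_map)
  have nz: "laplace_det ?B I' (None # map Some J0) \<noteq> 0"
    using I0(3) laplace_det_eq_0_iff[OF I0(1) dJ, of ?B] laplace_det_eq_0_iff[OF len_I' dJ, of ?B] set_I' by simp
  have dI: "distinct I'" using laplace_det_distinct[OF len_I' nz] .
  obtain r I where rI: "I' = r # I" using len_I' by (cases I') auto
  have l2: "list_all2 (\<lambda>i j. a i j \<noteq> 0) I J0"
    using I'(2) by (simp add: rI list_all2_map2)
  obtain z where z: "\<And>s j R. (s, j, R) \<in> set (splits_of J) \<Longrightarrow> z j = s * det1 a I' R"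
    "\<And>F. (\<Sum>(s, j, R)\<leftarrow>splits_of J. F j (s * det1 a I' R)) = (\<Sum>j\<in>set J. F j (z j) :: real)"
    by (rule splits_of_function[OF J(1), of "\<lambda>s R. s * det1 a I' R"]) (rule that)
  have row: "(\<Sum>j\<in>set J. a r' j * z j) = laplace_det a I' J" if r': "r' \<in> ?T" for r'
  proof -
    have dJN: "distinct (None # map Some J)" using J by (auto simp: distinct_map)
    have lenJN: "length (r' # I') = length (None # map Some J)" using len_I' J0 by simp
    \<comment> \<open>All its rows are tight, so the vector with \<open>- u\<close> at
      \<open>None\<close> and \<open>y\<close> elsewhere is annihilated by this larger matrix.
      Expanding the vanishing determinant along \<open>r'\<close> gives the payoff of
      \<open>z\<close> in that row, which is the same for every tight row.\<close>
    have "laplace_det ?B (r' # I') (None # map Some J) = 0"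
      unfolding laplace_det_eq_0_iff[OF lenJN dJN]
    proof (intro exI[of _ "case_option (- u) y"] conjI ballI)
      show "\<exists>c\<in>set (None # map Some J). case_option (- u) y c \<noteq> 0"
        using y0 J0 by (intro bexI[of _ "Some j0"]) auto
      fix i assume "i \<in> set (r' # I')"
      then have "i \<in> ?T" using r' I0(2) set_I' by auto
      then have "(\<Sum>j\<in>set J. a i j * y j) = u" using yJ[of "a i"] by (simp add: tight_def)
      then show "(\<Sum>c\<in>set (None # map Some J). ?B i c * case_option (- u) y c) = 0"
        by (simp add: sum.reindex image_iff)
    qed
    moreover have "length (None # map Some J) = Suc (length I')" using lenJN by simp
    ultimately have "(\<Sum>(s, c, R)\<leftarrow>splits_of (None # map Some J). s * ?B r' c * laplace_det ?B I' R) = 0"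
      by (simp only: laplace_det_row_expansion)
    moreover have "(\<Sum>(s, c, R)\<leftarrow>splits_of (None # map Some J). s * ?B r' c * laplace_det ?B I' R) =
        laplace_det ?B I' (map Some J) + (\<Sum>(s, j, R)\<leftarrow>splits_of J. - s * a r' j * laplace_det ?B I' (None # map Some R))"
      by (simp add: splits_of_map o_def split_def del: laplace_det.simps)
    moreover have "(\<Sum>(s, j, R)\<leftarrow>splits_of J. - s * a r' j * laplace_det ?B I' (None # map Some R)) =
        - (\<Sum>(s, j, R)\<leftarrow>splits_of J. a r' j * (s * det1 a I' R))"
      by (simp add: uminus_sum_list_map o_def split_def laplace_det_bordered_None mult_ac del: laplace_det.simps)
    ultimately have "laplace_det a I' J = (\<Sum>(s, j, R)\<leftarrow>splits_of J. a r' j * (s * det1 a I' R))"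
      by (simp add: laplace_det_bordered_Some)
    then show ?thesis using z(2)[of "\<lambda>j c. a r' j * c"] by simp
  qed
  define c where "c = (\<Sum>j\<in>set J. z j)"
  have zc: "z j = c * y j" if "j \<in> set J" for j
    unfolding c_def by (rule kernel[OF subset_refl that row])
  have "z j0 = laplace_det ?B I' (None # map Some J0)"
    unfolding laplace_det_bordered_None using z(1)[of 1 j0 J0] by (simp add: J0)
  then have "c \<noteq> 0" using nz zc[of j0] J0 by auto
  moreover have "(\<Sum>(s, j, R)\<leftarrow>splits_of J. s * det1 a (r # I) R) = c"
    using z(2)[of "\<lambda>_ c. c"] by (simp add: c_def rI)
  moreover have "\<forall>(s, j, R)\<in>set (splits_of J). s * det1 a (r # I) R = c * y j"
  proof safe
    fix s :: real and j R assume sp: "(s, j, R) \<in> set (splits_of J)"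
    then have "j \<in> set J" using splits_of_elem(4)[OF sp] by simp
    then show "s * det1 a (r # I) R = c * y j" using z(1)[OF sp] zc rI by metis
  qed
  moreover have "r < n" "set I \<subseteq> {..<n}" using I0(2) set_I' rI by (auto simp: tight_def)
  moreover have "distinct (r # I)" "list_all2 (\<lambda>i j. a i j \<noteq> 0) I (tl J)"
    using dI l2 rI J0 by simp_all
  ultimately show ?thesis by blast
qed

section \<open>Supports of minimal equilibria\<close>

definition touch :: "(nat \<Rightarrow> nat \<Rightarrow> real) \<Rightarrow> (nat \<Rightarrow> nat \<Rightarrow> real) \<Rightarrow> nat \<Rightarrow> nat \<Rightarrow> bool" where
  "touch a b i j \<longleftrightarrow> a i j \<noteq> 0 \<or> b j i \<noteq> 0"

definition adj2 :: "nat \<Rightarrow> (nat \<Rightarrow> nat \<Rightarrow> real) \<Rightarrow> (nat \<Rightarrow> nat \<Rightarrow> real) \<Rightarrow> nat \<Rightarrow> nat \<Rightarrow> bool" where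
  "adj2 n a b j j' \<longleftrightarrow> (\<exists>i<n. touch a b i j \<and> touch a b i j')"

text \<open>The middle column ranges over all columns, not just the support: it is a possible
  deviation of the column player.\<close>

definition adj4 :: "nat \<Rightarrow> (nat \<Rightarrow> nat \<Rightarrow> real) \<Rightarrow> (nat \<Rightarrow> nat \<Rightarrow> real) \<Rightarrow> nat \<Rightarrow> nat \<Rightarrow> bool" where
  "adj4 n a b j j' \<longleftrightarrow> (\<exists>j1<n. adj2 n a b j j1 \<and> adj2 n a b j1 j')"

definition adj1 :: "nat \<Rightarrow> (nat \<Rightarrow> nat \<Rightarrow> real) \<Rightarrow> (nat \<Rightarrow> nat \<Rightarrow> real) \<Rightarrow> nat \<Rightarrow> nat \<Rightarrow> bool" where
  "adj1 n a b j j' \<longleftrightarrow> (\<exists>i<n. a i j \<noteq> 0 \<and> b j' i \<noteq> 0)"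

definition sparse_fun :: "nat \<Rightarrow> nat \<Rightarrow> (nat \<Rightarrow> nat \<Rightarrow> 'a::zero) \<Rightarrow> bool" where
  "sparse_fun l n a \<longleftrightarrow> (\<forall>i<n. card {j. j < n \<and> a i j \<noteq> 0} \<le> l) \<and>
     (\<forall>j<n. card {i. i < n \<and> a i j \<noteq> 0} \<le> l)"

lemma adj2_sym: "adj2 n a b j j' \<Longrightarrow> adj2 n a b j' j"
  by (auto simp: adj2_def)

lemma adj4_sym: "adj4 n a b j j' \<Longrightarrow> adj4 n a b j' j"
  unfolding adj4_def by (blast intro: adj2_sym)

lemma adj2_imp_adj4: "adj2 n a b j j' \<Longrightarrow> j' < n \<Longrightarrow> adj4 n a b j j'"
  unfolding adj4_def adj2_def by blast

lemma restricted_sum: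
  assumes "eqm n a b x y u v" "C \<subseteq> supp n y" "\<And>j. j \<in> supp n y - C \<Longrightarrow> f j = 0"
  shows "(\<Sum>j\<in>C. f j * y j) = (\<Sum>j<n. f j * y j)"
proof -
  have "(\<Sum>j<n. f j * y j) = (\<Sum>j\<in>supp n y. f j * y j)"
    using assms(1) by (intro sum_supp) (simp add: eqm_def)
  also have "\<dots> = (\<Sum>j\<in>C. f j * y j)"
    by (rule sum.mono_neutral_right) (use assms in auto)
  finally show ?thesis by simp
qed

lemma eqm_row:
  assumes "eqm n a b x y u v"
  shows "i < n \<Longrightarrow> (\<Sum>j<n. a i j * y j) \<le> u" "i \<in> supp n x \<Longrightarrow> (\<Sum>j<n. a i j * y j) = u"
    "j < n \<Longrightarrow> (\<Sum>i<n. b j i * x i) \<le> v" "j \<in> supp n y \<Longrightarrow> (\<Sum>i<n. b j i * x i) = v"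
  using assms unfolding eqm_def best_def supp_def by auto

lemma eqm_row_nonzero:
  assumes "eqm n a b x y u v" "i < n" "(\<Sum>j<n. a i j * y j) \<noteq> 0"
  shows "\<exists>j\<in>supp n y. a i j \<noteq> 0"
proof (rule ccontr)
  assume "\<not> ?thesis"
  then have "(\<Sum>j\<in>{}. a i j * y j) = (\<Sum>j<n. a i j * y j)"
    by (intro restricted_sum[OF assms(1)]) auto
  then show False using assms(3) by simp
qed

lemma eqm_payoff_nonneg:
  assumes e: "eqm n a b x y u v" and s: "sparse_fun l n a" and k: "card (supp n y) \<le> k" "k * l < n"
  shows "0 \<le> u"
proof -
  let ?U = "\<Union>j\<in>supp n y. {i. i < n \<and> a i j \<noteq> 0}"
  have "card ?U \<le> (\<Sum>j\<in>supp n y. card {i. i < n \<and> a i j \<noteq> 0})"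
    by (rule card_UN_le) simp
  also have "\<dots> \<le> (\<Sum>j\<in>supp n y. l)"
    by (rule sum_mono) (use s in \<open>auto simp: sparse_fun_def supp_def\<close>)
  also have "\<dots> \<le> k * l" using k by simp
  finally have "card ?U < n" using k by simp
  moreover have "finite ?U" by simp
  ultimately have "\<not> {..<n} \<subseteq> ?U" using card_mono[of ?U "{..<n}"] by auto
  then obtain i where i: "i < n" "i \<notin> ?U" by auto
  have "(\<Sum>j<n. a i j * y j) = 0" using eqm_row_nonzero[OF e i(1)] i by blast
  then show ?thesis using eqm_row(1)[OF e i(1)] by simp
qed

text \<open>The restricted row sums are either full or zero, and zero is admissible since
  \<open>u\<close> and \<open>v\<close> are nonnegative. For \<open>u = 0\<close> only
  \<open>y\<close> is restricted. For \<open>u > 0\<close> also \<open>x\<close> is restricted, to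
  the rows touching the component; then each supporting row meets some supporting column, which
  keeps the column sums from mixing two components.\<close>

lemma min_eqm_connected:
  assumes m: "min_eqm k n a b x y u v" and sa: "sparse_fun l n a" and sb: "sparse_fun l n b"
    and kl: "k * l < n"
  shows "\<exists>j0\<in>supp n y. \<forall>j\<in>supp n y.
    (j0, j) \<in> {(p, q). p \<in> supp n y \<and> q \<in> supp n y \<and> adj4 n a b p q}\<^sup>*"
proof -
  let ?J = "supp n y"
  let ?R = "{(p, q). p \<in> ?J \<and> q \<in> ?J \<and> adj4 n a b p q}"
  have e: "eqm n a b x y u v" using m by (simp add: min_eqm_def)
  have Jn: "j < n" if "j \<in> ?J" for j using that by (simp add: supp_def)
  have u: "0 \<le> u" using eqm_payoff_nonneg[OF e sa _ kl] m by (simp add: min_eqm_def)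
  have v: "0 \<le> v" using eqm_payoff_nonneg[OF e[unfolded eqm_swap[of n a]] sb _ kl] m by (simp add: min_eqm_def)
  define reach where "reach j0 = {j. (j0, j) \<in> ?R\<^sup>*} \<inter> ?J" for j0
  have reach0: "j0 \<in> reach j0" if "j0 \<in> ?J" for j0 using that by (simp add: reach_def)
  have closed: "q \<in> reach j0" if "p \<in> reach j0" "q \<in> ?J" "adj4 n a b p q" for j0 p q
    using that unfolding reach_def by (auto intro: rtrancl_into_rtrancl)
  \<comment> \<open>Another supporting column with an entry in this row would share the row with
    \<open>j\<close>, hence be at distance two and in the same component.\<close>
  have rowa: "(\<Sum>j\<in>reach j0. a i j * y j) = (\<Sum>j<n. a i j * y j)"
    if "j \<in> reach j0" "touch a b i j" "i < n" for i j j0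
  proof (rule restricted_sum[OF e])
    show "reach j0 \<subseteq> ?J" by (auto simp: reach_def)
    fix j' assume j': "j' \<in> ?J - reach j0"
    show "a i j' = 0"
    proof (rule ccontr)
      assume "a i j' \<noteq> 0"
      then have "adj4 n a b j j'" using that j' Jn
        by (intro adj2_imp_adj4) (auto simp: adj2_def touch_def)
      then show False using closed[OF that(1)] j' by blast
    qed
  qed
  have row0: "(\<Sum>j\<in>reach j0. a i j * y j) = 0" if "\<not> (\<exists>j\<in>reach j0. touch a b i j)" for i j0
    using that by (intro sum.neutral) (auto simp: touch_def)
  have rowle: "(\<Sum>j\<in>reach j0. a i j * y j) \<le> u" if "i < n" for i j0
    using rowa[of _ j0 i] row0[of j0 i] eqm_row(1)[OF e that] u that by fastforce
  obtain j0 where j0: "j0 \<in> ?J" and all: "?J = reach j0"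
  proof (cases "u = 0")
    case True
    obtain j0 where j0: "j0 \<in> ?J" using eqm_supp(2)[OF e] by blast
    have "reach j0 = ?J"
    proof (rule min_eqm_restrict(2)[OF m, where K = "supp n x"])
      show "(\<Sum>j\<in>reach j0. a i j * y j) = u" if "i \<in> supp n x" for i
        using rowa[of _ j0 i] row0[of j0 i] eqm_row(2)[OF e that] that True by (fastforce simp: supp_def)
      show "(\<Sum>i\<in>supp n x. b j i * x i) \<le> v" if "j < n" for j
        using eqm_row(3)[OF e that] restricted_sum[OF e[unfolded eqm_swap[of n a]], of "supp n x" "b j"] by simp
      show "(\<Sum>i\<in>supp n x. b j i * x i) = v" if "j \<in> reach j0" for j
        using eqm_row(4)[OF e, of j] restricted_sum[OF e[unfolded eqm_swap[of n a]], of "supp n x" "b j"] that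
        by (simp add: reach_def)
    qed (use rowle reach0[OF j0] eqm_supp(1)[OF e] in \<open>auto simp: reach_def\<close>)
    then show ?thesis using j0 by (intro that[of j0]) simp_all
  next
    case False
    then have up: "0 < u" using u by simp
    have nb: "\<exists>j\<in>?J. a i j \<noteq> 0" if "i \<in> supp n x" for i
      using eqm_row_nonzero[OF e, of i] eqm_row(2)[OF e that] up that by (simp add: supp_def)
    \<comment> \<open>Starting from a supporting row and one of its nonzero entries guarantees that
      \<open>K\<close> is nonempty.\<close>
    obtain i0 where i0: "i0 \<in> supp n x" using eqm_supp(1)[OF e] by blast
    obtain j0 where j0: "j0 \<in> ?J" "a i0 j0 \<noteq> 0" using nb[OF i0] by blast
    define K where "K = {i\<in>supp n x. \<exists>j\<in>reach j0. touch a b i j}"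
    \<comment> \<open>If a row \<open>i\<close> in \<open>K\<close> and a supporting row
      \<open>i'\<close> outside it both had an entry of \<open>b\<close> in column \<open>j\<close>,
      then \<open>j1\<close>, \<open>i\<close>, \<open>j\<close>, \<open>i'\<close>,
      \<open>j2\<close> would be a path of length four from the component to a supporting column
      \<open>j2\<close>, which puts \<open>i'\<close> into \<open>K\<close>. Such a
      \<open>j2\<close> exists because \<open>u > 0\<close>.\<close>
    have colb: "(\<Sum>i\<in>K. b j i * x i) = (\<Sum>i<n. b j i * x i)" if i: "i \<in> K" "b j i \<noteq> 0" and j: "j < n" for i j
    proof (rule restricted_sum[OF e[unfolded eqm_swap[of n a]]])
      show "K \<subseteq> supp n x" by (auto simp: K_def)
      fix i' assume i': "i' \<in> supp n x - K"
      show "b j i' = 0"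
      proof (rule ccontr)
        assume b: "b j i' \<noteq> 0"
        obtain j1 where j1: "j1 \<in> reach j0" "touch a b i j1" using i by (auto simp: K_def)
        obtain j2 where j2: "j2 \<in> ?J" "a i' j2 \<noteq> 0" using nb i' by blast
        have "adj2 n a b j1 j" using i j1 by (auto simp: adj2_def touch_def K_def supp_def)
        moreover have "adj2 n a b j j2" using b j2 i' by (auto simp: adj2_def touch_def supp_def)
        ultimately have "adj4 n a b j1 j2" using j by (auto simp: adj4_def)
        then have "j2 \<in> reach j0" using closed j1(1) j2(1) by blast
        then show False using i' j2 by (auto simp: K_def touch_def)
      qed
    qed
    have col0: "(\<Sum>i\<in>K. b j i * x i) = 0" if "\<not> (\<exists>i\<in>K. b j i \<noteq> 0)" for j
      using that by (intro sum.neutral) auto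
    have "reach j0 = ?J"
    proof (rule min_eqm_restrict(2)[OF m, where K = K])
      show "K \<noteq> {}" using i0 j0 reach0 by (auto simp: K_def touch_def)
      show "(\<Sum>j\<in>reach j0. a i j * y j) = u" if "i \<in> K" for i
        using rowa[of _ j0 i] eqm_row(2)[OF e, of i] that by (auto simp: K_def supp_def)
      show "(\<Sum>i\<in>K. b j i * x i) \<le> v" if "j < n" for j
        using colb[of _ j] col0[of j] eqm_row(3)[OF e that] v that by fastforce
      show "(\<Sum>i\<in>K. b j i * x i) = v" if j: "j \<in> reach j0" for j
      proof (cases "\<exists>i\<in>K. b j i \<noteq> 0")
        case True
        then show ?thesis using colb[of _ j] eqm_row(4)[OF e, of j] j Jn by (auto simp: reach_def)
      next
        case False
        \<comment> \<open>Any supporting row with an entry of \<open>b\<close> in column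
          \<open>j\<close> touches the component and lies in \<open>K\<close>; here there is none,
          so the full sum vanishes and \<open>v = 0\<close>.\<close>
        have "b j i = 0" if "i \<in> supp n x" for i
          using False j that by (auto simp: K_def touch_def)
        then have "(\<Sum>i<n. b j i * x i) = 0"
          using restricted_sum[OF e[unfolded eqm_swap[of n a]], of "{}" "b j"] by simp
        then show ?thesis using eqm_row(4)[OF e, of j] j col0[OF False] by (simp add: reach_def)
      qed
    qed (use rowle reach0[OF j0(1)] in \<open>auto simp: reach_def K_def\<close>)
    then show ?thesis using j0 by (intro that[of j0]) simp_all
  qed
  then show ?thesis unfolding reach_def by blast
qed

text \<open>A depth-first traversal: each new vertex is visited by a detour of two steps.\<close>

lemma connected_walk:
  assumes fin: "finite J" and j0: "j0 \<in> J" and sym: "\<And>p q. E p q \<Longrightarrow> E q p"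
    and conn: "\<forall>j\<in>J. (j0, j) \<in> {(p, q). p \<in> J \<and> q \<in> J \<and> E p q}\<^sup>*"
  shows "\<exists>ws. ws \<noteq> [] \<and> set ws = J \<and> successively E ws \<and> length ws < 2 * card J"
proof -
  have "\<exists>ws. j0 \<in> set ws \<and> set ws \<subseteq> J \<and> successively E ws \<and> card (set ws) = Suc m \<and> length ws = Suc (2 * m)"
    if "Suc m \<le> card J" for m
    using that
  proof (induction m)
    case 0
    then show ?case using j0 by (intro exI[of _ "[j0]"]) auto
  next
    case (Suc m)
    then obtain ws where ws: "j0 \<in> set ws" "set ws \<subseteq> J" "successively E ws" "card (set ws) = Suc m"
      "length ws = Suc (2 * m)" by auto
    \<comment> \<open>Otherwise the visited set would be closed under the edges inside
      \<open>J\<close> and contain everything reachable from \<open>j0\<close>.\<close>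
    have "\<exists>p\<in>set ws. \<exists>q\<in>J - set ws. E p q"
    proof (rule ccontr)
      assume neg: "\<not> ?thesis"
      have "j \<in> set ws" if "(j0, j) \<in> {(p, q). p \<in> J \<and> q \<in> J \<and> E p q}\<^sup>*" for j
        using that by (induction rule: rtrancl_induct) (use ws neg in auto)
      then have "J \<subseteq> set ws" using conn by blast
      then have "card J \<le> card (set ws)" by (intro card_mono) auto
      then show False using ws Suc.prems by simp
    qed
    then obtain p q where pq: "p \<in> set ws" "q \<in> J - set ws" "E p q" by blast
    obtain us vs where uv: "ws = us @ p # vs" using pq(1) by (meson split_list)
    let ?ws = "us @ [p, q, p] @ vs"
    have "successively E ?ws"
      using ws(3) pq(3) sym[OF pq(3)] unfolding uv
      by (auto simp: successively_append_iff successively_Cons)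
    moreover have "set ?ws = insert q (set ws)" by (auto simp: uv)
    ultimately show ?case using ws pq uv by (intro exI[of _ ?ws]) auto
  qed
  from this[of "card J - 1"] obtain ws where ws: "j0 \<in> set ws" "set ws \<subseteq> J" "successively E ws"
    "card (set ws) = card J" "length ws = Suc (2 * (card J - 1))"
    using fin j0 by (metis Suc_pred' card_gt_0_iff empty_iff order_refl)
  have "set ws = J" using ws fin by (intro card_subset_eq) auto
  moreover have "card J > 0" using fin j0 by (auto simp: card_gt_0_iff)
  ultimately show ?thesis using ws by (intro exI[of _ ws]) auto
qed

section \<open>Matrices with at most one nonzero entry per row and column\<close>

lemma sparse_fun_1:
  assumes "sparse_fun 1 n a"
  shows "a i j \<noteq> 0 \<Longrightarrow> a i j' \<noteq> 0 \<Longrightarrow> i < n \<Longrightarrow> j < n \<Longrightarrow> j' < n \<Longrightarrow> j = j'"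
    and "a i j \<noteq> 0 \<Longrightarrow> a i' j \<noteq> 0 \<Longrightarrow> i < n \<Longrightarrow> i' < n \<Longrightarrow> j < n \<Longrightarrow> i = i'"
proof -
  assume h: "a i j \<noteq> 0" "a i j' \<noteq> 0" "i < n" "j < n" "j' < n"
  have "card {j. j < n \<and> a i j \<noteq> 0} \<le> 1" using assms h unfolding sparse_fun_def by blast
  then show "j = j'" using h by (auto simp: card_le_Suc0_iff_eq)
next
  assume h: "a i j \<noteq> 0" "a i' j \<noteq> 0" "i < n" "i' < n" "j < n"
  have "card {i. i < n \<and> a i j \<noteq> 0} \<le> 1" using assms h unfolding sparse_fun_def by blast
  then show "i = i'" using h by (auto simp: card_le_Suc0_iff_eq)
qed

text \<open>Each column can serve only one row, so \<open>n\<close> rows need \<open>n\<close>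
  columns.\<close>

lemma sparse_fun_1_full:
  assumes "sparse_fun 1 n a" "J \<subseteq> {..<n}" "\<And>i. i < n \<Longrightarrow> \<exists>j\<in>J. a i j \<noteq> 0"
  shows "J = {..<n}"
proof -
  obtain h where h: "\<And>i. i < n \<Longrightarrow> h i \<in> J \<and> a i (h i) \<noteq> 0" using assms(3) by metis
  have "inj_on h {..<n}"
  proof (rule inj_onI)
    fix i i' assume *: "i \<in> {..<n}" "i' \<in> {..<n}" "h i = h i'"
    then show "i = i'" using h[of i] h[of i'] assms(2) sparse_fun_1(2)[OF assms(1), of i "h i" i'] by auto
  qed
  moreover have "h ` {..<n} \<subseteq> J" using h by auto
  moreover have "finite J" using assms(2) by (rule finite_subset) simp
  ultimately have "card {..<n} \<le> card J" by (metis card_inj_on_le)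
  then show ?thesis using assms(2) by (metis card_seteq finite_lessThan)
qed

text \<open>Each payoff sum has at most one nonzero term, so the signs of the payoffs decide which
  restrictions are possible. A negative payoff forces an entry in every row or column and ends in
  the full set; a zero payoff lets the support shrink to one column; if both payoffs are positive,
  the nonzero entries match the two supports in both directions, and minimality leaves a single
  cycle.\<close>

lemma min_eqm_sparse_1:
  assumes m: "min_eqm k n a b x y u v" and sa: "sparse_fun 1 n a" and sb: "sparse_fun 1 n b"
  shows "supp n y = {..<n} \<or>
    (\<exists>ws. ws \<noteq> [] \<and> set ws = supp n y \<and> successively (adj1 n a b) ws \<and> length ws \<le> n)"
proof -
  let ?J = "supp n y" and ?I = "supp n x"
  have e: "eqm n a b x y u v" using m by (simp add: min_eqm_def)
  have e': "eqm n b a y x v u" using e eqm_swap by blast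
  have Jn: "j < n" if "j \<in> ?J" for j using that by (simp add: supp_def)
  have In: "i < n" if "i \<in> ?I" for i using that by (simp add: supp_def)
  have single: ?thesis if "?J = {j}" for j
    using that Jn[of j] by (intro disjI2 exI[of _ "[j]"]) auto
  have suma: "(\<Sum>j\<in>C. a i j * y j) = (\<Sum>j<n. a i j * y j)"
    if "C \<subseteq> ?J" "j \<in> C" "a i j \<noteq> 0" "i < n" for C i j
    by (rule restricted_sum[OF e that(1)])
      (use that Jn sparse_fun_1(1)[OF sa that(3) _ that(4)] in blast)
  have sumb: "(\<Sum>i\<in>K. b j i * x i) = (\<Sum>i<n. b j i * x i)"
    if "K \<subseteq> ?I" "i \<in> K" "b j i \<noteq> 0" "j < n" for K i j
    by (rule restricted_sum[OF e' that(1)])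
      (use that In sparse_fun_1(1)[OF sb that(3) _ that(4)] in blast)
  have suma0: "(\<Sum>j\<in>C. a i j * y j) = 0" if "\<not> (\<exists>j\<in>C. a i j \<noteq> 0)" for C i
    using that by (intro sum.neutral) auto
  have sumb0: "(\<Sum>i\<in>K. b j i * x i) = 0" if "\<not> (\<exists>i\<in>K. b j i \<noteq> 0)" for K j
    using that by (intro sum.neutral) auto
  have sumale: "(\<Sum>j\<in>C. a i j * y j) \<le> u" if "0 \<le> u" "C \<subseteq> ?J" "i < n" for C i
    using suma[OF that(2) _ _ that(3)] suma0[of C i] eqm_row(1)[OF e that(3)] that(1) by fastforce
  have sumble: "(\<Sum>i\<in>K. b j i * x i) \<le> v" if "0 \<le> v" "K \<subseteq> ?I" "j < n" for K j
    using sumb[OF that(2) _ _ that(3)] sumb0[of K j] eqm_row(3)[OF e that(3)] that(1) by fastforce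
  have fullx: "(\<Sum>i\<in>?I. b j i * x i) = (\<Sum>i<n. b j i * x i)" for j
    by (rule restricted_sum[OF e']) auto
  consider "u < 0" | "u = 0" | "0 < u" "v = 0" | "0 < u" "v < 0" | "0 < u" "0 < v" by linarith
  then show ?thesis
  proof cases
    case 1
    have "\<exists>j\<in>?J. a i j \<noteq> 0" if "i < n" for i
      using eqm_row_nonzero[OF e that] eqm_row(1)[OF e that] 1 by linarith
    then show ?thesis using sparse_fun_1_full[OF sa eqm_supp(4)[OF e]] by blast
  next
    case 2
    obtain j0 where j0: "j0 \<in> ?J" using eqm_supp(2)[OF e] by blast
    have "{j0} = ?J"
    proof (rule min_eqm_restrict(2)[OF m, where K = ?I])
      show "(\<Sum>j\<in>{j0}. a i j * y j) = u" if "i \<in> ?I" for i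
        using suma[of "{j0}" j0 i] suma0[of "{j0}" i] eqm_row(2)[OF e that] In[OF that] 2 j0 by fastforce
      show "(\<Sum>i\<in>?I. b j i * x i) \<le> v" if "j < n" for j
        using eqm_row(3)[OF e that] fullx[of j] by simp
      show "(\<Sum>i\<in>?I. b j i * x i) = v" if "j \<in> {j0}" for j
        using eqm_row(4)[OF e, of j] fullx[of j] that j0 by simp
      show "(\<Sum>j\<in>{j0}. a i j * y j) \<le> u" if "i < n" for i
        by (rule sumale) (use 2 j0 that in auto)
    qed (use j0 eqm_supp(1)[OF e] in auto)
    then show ?thesis using single by metis
  next
    case 3
    obtain i0 where i0: "i0 \<in> ?I" using eqm_supp(1)[OF e] by blast
    obtain j0 where j0: "j0 \<in> ?J" "a i0 j0 \<noteq> 0"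
      using eqm_row_nonzero[OF e In[OF i0]] eqm_row(2)[OF e i0] 3 by auto
    have "{j0} = ?J"
    proof (rule min_eqm_restrict(2)[OF m, where K = "{i0}"])
      show "(\<Sum>j\<in>{j0}. a i j * y j) = u" if "i \<in> {i0}" for i
        using suma[of "{j0}" j0 i] eqm_row(2)[OF e i0] In[OF i0] j0 that by simp
      show "(\<Sum>j\<in>{j0}. a i j * y j) \<le> u" if "i < n" for i
        by (rule sumale) (use 3 j0 that in auto)
      show "(\<Sum>i\<in>{i0}. b j i * x i) \<le> v" if "j < n" for j
        by (rule sumble) (use 3 i0 that in auto)
      show "(\<Sum>i\<in>{i0}. b j i * x i) = v" if "j \<in> {j0}" for j
        using sumb[of "{i0}" i0 j] sumb0[of "{i0}" j] eqm_row(4)[OF e, of j] 3 i0 that j0 Jn[of j0] by fastforce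
    qed (use i0 j0 in auto)
    then show ?thesis using single by metis
  next
    case 4
    have "\<exists>i\<in>?I. b j i \<noteq> 0" if "j < n" for j
      using eqm_row_nonzero[OF e' that] eqm_row(3)[OF e that] 4 by linarith
    then have "?I = {..<n}" using sparse_fun_1_full[OF sb eqm_supp(3)[OF e]] by blast
    then have "\<exists>j\<in>?J. a i j \<noteq> 0" if "i < n" for i
      using eqm_row_nonzero[OF e that] eqm_row(2)[OF e, of i] 4 that by simp
    then show ?thesis using sparse_fun_1_full[OF sa eqm_supp(4)[OF e]] by blast
  next
    case 5
    have "\<exists>j\<in>?J. a i j \<noteq> 0" if "i \<in> ?I" for i
      using eqm_row_nonzero[OF e In[OF that]] eqm_row(2)[OF e that] 5 by simp
    then obtain h where h: "\<And>i. i \<in> ?I \<Longrightarrow> h i \<in> ?J \<and> a i (h i) \<noteq> 0" by metis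
    have "\<exists>i\<in>?I. b j i \<noteq> 0" if "j \<in> ?J" for j
      using eqm_row_nonzero[OF e' Jn[OF that]] eqm_row(4)[OF e that] 5 by simp
    then obtain h' where h': "\<And>j. j \<in> ?J \<Longrightarrow> h' j \<in> ?I \<and> b j (h' j) \<noteq> 0" by metis
    have inj: "inj_on h ?I" by (rule inj_onI) (metis h In Jn sparse_fun_1(2)[OF sa])
    have inj': "inj_on h' ?J" by (rule inj_onI) (metis h' In Jn sparse_fun_1(2)[OF sb])
    have im: "h ` ?I \<subseteq> ?J" "h' ` ?J \<subseteq> ?I" using h h' by auto
    have "card ?I = card ?J"
      using card_inj_on_le[OF inj im(1) finite_supp] card_inj_on_le[OF inj' im(2) finite_supp] by simp
    then have surj: "h ` ?I = ?J" "h' ` ?J = ?I"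
      using card_subset_eq[OF finite_supp im(1)] card_subset_eq[OF finite_supp im(2)]
        card_image[OF inj] card_image[OF inj'] by auto
    \<comment> \<open>The walk goes from a column to the row of its entry in \<open>a\<close> and on
      to the column of that row's entry in \<open>b\<close>. The choices \<open>h\<close> and
      \<open>h'\<close> run the other way round, hence the inverses.\<close>
    define f where "f = inv_into ?I h"
    define g where "g = inv_into ?J h'"
    have f: "f j \<in> ?I \<and> a (f j) j \<noteq> 0" if "j \<in> ?J" for j
      using that surj(1) h unfolding f_def by (metis f_inv_into_f inv_into_into)
    have g: "g i \<in> ?J \<and> b (g i) i \<noteq> 0" if "i \<in> ?I" for i
      using that surj(2) h' unfolding g_def by (metis f_inv_into_f inv_into_into)
    obtain j0 where j0: "j0 \<in> ?J" using eqm_supp(2)[OF e] by blast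
    define s where "s t = ((\<lambda>j. g (f j)) ^^ t) j0" for t
    have sJ: "s t \<in> ?J" for t by (induction t) (use j0 f g in \<open>auto simp: s_def\<close>)
    have sS: "s (Suc t) = g (f (s t))" for t by (simp add: s_def)
    \<comment> \<open>Pigeonhole: the orbit takes \<open>card ?J + 1\<close> values inside
      \<open>?J\<close>, so it closes up, and the part between two equal values is a cycle
      \<open>C\<close>.\<close>
    have "\<not> inj_on s {..card ?J}"
    proof
      assume "inj_on s {..card ?J}"
      moreover have "s ` {..card ?J} \<subseteq> ?J" using sJ by auto
      ultimately have "card {..card ?J} \<le> card ?J" by (metis card_inj_on_le finite_supp)
      then show False by simp
    qed
    then obtain p' q' where "p' \<le> card ?J" "q' \<le> card ?J" "p' \<noteq> q'" "s p' = s q'"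
      unfolding inj_on_def by auto
    then obtain p q where pq: "p < q" "q \<le> card ?J" "s p = s q" by (metis linorder_neqE_nat)
    define C where "C = s ` {p..<q}"
    have CJ: "C \<subseteq> ?J" using sJ by (auto simp: C_def)
    have next_C: "g (f j) \<in> C" if jC: "j \<in> C" for j
    proof -
      obtain t where t: "p \<le> t" "t < q" "j = s t" using jC by (auto simp: C_def)
      show ?thesis
      proof (cases "Suc t = q")
        case True
        then have "g (f j) = s p" using t pq sS[of t] by simp
        moreover have "p \<in> {p..<q}" using pq by simp
        ultimately show ?thesis unfolding C_def by (metis imageI)
      next
        case False
        then have "Suc t \<in> {p..<q}" using t by simp
        then show ?thesis unfolding C_def t(3) sS[symmetric] by (rule imageI)
      qed
    qed
    have prev_C: "\<exists>j'\<in>C. j = g (f j')" if jC: "j \<in> C" for j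
    proof -
      obtain t where t: "p \<le> t" "t < q" "j = s t" using jC by (auto simp: C_def)
      show ?thesis
      proof (cases "t = p")
        case True
        obtain q1 where "q = Suc q1" using pq(1) by (cases q) auto
        then have "j = g (f (s q1))" "q1 \<in> {p..<q}" using True t pq sS[of q1] by auto
        then show ?thesis unfolding C_def by blast
      next
        case False
        then obtain t1 where "t = Suc t1" using t(1) by (cases t) auto
        then have "j = g (f (s t1))" "t1 \<in> {p..<q}" using t False sS[of t1] by auto
        then show ?thesis unfolding C_def by blast
      qed
    qed
    have "C = ?J"
    proof (rule min_eqm_restrict(2)[OF m, where K = "f ` C"])
      show KI: "f ` C \<subseteq> ?I" using f CJ by auto
      show "(\<Sum>j\<in>C. a i j * y j) = u" if i: "i \<in> f ` C" for i
      proof -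
        obtain j where j: "j \<in> C" "i = f j" using i by blast
        show ?thesis using suma[OF CJ j(1), of i] eqm_row(2)[OF e, of i] f[of j] j CJ In by auto
      qed
      show "(\<Sum>i\<in>f ` C. b j i * x i) = v" if j: "j \<in> C" for j
      proof -
        \<comment> \<open>The payoff of column \<open>j\<close> is supplied by the row of its
          predecessor on the cycle.\<close>
        obtain j' where j': "j' \<in> C" "j = g (f j')" using prev_C[OF j] by blast
        then show ?thesis using sumb[OF KI, of "f j'" j] eqm_row(4)[OF e, of j] g[of "f j'"] f[of j'] j CJ Jn by auto
      qed
      show "C \<noteq> {}" using pq by (auto simp: C_def)
      then show "f ` C \<noteq> {}" by simp
      show "(\<Sum>j\<in>C. a i j * y j) \<le> u" if "i < n" for i by (rule sumale) (use 5 CJ that in auto)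
      show "(\<Sum>i\<in>f ` C. b j i * x i) \<le> v" if "j < n" for j by (rule sumble) (use 5 KI that in auto)
    qed (rule CJ)
    have "successively (adj1 n a b) (map s [p..<q])"
      unfolding successively_conv_nth
    proof (intro allI impI)
      fix t assume "Suc t < length (map s [p..<q])"
      then show "adj1 n a b (map s [p..<q] ! t) (map s [p..<q] ! Suc t)"
        using f[OF sJ] g[of "f (s (p + t))"] In sS[of "p + t"] by (auto simp: adj1_def)
    qed
    moreover have "length (map s [p..<q]) \<le> n"
      using pq card_mono[OF _ eqm_supp(4)[OF e]] by simp
    ultimately show ?thesis using \<open>C = ?J\<close> pq
      by (intro disjI2 exI[of _ "map s [p..<q]"]) (auto simp: C_def)
  qed
qed

section \<open>Enumeration of candidate strategies\<close>

definition nzs :: "rat list \<Rightarrow> nat list \<Rightarrow> nat list" where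
  "nzs r idx = filter (\<lambda>j. r ! j \<noteq> 0) idx"

definition step_list :: "rat list list \<Rightarrow> nat list \<Rightarrow> nat list \<Rightarrow> nat list" where
  "step_list M idx L = concat (map (\<lambda>i. nzs (M ! i) idx) L)"

text \<open>Lists already containing \<open>x\<close> are dropped, so that only distinct row lists
  arise; the cost bound for the determinant counts on that.\<close>

definition mapcons :: "nat \<Rightarrow> nat list list \<Rightarrow> nat list list" where
  "mapcons x Ls = map ((#) x) (filter (\<lambda>L. x \<notin> set L) Ls)"

definition consall :: "nat list list \<Rightarrow> nat list \<Rightarrow> nat list list" where
  "consall Ls is = concat (map (\<lambda>i. mapcons i Ls) is)"

text \<open>\<open>Mt\<close> is the transpose, so its row \<open>j\<close> shows which rows have an
  entry in column \<open>j\<close>. In a sparse matrix at most \<open>l\<close> rows are offered per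
  column, instead of \<open>n\<close>.\<close>

fun row_choices :: "rat list list \<Rightarrow> nat list \<Rightarrow> nat list \<Rightarrow> nat list list" where
  "row_choices Mt idx [] = [[]]"
| "row_choices Mt idx (j # J) = consall (row_choices Mt idx J) (nzs (Mt ! j) idx)"

abbreviation entry :: "rat list list \<Rightarrow> nat \<Rightarrow> nat \<Rightarrow> rat" where
  "entry M i j \<equiv> M ! i ! j"

text \<open>The numerators of Cramer's rule: signed bordered minors, each omitting one
  column.\<close>

definition weights :: "rat list list \<Rightarrow> nat list \<Rightarrow> (rat \<times> nat \<times> nat list) list \<Rightarrow> (nat \<times> rat) list" where
  "weights M I sp = map (\<lambda>(s, j, R). (j, s * det1 (entry M) I R)) sp"

fun assoc :: "nat \<Rightarrow> (nat \<times> rat) list \<Rightarrow> rat" where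
  "assoc j [] = 0"
| "assoc j (p # W) = (if fst p = j then snd p else assoc j W)"

text \<open>A row choice of total zero does not determine a strategy; the empty list stands for no
  candidate.\<close>

definition normalize :: "nat list \<Rightarrow> (nat \<times> rat) list \<Rightarrow> rat list list" where
  "normalize idx W = (let t = sum_list (map snd W) in
     if t = 0 then [] else [map (\<lambda>j. assoc j W / t) idx])"

definition cand :: "rat list list \<Rightarrow> nat list \<Rightarrow> nat list \<Rightarrow> nat list \<Rightarrow> rat list list" where
  "cand M idx J I = normalize idx (weights M I (splits_of J))"

text \<open>The rows for \<open>tl J\<close> come from the nonzero entries; the row put in front of
  them by \<open>consall\<close> belongs to the column of ones and runs over all of
  \<open>idx\<close>.\<close>

definition cand_set :: "rat list list \<Rightarrow> rat list list \<Rightarrow> nat list \<Rightarrow> nat list \<Rightarrow> rat list list" where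
  "cand_set M Mt idx J = (if J = [] then [] else
     concat (map (cand M idx J) (consall (row_choices Mt idx (tl J)) idx)))"

definition ins :: "nat \<Rightarrow> nat list \<Rightarrow> nat list" where
  "ins j S = (if j \<in> set S then S else j # S)"

definition ext :: "nat list \<Rightarrow> nat list \<Rightarrow> (nat \<times> nat list) list" where
  "ext S ns = map (\<lambda>j. (j, ins j S)) ns"

definition ext_all :: "(nat \<Rightarrow> nat list) \<Rightarrow> (nat \<times> nat list) list \<Rightarrow> (nat \<times> nat list) list" where
  "ext_all N W = concat (map (\<lambda>(c, S). ext S (N c)) W)"

text \<open>A pair records the end of a walk and the columns it has visited, the only data on which
  its continuations and its result depend. All levels are kept, since shorter walks count as
  well.\<close>

fun levels :: "(nat \<Rightarrow> nat list) \<Rightarrow> nat \<Rightarrow> (nat \<times> nat list) list \<Rightarrow> (nat \<times> nat list) list" where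
  "levels N 0 W = W"
| "levels N (Suc m) W = W @ levels N m (ext_all N W)"

definition spread :: "nat list \<Rightarrow> rat list list \<Rightarrow> rat list list \<Rightarrow> rat list list \<Rightarrow> rat list list \<Rightarrow> nat list \<Rightarrow> nat list" where
  "spread idx A At B Bt L = (let R = step_list At idx L @ step_list Bt idx L in
     step_list A idx R @ step_list B idx R)"

definition nbrs :: "nat \<Rightarrow> nat list \<Rightarrow> rat list list \<Rightarrow> rat list list \<Rightarrow> rat list list \<Rightarrow> rat list list \<Rightarrow> nat \<Rightarrow> nat list" where
  "nbrs l idx A At B Bt j = (if l < 2 then step_list B idx (step_list At idx [j])
     else spread idx A At B Bt (spread idx A At B Bt [j]))"

fun subs :: "nat list \<Rightarrow> nat list list" where
  "subs [] = [[]]"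
| "subs (x # xs) = mapcons x (subs xs) @ subs xs"

text \<open>For \<open>l = 1\<close> a column of a sparse game has at most one successor, so
  \<open>length idx\<close> rounds do not multiply the walks; the list \<open>idx\<close> itself is
  added because negative payoffs force the full support.\<close>

definition col_sets :: "nat \<Rightarrow> nat \<Rightarrow> nat list \<Rightarrow> rat list list \<Rightarrow> rat list list \<Rightarrow> rat list list \<Rightarrow> rat list list \<Rightarrow> nat list list" where
  "col_sets k l idx A At B Bt = (let W = map (\<lambda>j. (j, [j])) idx; N = nbrs l idx A At B Bt in
     if l < 2 then idx # map snd (levels N (length idx) W)
     else if k * l < length idx then map snd (levels N (2 * k) W)
     else subs idx)"

definition cands :: "nat \<Rightarrow> nat \<Rightarrow> nat list \<Rightarrow> rat list list \<Rightarrow> rat list list \<Rightarrow> rat list list \<Rightarrow> rat list list \<Rightarrow> rat list list" where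
  "cands k l idx A At B Bt = concat (map (cand_set A At idx) (col_sets k l idx A At B Bt))"

section \<open>Completeness of the enumeration\<close>

lemma set_nzs: "set (nzs r idx) = {j \<in> set idx. r ! j \<noteq> 0}"
  by (auto simp: nzs_def)

lemma set_step_list: "set (step_list M idx L) = {j \<in> set idx. \<exists>i\<in>set L. M ! i ! j \<noteq> 0}"
  by (auto simp: step_list_def set_nzs)

lemma mem_consall: "L \<in> set (consall Ls is) \<longleftrightarrow> (\<exists>i L'. L = i # L' \<and> i \<in> set is \<and> L' \<in> set Ls \<and> i \<notin> set L')"
  by (auto simp: consall_def mapcons_def)

lemma row_choices_mem:
  assumes "list_all2 (\<lambda>i j. Mt ! j ! i \<noteq> 0) I J" "distinct I" "set I \<subseteq> set idx"
  shows "I \<in> set (row_choices Mt idx J)"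
  using assms
proof (induction J arbitrary: I rule: list.induct)
  case (Cons j J)
  from Cons.prems(1) obtain i I' where "I = i # I'" by (auto simp: list_all2_Cons2)
  then show ?case using Cons by (auto simp: mem_consall set_nzs)
qed auto

lemma row_choices_elem:
  assumes "I \<in> set (row_choices Mt idx J)"
  shows "length I = length J" "distinct I" "set I \<subseteq> set idx"
  using assms by (induction J arbitrary: I) (force simp: mem_consall set_nzs)+

lemma levels_append_mem: "q \<in> set W \<Longrightarrow> q \<in> set (levels N m W)"
  by (cases m) auto

lemma walk_in_levels:
  assumes "(c, S) \<in> set W" "successively (\<lambda>p q. q \<in> set (N p)) (c # ws)" "length ws \<le> m" "distinct S"
  shows "\<exists>c' S'. (c', S') \<in> set (levels N m W) \<and> distinct S' \<and> set S' = set S \<union> set ws"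
  using assms
proof (induction ws arbitrary: c S W m)
  case Nil
  then show ?case using levels_append_mem[of "(c, S)" W N m] by auto
next
  case (Cons c' ws)
  then obtain m' where m: "m = Suc m'" by (cases m) auto
  have "(c', ins c' S) \<in> set (ext_all N W)"
    using Cons.prems(1,2) by (force simp: ext_all_def ext_def successively_Cons)
  moreover have "distinct (ins c' S)" using Cons.prems(4) by (simp add: ins_def)
  moreover have "successively (\<lambda>p q. q \<in> set (N p)) (c' # ws)" "length ws \<le> m'"
    using Cons.prems(2,3) m by (simp_all add: successively_Cons)
  ultimately obtain c'' S' where "(c'', S') \<in> set (levels N m' (ext_all N W))" "distinct S'"
    "set S' = set (ins c' S) \<union> set ws" using Cons.IH[of c' "ins c' S" "ext_all N W" m'] by blast
  moreover have "set (ins c' S) = insert c' (set S)" by (auto simp: ins_def)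
  ultimately show ?case by (intro exI[of _ c''] exI[of _ S']) (auto simp: m)
qed

lemma subs_mem: "distinct xs \<Longrightarrow> filter P xs \<in> set (subs xs)"
  by (induction xs) (auto simp: mapcons_def)

lemma assoc_eq: "distinct (map fst W) \<Longrightarrow> (j, q) \<in> set W \<Longrightarrow> assoc j W = q"
  by (induction W) force+

lemma assoc_notin: "j \<notin> fst ` set W \<Longrightarrow> assoc j W = 0"
  by (induction W) auto

lemma of_rat_sum_list: "of_rat (sum_list xs) = (\<Sum>x\<leftarrow>xs. (of_rat x :: real))"
  by (induction xs) (auto simp: of_rat_add)

lemma splits_of_of_rat: "(splits_of I :: (real \<times> 'i \<times> 'i list) list) = map (\<lambda>(s, i, R). (of_rat s, i, R)) (splits_of I)"
  by (induction I) (auto simp: o_def case_prod_beta of_rat_minus)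

lemma of_rat_laplace_det: "real_of_rat (laplace_det a I J) = laplace_det (\<lambda>i j. of_rat (a i j)) I J"
proof (induction J arbitrary: I)
  case (Cons j J)
  show ?case
    by (simp add: of_rat_sum_list splits_of_of_rat[of I] o_def case_prod_beta of_rat_mult Cons)
qed simp

lemma of_rat_det1: "real_of_rat (det1 a I J) = det1 (\<lambda>i j. of_rat (a i j)) I J"
  by (simp add: det1_def of_rat_sum_list splits_of_of_rat[of I] o_def case_prod_beta of_rat_mult of_rat_laplace_det)

definition mat_fun :: "rat list list \<Rightarrow> nat \<Rightarrow> nat \<Rightarrow> real" where
  "mat_fun M i j = of_rat (entry M i j)"

text \<open>The data produced by \<open>min_eqm_cramer\<close> are among the enumerated ones:
  \<open>I\<close> is a transversal of \<open>tl J\<close>, and \<open>c \<noteq> 0\<close> keeps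
  \<open>normalize\<close> from discarding it. As the minors are rational, the real vector
  \<open>y\<close> turns out to have rational coordinates.\<close>

lemma cands_complete:
  assumes m: "min_eqm k n (mat_fun A) b x y u v" and J: "distinct J" "set J = supp n y"
    and At: "\<And>i j. i < n \<Longrightarrow> j < n \<Longrightarrow> At ! j ! i = A ! i ! j"
  shows "\<exists>q\<in>set (cand_set A At [0..<n] J). length q = n \<and> (\<forall>j<n. real_of_rat (q ! j) = y j)"
proof -
  let ?a = "mat_fun A"
  obtain r I c where rI: "distinct (r # I)" "r < n" "set I \<subseteq> {..<n}"
      "list_all2 (\<lambda>i j. ?a i j \<noteq> 0) I (tl J)"
    and c: "c \<noteq> 0" "(\<Sum>(s, j, R)\<leftarrow>splits_of J. s * det1 ?a (r # I) R) = c"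
      "\<And>s j R. (s, j, R) \<in> set (splits_of J) \<Longrightarrow> s * det1 ?a (r # I) R = c * y j"
    using min_eqm_cramer[OF m J] by blast
  have e: "eqm n ?a b x y u v" using m by (simp add: min_eqm_def)
  have Jn: "set J \<subseteq> {..<n}" using J by (auto simp: supp_def)
  have "J \<noteq> []" using J eqm_supp(2)[OF e] by auto
  have tlJ: "set (tl J) \<subseteq> {..<n}" using Jn \<open>J \<noteq> []\<close> by (metis list.set_sel(2) subset_iff)
  have "list_all2 (\<lambda>i j. At ! j ! i \<noteq> 0) I (tl J)"
    using rI(3,4) tlJ At by (auto simp: list_all2_conv_all_nth mat_fun_def subset_iff)
  then have "I \<in> set (row_choices At [0..<n] (tl J))"
    using rI by (intro row_choices_mem) (auto simp: atLeast0LessThan)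
  then have rI': "r # I \<in> set (consall (row_choices At [0..<n] (tl J)) [0..<n])"
    using rI by (auto simp: mem_consall)
  let ?W = "weights A (r # I) (splits_of J)"
  have det: "real_of_rat (det1 (entry A) I R) = det1 ?a I R" for I R
    unfolding of_rat_det1 mat_fun_def[abs_def] ..
  have fst: "map fst ?W = J"
    unfolding weights_def by (simp only: map_map o_def case_prod_beta fst_conv snd_conv map_splits_of_index[unfolded case_prod_beta])
  have Wc: "real_of_rat q = c * y j" if "(j, q) \<in> set ?W" for j q
  proof -
    from that obtain s R where s: "(s, j, R) \<in> set (splits_of J)" "q = s * det1 (entry A) (r # I) R"
      by (auto simp: weights_def)
    have "(real_of_rat s, j, R) \<in> set (splits_of J)" using s(1) unfolding splits_of_of_rat[of J] by force
    from c(3)[OF this] show ?thesis by (simp add: s(2) of_rat_mult det)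
  qed
  have tot: "real_of_rat (sum_list (map snd ?W)) = c"
    unfolding c(2)[symmetric] of_rat_sum_list splits_of_of_rat[of J]
    by (simp add: weights_def o_def case_prod_beta of_rat_mult det)
  then have t0: "sum_list (map snd ?W) \<noteq> 0" using c(1) by auto
  define q where "q = map (\<lambda>j. assoc j ?W / sum_list (map snd ?W)) [0..<n]"
  have "q \<in> set (cand A [0..<n] J (r # I))"
    using t0 by (simp add: cand_def normalize_def q_def)
  then have "q \<in> set (cand_set A At [0..<n] J)"
    using rI' \<open>J \<noteq> []\<close> by (auto simp: cand_set_def)
  moreover have "real_of_rat (q ! j) = y j" if "j < n" for j
  proof -
    have "real_of_rat (assoc j ?W) = c * y j"
    proof (cases "j \<in> set J")
      case True
      then have "j \<in> fst ` set ?W" using fst by (metis list.set_map)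
      then obtain p where "(j, p) \<in> set ?W" by force
      then show ?thesis using assoc_eq[of ?W j p] fst J(1) Wc by simp
    next
      case False
      then have "j \<notin> fst ` set ?W" using fst by (metis list.set_map)
      moreover have "y j = 0" using False J(2) that e by (force simp: supp_def eqm_def)
      ultimately show ?thesis using assoc_notin[of j ?W] by simp
    qed
    then show ?thesis using that c(1) tot by (simp add: q_def of_rat_divide)
  qed
  ultimately show ?thesis by (intro bexI[of _ q]) (auto simp: q_def)
qed

lemma spread_adj2:
  assumes At: "\<And>i j. i < n \<Longrightarrow> j < n \<Longrightarrow> At ! j ! i = A ! i ! j"
    and Bt: "\<And>i j. i < n \<Longrightarrow> j < n \<Longrightarrow> Bt ! j ! i = B ! i ! j" and L: "set L \<subseteq> {..<n}"
  shows "set (spread [0..<n] A At B Bt L) = {j'. j' < n \<and> (\<exists>j\<in>set L. adj2 n (mat_fun A) (mat_fun Bt) j j')}"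
proof -
  define R where "R = step_list At [0..<n] L @ step_list Bt [0..<n] L"
  have R: "set R = {i. i < n \<and> (\<exists>j\<in>set L. touch (mat_fun A) (mat_fun Bt) i j)}"
  proof -
    have "At ! j ! i = A ! i ! j" if "j \<in> set L" "i < n" for i j using At that L by auto
    then show ?thesis by (auto simp: R_def set_step_list touch_def mat_fun_def)
  qed
  have "B ! i ! j = Bt ! j ! i" if "j < n" "i \<in> set R" for i j
    using Bt that unfolding R by simp
  then have "set (step_list A [0..<n] R @ step_list B [0..<n] R) =
      {j'. j' < n \<and> (\<exists>i\<in>set R. touch (mat_fun A) (mat_fun Bt) i j')}"
    by (auto simp: set_step_list touch_def mat_fun_def)
  then show ?thesis unfolding R spread_def Let_def adj2_def R_def[symmetric] by auto
qed

lemma nbrs_adj: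
  assumes At: "\<And>i j. i < n \<Longrightarrow> j < n \<Longrightarrow> At ! j ! i = A ! i ! j"
    and Bt: "\<And>i j. i < n \<Longrightarrow> j < n \<Longrightarrow> Bt ! j ! i = B ! i ! j" and j: "j < n"
  shows "l < 2 \<Longrightarrow> set (nbrs l [0..<n] A At B Bt j) = {j'. j' < n \<and> adj1 n (mat_fun A) (mat_fun Bt) j j'}"
    and "\<not> l < 2 \<Longrightarrow> set (nbrs l [0..<n] A At B Bt j) = {j'. j' < n \<and> adj4 n (mat_fun A) (mat_fun Bt) j j'}"
proof -
  show "set (nbrs l [0..<n] A At B Bt j) = {j'. j' < n \<and> adj1 n (mat_fun A) (mat_fun Bt) j j'}" if "l < 2"
  proof -
    have "At ! j ! i = A ! i ! j" "B ! i ! j' = Bt ! j' ! i" if "i < n" "j' < n" for i j'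
      using At Bt that j by auto
    then show ?thesis using that by (auto simp: nbrs_def set_step_list adj1_def mat_fun_def)
  qed
  have 1: "set (spread [0..<n] A At B Bt [j]) = {j'. j' < n \<and> adj2 n (mat_fun A) (mat_fun Bt) j j'}"
    using spread_adj2[OF At Bt, where L = "[j]"] j by simp
  then show "set (nbrs l [0..<n] A At B Bt j) = {j'. j' < n \<and> adj4 n (mat_fun A) (mat_fun Bt) j j'}" if "\<not> l < 2"
    using that spread_adj2[OF At Bt, where L = "spread [0..<n] A At B Bt [j]"]
    by (auto simp: nbrs_def adj4_def)
qed

lemma col_sets_complete:
  assumes m: "min_eqm k n (mat_fun A) (mat_fun Bt) x y u v" and l: "1 \<le> l"
    and sp: "sparse_fun l n (mat_fun A)" "sparse_fun l n (mat_fun Bt)"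
    and At: "\<And>i j. i < n \<Longrightarrow> j < n \<Longrightarrow> At ! j ! i = A ! i ! j"
    and Bt: "\<And>i j. i < n \<Longrightarrow> j < n \<Longrightarrow> Bt ! j ! i = B ! i ! j"
  shows "\<exists>J\<in>set (col_sets k l [0..<n] A At B Bt). distinct J \<and> set J = supp n y"
proof -
  let ?N = "nbrs l [0..<n] A At B Bt"
  let ?W = "map (\<lambda>j. (j, [j])) [0..<n]"
  have e: "eqm n (mat_fun A) (mat_fun Bt) x y u v" using m by (simp add: min_eqm_def)
  have Jn: "supp n y \<subseteq> {..<n}" by (rule eqm_supp(4)[OF e])
  \<comment> \<open>A walk with \<open>d\<close> steps has \<open>Suc d\<close> columns; the first
    one is supplied by \<open>?W\<close>.\<close>
  have walk: "\<exists>J\<in>set (map snd (levels ?N d ?W)). distinct J \<and> set J = supp n y"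
    if ws: "ws \<noteq> []" "set ws = supp n y" "successively E ws" "length ws \<le> Suc d"
      and N: "\<And>p q. p < n \<Longrightarrow> q < n \<Longrightarrow> E p q \<Longrightarrow> q \<in> set (?N p)" for E d ws
  proof -
    obtain c ws' where c: "ws = c # ws'" using ws(1) by (cases ws) auto
    have "successively (\<lambda>p q. q \<in> set (?N p)) ws"
      by (rule successively_mono[OF ws(3)]) (use N ws(2) Jn in auto)
    then have "\<exists>c' S'. (c', S') \<in> set (levels ?N d ?W) \<and> distinct S' \<and> set S' = set [c] \<union> set ws'"
      using ws c Jn by (intro walk_in_levels) auto
    then obtain c' S' where "(c', S') \<in> set (levels ?N d ?W)" "distinct S'" "set S' = supp n y"
      using ws(2) c by auto
    then show ?thesis by force
  qed
  consider "l < 2" | "\<not> l < 2" "k * l < n" | "\<not> l < 2" "\<not> k * l < n" by blast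
  then show ?thesis
  proof cases
    case 1
    then have l1: "l = 1" using l by simp
    from min_eqm_sparse_1[OF m sp[unfolded l1]] show ?thesis
    proof (elim disjE exE conjE)
      assume "supp n y = {..<n}"
      then show ?thesis using 1 by (auto simp: col_sets_def atLeast0LessThan)
    next
      fix ws assume "ws \<noteq> []" "set ws = supp n y" "successively (adj1 n (mat_fun A) (mat_fun Bt)) ws" "length ws \<le> n"
      then have "\<exists>J\<in>set (map snd (levels ?N n ?W)). distinct J \<and> set J = supp n y"
        using nbrs_adj(1)[OF At Bt _ 1] by (intro walk[of ws "adj1 n (mat_fun A) (mat_fun Bt)"]) auto
      then show ?thesis using 1 by (auto simp: col_sets_def)
    qed
  next
    case 2
    obtain j0 where "j0 \<in> supp n y" "\<forall>j\<in>supp n y.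
        (j0, j) \<in> {(p, q). p \<in> supp n y \<and> q \<in> supp n y \<and> adj4 n (mat_fun A) (mat_fun Bt) p q}\<^sup>*"
      using min_eqm_connected[OF m sp 2(2)] by blast
    from connected_walk[OF finite_supp this(1) adj4_sym this(2)]
    obtain ws where "ws \<noteq> []" "set ws = supp n y" "successively (adj4 n (mat_fun A) (mat_fun Bt)) ws"
      "length ws < 2 * card (supp n y)" by blast
    moreover have "card (supp n y) \<le> k" using m by (simp add: min_eqm_def)
    ultimately have "\<exists>J\<in>set (map snd (levels ?N (2 * k) ?W)). distinct J \<and> set J = supp n y"
      using nbrs_adj(2)[OF At Bt _ 2(1)] by (intro walk[of ws "adj4 n (mat_fun A) (mat_fun Bt)"]) auto
    then show ?thesis using 2 by (auto simp: col_sets_def)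
  next
    case 3
    have "filter (\<lambda>j. j \<in> supp n y) [0..<n] \<in> set (subs [0..<n])" by (rule subs_mem) simp
    moreover have "set (filter (\<lambda>j. j \<in> supp n y) [0..<n]) = supp n y" using Jn by auto
    ultimately show ?thesis using 3
      by (intro bexI[of _ "filter (\<lambda>j. j \<in> supp n y) [0..<n]"]) (auto simp: col_sets_def)
  qed
qed

section \<open>Size of rational numbers\<close>

text \<open>The fraction is not assumed reduced, which makes the notion stable under arithmetic
  without any gcd; reduction can only shorten it, see \<open>size_le_imp_rat_bits\<close>.\<close>

definition size_le :: "rat \<Rightarrow> nat \<Rightarrow> bool" where
  "size_le q s \<longleftrightarrow> (\<exists>a b :: int. 0 < b \<and> q = of_int a / of_int b \<and> \<bar>a\<bar> < 2 ^ s \<and> b < 2 ^ s)"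

lemma size_le_imp_rat_bits:
  assumes "size_le q s"
  shows "rat_bits q \<le> 2 * s"
proof -
  obtain a b :: int where ab: "0 < b" "q = of_int a / of_int b" "\<bar>a\<bar> < 2 ^ s" "b < 2 ^ s"
    using assms unfolding size_le_def by blast
  obtain p r where pr: "quotient_of q = (p, r)" by fastforce
  have r: "0 < r" "coprime p r" "q = of_int p / of_int r"
    using quotient_of_denom_pos[OF pr] quotient_of_coprime[OF pr] quotient_of_div[OF pr] by auto
  have "(of_int (a * r) :: rat) = of_int (p * b)"
    using ab(1,2) r(1,3) by (simp add: field_simps)
  then have eq: "a * r = p * b" by (simp only: of_int_eq_iff)
  have "p dvd a" using eq r(2) by (metis coprime_dvd_mult_left_iff dvd_triv_left)
  moreover have "r dvd b" using eq r(2) by (metis coprime_commute coprime_dvd_mult_right_iff dvd_triv_right)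
  ultimately have "\<bar>p\<bar> \<le> \<bar>a\<bar>" "r \<le> b"
    using eq ab(1) dvd_imp_le_int[of a p] by (cases "a = 0"; auto intro: zdvd_imp_le)+
  then have "\<bar>p\<bar> < 2 ^ s" "r < 2 ^ s" using ab by auto
  then have "nat \<bar>p\<bar> < 2 ^ s" "nat r < 2 ^ s" using r(1) by (auto simp: nat_less_iff)
  then have "floorlog 2 (nat \<bar>p\<bar>) \<le> s" "floorlog 2 (nat r) \<le> s" by (auto intro: floorlog_leI)
  then show ?thesis by (simp add: rat_bits_def pr)
qed

lemma floorlog_bound: "x < 2 ^ floorlog 2 x"
  by (rule floorlog_leD) auto

lemma rat_bits_num_den:
  assumes "quotient_of q = (p, r)"
  shows "\<bar>p\<bar> < 2 ^ rat_bits q" "r < 2 ^ rat_bits q" "0 < r" "q = of_int p / of_int r"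
proof -
  show r: "0 < r" using quotient_of_denom_pos[OF assms] .
  show "q = of_int p / of_int r" by (rule quotient_of_div[OF assms])
  have b: "rat_bits q = floorlog 2 (nat \<bar>p\<bar>) + floorlog 2 (nat r)" by (simp add: rat_bits_def assms)
  have "nat \<bar>p\<bar> < 2 ^ rat_bits q" "nat r < 2 ^ rat_bits q"
    unfolding b by (rule less_le_trans[OF floorlog_bound]; simp)+
  then show "\<bar>p\<bar> < 2 ^ rat_bits q" "r < 2 ^ rat_bits q"
    using r by (simp_all add: nat_less_iff)
qed

lemma size_le_rat_bits: "size_le q (rat_bits q)"
  unfolding size_le_def using rat_bits_num_den by (metis surj_pair)

lemma rat_bits_pos: "1 \<le> rat_bits q"
proof -
  obtain p r where pr: "quotient_of q = (p, r)" by fastforce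
  have "r < 2 ^ rat_bits q" "0 < r" using rat_bits_num_den[OF pr] by auto
  then show ?thesis by (cases "rat_bits q") auto
qed

lemma size_le_mono: "size_le q s \<Longrightarrow> s \<le> t \<Longrightarrow> size_le q t"
proof -
  assume "size_le q s" "s \<le> t"
  then obtain a b :: int where ab: "0 < b" "q = of_int a / of_int b" "\<bar>a\<bar> < 2 ^ s" "b < 2 ^ s"
    unfolding size_le_def by blast
  have "(2 :: int) ^ s \<le> 2 ^ t" using \<open>s \<le> t\<close> by (simp add: power_increasing)
  then have "\<bar>a\<bar> < 2 ^ t" "b < 2 ^ t" using ab by linarith+
  then show "size_le q t" unfolding size_le_def using ab(1,2) by blast
qed

lemma size_le_mult: "size_le p s \<Longrightarrow> size_le q t \<Longrightarrow> size_le (p * q) (s + t)"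
proof -
  assume "size_le p s" "size_le q t"
  then obtain a b c d :: int where *: "0 < b" "p = of_int a / of_int b" "\<bar>a\<bar> < 2 ^ s" "b < 2 ^ s"
    "0 < d" "q = of_int c / of_int d" "\<bar>c\<bar> < 2 ^ t" "d < 2 ^ t" unfolding size_le_def by blast
  have "\<bar>a * c\<bar> < 2 ^ (s + t)" "b * d < 2 ^ (s + t)"
    unfolding abs_mult power_add using * by (auto intro!: mult_strict_mono')
  then show ?thesis unfolding size_le_def using *
    by (intro exI[of _ "a * c"] exI[of _ "b * d"]) auto
qed

lemma size_le_add: "size_le p s \<Longrightarrow> size_le q t \<Longrightarrow> size_le (p + q) (s + t + 1)"
proof -
  assume "size_le p s" "size_le q t"
  then obtain a b c d :: int where *: "0 < b" "p = of_int a / of_int b" "\<bar>a\<bar> < 2 ^ s" "b < 2 ^ s"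
    "0 < d" "q = of_int c / of_int d" "\<bar>c\<bar> < 2 ^ t" "d < 2 ^ t" unfolding size_le_def by blast
  have "\<bar>a * d\<bar> < 2 ^ (s + t)" "\<bar>b * c\<bar> < 2 ^ (s + t)" "b * d < 2 ^ (s + t)"
    unfolding abs_mult power_add using * by (auto intro!: mult_strict_mono')
  then have "\<bar>a * d + b * c\<bar> < 2 ^ (s + t + 1)" "b * d < 2 ^ (s + t + 1)"
    by (auto simp: power_add)
  moreover have "p + q = of_int (a * d + b * c) / of_int (b * d)"
    using * by (simp add: field_simps)
  ultimately show ?thesis unfolding size_le_def using *
    by (intro exI[of _ "a * d + b * c"] exI[of _ "b * d"]) auto
qed

lemma size_le_inverse: "size_le q t \<Longrightarrow> size_le (inverse q) t"
proof (cases "q = 0")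
  case False
  assume "size_le q t"
  then obtain c d :: int where *: "0 < d" "q = of_int c / of_int d" "\<bar>c\<bar> < 2 ^ t" "d < 2 ^ t"
    unfolding size_le_def by blast
  have "c \<noteq> 0" using * False by auto
  moreover have "inverse q = of_int (sgn c * d) / of_int \<bar>c\<bar>"
    unfolding *(2) using \<open>c \<noteq> 0\<close> by (cases "c > 0") (auto simp: sgn_if)
  ultimately show ?thesis unfolding size_le_def using *
    by (intro exI[of _ "sgn c * d"] exI[of _ "\<bar>c\<bar>"]) (auto simp: abs_mult)
qed auto

lemma size_le_divide: "size_le p s \<Longrightarrow> size_le q t \<Longrightarrow> size_le (p / q) (s + t)"
  unfolding divide_inverse by (intro size_le_mult size_le_inverse)

lemma size_le_of_nat:
  assumes "m < 2 ^ s" "1 \<le> s"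
  shows "size_le (of_nat m) s"
proof -
  have "int m < int (2 ^ s)" using assms(1) by (simp only: of_nat_less_iff)
  then have "\<bar>int m\<bar> < 2 ^ s" by simp
  moreover have "(1 :: int) < 2 ^ s" using assms(2) by (intro one_less_power) auto
  moreover have "of_nat m = of_int (int m) / (of_int 1 :: rat)" by simp
  ultimately show ?thesis unfolding size_le_def
    by - (rule exI[of _ "int m"], rule exI[of _ 1], simp)
qed

lemma size_le_sum_list:
  assumes "\<And>x. x \<in> set xs \<Longrightarrow> size_le (f x) s" "length xs \<le> N"
  shows "size_le (\<Sum>x\<leftarrow>xs. f x) (N * (s + 1) + 1)"
proof -
  have "size_le (\<Sum>x\<leftarrow>xs. f x) (length xs * (s + 1) + 1)"
    using assms(1)
  proof (induction xs)
    case Nil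
    then show ?case using size_le_of_nat[of 0 1] by simp
  next
    case (Cons x xs)
    have "size_le (f x + (\<Sum>x\<leftarrow>xs. f x)) (s + (length xs * (s + 1) + 1) + 1)"
      by (rule size_le_add) (use Cons in auto)
    then show ?case by (simp add: algebra_simps)
  qed
  then show ?thesis by (rule size_le_mono) (use assms(2) in \<open>simp add: mult_right_mono del: mult_Suc_right\<close>)
qed

text \<open>Under \<open>size_le\<close> the lengths of the summands add up, which is hopeless for
  the exponentially many terms of a determinant. Over a common denominator \<open>D ^ m\<close> the
  denominator stays put and only the absolute value grows.\<close>

definition frac_le :: "nat \<Rightarrow> rat \<Rightarrow> nat \<Rightarrow> rat \<Rightarrow> bool" where
  "frac_le D B m q \<longleftrightarrow> (\<exists>z :: int. q * of_nat D ^ m = of_int z) \<and> \<bar>q\<bar> \<le> B"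

lemma frac_le_mult:
  assumes "frac_le D B m p" "frac_le D B' m' q"
  shows "frac_le D (B * B') (m + m') (p * q)"
proof -
  obtain z z' where z: "p * of_nat D ^ m = of_int z" "q * of_nat D ^ m' = of_int z'"
    using assms unfolding frac_le_def by blast
  have "p * q * of_nat D ^ (m + m') = of_int (z * z')"
    by (simp add: z[symmetric] power_add)
  moreover have "\<bar>p * q\<bar> \<le> B * B'"
    unfolding abs_mult using assms unfolding frac_le_def by (intro mult_mono) auto
  ultimately show ?thesis unfolding frac_le_def by blast
qed

lemma frac_le_mono:
  assumes "frac_le D B m q" "B \<le> B'" "m \<le> m'"
  shows "frac_le D B' m' q"
proof -
  obtain z where z: "q * of_nat D ^ m = of_int z" using assms unfolding frac_le_def by blast
  have "q * of_nat D ^ m' = (q * of_nat D ^ m) * of_nat D ^ (m' - m)"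
    using assms(3) by (simp flip: power_add)
  also have "\<dots> = of_int (z * int D ^ (m' - m))" by (simp add: z)
  finally show ?thesis using assms unfolding frac_le_def by (meson order_trans)
qed

lemma frac_le_sign:
  assumes "s = 1 \<or> s = - 1" "frac_le D B m q"
  shows "frac_le D B m (s * q)"
proof -
  obtain z where "q * of_nat D ^ m = of_int z" "\<bar>q\<bar> \<le> B" using assms(2) unfolding frac_le_def by blast
  then have "- q * of_nat D ^ m = of_int (- z)" "\<bar>- q\<bar> \<le> B" by simp_all
  then have "frac_le D B m (- q)" unfolding frac_le_def by blast
  then show ?thesis using assms by auto
qed

lemma frac_le_sum_list:
  assumes "\<And>x. x \<in> set xs \<Longrightarrow> frac_le D B m (f x)" "length xs \<le> N" "0 \<le> B"
  shows "frac_le D (of_nat N * B) m (\<Sum>x\<leftarrow>xs. f x)"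
proof -
  have "frac_le D (of_nat (length xs) * B) m (\<Sum>x\<leftarrow>xs. f x)"
    using assms(1)
  proof (induction xs)
    case Nil
    then show ?case by (auto simp: frac_le_def)
  next
    case (Cons x xs)
    obtain z where z: "f x * of_nat D ^ m = of_int z" "\<bar>f x\<bar> \<le> B"
      using Cons.prems[of x] by (auto simp: frac_le_def)
    obtain z' where z': "(\<Sum>x\<leftarrow>xs. f x) * of_nat D ^ m = of_int z'"
      "\<bar>\<Sum>x\<leftarrow>xs. f x\<bar> \<le> of_nat (length xs) * B"
      using Cons by (auto simp: frac_le_def)
    have "(\<Sum>x\<leftarrow>x # xs. f x) * of_nat D ^ m = of_int (z + z')"
      using z z' by (simp add: distrib_right)
    moreover have "\<bar>\<Sum>x\<leftarrow>x # xs. f x\<bar> \<le> of_nat (length (x # xs)) * B"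
      using z(2) z'(2) by (simp add: distrib_right)
    ultimately show ?case unfolding frac_le_def by blast
  qed
  then show ?thesis by (rule frac_le_mono) (use assms in \<open>auto intro: mult_right_mono\<close>)
qed

text \<open>The numerator over \<open>D ^ m\<close> is at most \<open>B * D ^ m\<close> in absolute
  value, whence the exponent \<open>t + s * m\<close>; the additional \<open>1\<close> makes the
  bound strict.\<close>

lemma frac_le_size_le:
  assumes q: "frac_le D B m q" and D: "0 < D" "D \<le> 2 ^ s" "B \<le> 2 ^ t"
  shows "size_le q (t + s * m + 1)"
proof -
  obtain z where z: "q * of_nat D ^ m = of_int z" and B: "\<bar>q\<bar> \<le> B" using q unfolding frac_le_def by blast
  have Dm: "D ^ m \<le> 2 ^ (s * m)" using power_mono[OF D(2), of m] by (simp add: power_mult)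
  have "(of_int \<bar>z\<bar> :: rat) = \<bar>q\<bar> * of_nat (D ^ m)" using z by (metis abs_mult abs_of_nat of_int_abs of_nat_power)
  also have "\<dots> \<le> 2 ^ t * of_nat (2 ^ (s * m))"
    using B D(3) Dm by (intro mult_mono of_nat_mono) auto
  also have "\<dots> = of_int (2 ^ (t + s * m))" by (simp add: power_add)
  finally have "\<bar>z\<bar> \<le> 2 ^ (t + s * m)" by (simp only: of_int_le_iff)
  also have "\<dots> < 2 ^ (t + s * m + 1)" by simp
  finally have "\<bar>z\<bar> < 2 ^ (t + s * m + 1)" .
  moreover have "int (D ^ m) < 2 ^ (t + s * m + 1)"
  proof -
    have "int (D ^ m) \<le> int (2 ^ (s * m))" using Dm by (simp only: of_nat_le_iff)
    also have "\<dots> \<le> 2 ^ (t + s * m)" by (simp add: power_increasing)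
    also have "\<dots> < 2 ^ (t + s * m + 1)" by simp
    finally show ?thesis .
  qed
  moreover have "q = of_int z / of_int (int (D ^ m))" using z D(1) by (simp add: field_simps)
  ultimately show ?thesis unfolding size_le_def using D(1)
    by (intro exI[of _ z] exI[of _ "int (D ^ m)"]) auto
qed

text \<open>The product of the denominators serves: its length is at most the sum of their
  lengths.\<close>

lemma common_denominator:
  "\<exists>D>0. D \<le> 2 ^ (\<Sum>q\<leftarrow>E. rat_bits q) \<and> (\<forall>q\<in>set E. \<exists>z :: int. q * of_nat D = of_int z)"
proof (induction E)
  case Nil
  then show ?case by (intro exI[of _ 1]) auto
next
  case (Cons e E)
  then obtain D where D: "D > 0" "D \<le> 2 ^ (\<Sum>q\<leftarrow>E. rat_bits q)"
    "\<And>q. q \<in> set E \<Longrightarrow> \<exists>z :: int. q * of_nat D = of_int z" by blast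
  obtain p r where pr: "quotient_of e = (p, r)" by fastforce
  note b = rat_bits_num_den[OF pr]
  have "nat r \<le> 2 ^ rat_bits e" using b(2,3) by (simp add: nat_le_iff)
  then have "nat r * D \<le> 2 ^ (\<Sum>q\<leftarrow>e # E. rat_bits q)"
    using D(2) by (simp add: power_add mult_mono)
  moreover have "\<exists>z :: int. q * of_nat (nat r * D) = of_int z" if q: "q \<in> set (e # E)" for q
  proof (cases "q = e")
    case True
    have "q * of_nat (nat r * D) = of_int (p * int D)" using b(3,4) True by simp
    then show ?thesis by blast
  next
    case False
    then obtain z where "q * of_nat D = of_int z" using D(3) q by auto
    then have "q * of_nat (nat r * D) = of_int (r * z)" using b(3) by (simp add: algebra_simps)
    then show ?thesis by blast
  qed
  ultimately show ?case using D(1) b(3) by (intro exI[of _ "nat r * D"]) auto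
qed

lemma rat_abs_le: "\<bar>q\<bar> \<le> 2 ^ rat_bits q"
proof -
  obtain p r where pr: "quotient_of q = (p, r)" by fastforce
  note b = rat_bits_num_den[OF pr]
  have "\<bar>q\<bar> = of_int \<bar>p\<bar> / of_int r" using b(3) by (simp add: b(4))
  also have "\<dots> \<le> of_int \<bar>p\<bar> / 1" using b(3) by (intro divide_left_mono) auto
  also have "\<dots> \<le> of_int (2 ^ rat_bits q)" using b(1) by (simp only: div_by_1 of_int_le_iff)
  finally show ?thesis by simp
qed

text \<open>Every column contributes one factor \<open>D\<close> to the denominator, and to the
  absolute value a factor \<open>S\<close> for its entry and \<open>N\<close> for the number of
  terms.\<close>

lemma frac_le_laplace_det:
  assumes a: "\<And>i j. i \<in> set I \<Longrightarrow> j \<in> set J \<Longrightarrow> frac_le D S 1 (a i j)" and I: "length I \<le> N" and S: "0 \<le> S"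
  shows "frac_le D ((of_nat N * S) ^ length J) (length J) (laplace_det a I J)"
  using a I
proof (induction J arbitrary: I)
  case Nil
  show ?case by (simp add: frac_le_def)
next
  case (Cons j J)
  have "frac_le D (of_nat N * (S * (of_nat N * S) ^ length J)) (1 + length J)
      (\<Sum>(s, i, R)\<leftarrow>splits_of I. s * a i j * laplace_det a R J)"
  proof (rule frac_le_sum_list)
    fix q :: "rat \<times> 'a \<times> 'a list" assume qs: "q \<in> set (splits_of I)"
    obtain s i R where "q = (s, i, R)" by (cases q)
    with qs have q: "q = (s, i, R)" "(s, i, R) \<in> set (splits_of I)" by simp_all
    note sp = splits_of_elem[OF q(2)]
    have "frac_le D ((of_nat N * S) ^ length J) (length J) (laplace_det a R J)"
      by (rule Cons.IH) (use Cons.prems sp in auto)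
    moreover have "frac_le D S 1 (a i j)" using Cons.prems sp by auto
    ultimately have "frac_le D (S * (of_nat N * S) ^ length J) (1 + length J) (a i j * laplace_det a R J)"
      by (rule frac_le_mult[rotated])
    then have "frac_le D (S * (of_nat N * S) ^ length J) (1 + length J) (s * (a i j * laplace_det a R J))"
      by (rule frac_le_sign[OF sp(1)])
    then show "frac_le D (S * (of_nat N * S) ^ length J) (1 + length J) (case q of (s, i, R) \<Rightarrow> s * a i j * laplace_det a R J)"
      by (simp add: q(1) mult.assoc)
  qed (use Cons.prems S in auto)
  then show ?case by (simp add: mult.assoc)
qed

lemma frac_le_laplace_det_term:
  assumes a: "\<And>i j. i \<in> set I \<Longrightarrow> j \<in> set (j' # J) \<Longrightarrow> frac_le D S 1 (a i j)" and I: "length I \<le> N" and S: "0 \<le> S"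
    and sp: "(s, i, R) \<in> set (splits_of I)"
  shows "frac_le D (S * (of_nat N * S) ^ length J) (1 + length J) (s * a i j' * laplace_det a R J)"
proof -
  note e = splits_of_elem[OF sp]
  have "frac_le D ((of_nat N * S) ^ length J) (length J) (laplace_det a R J)"
    by (rule frac_le_laplace_det) (use a I S e in auto)
  moreover have "frac_le D S 1 (s * a i j')" using frac_le_sign[OF e(1)] a e(4) by auto
  ultimately show ?thesis by (rule frac_le_mult[rotated])
qed

text \<open>Selections \<open>zs\<close> of the terms are allowed because the machine checks the
  precision of every partial sum.\<close>

lemma frac_le_laplace_det_sum:
  assumes a: "\<And>i j. i \<in> set I \<Longrightarrow> j \<in> set (j' # J) \<Longrightarrow> frac_le D S 1 (a i j)" and I: "length I \<le> N" and S: "0 \<le> S"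
    and zs: "set zs \<subseteq> set (splits_of I)" "length zs \<le> length I"
  shows "frac_le D ((of_nat N * S) ^ Suc (length J)) (Suc (length J)) (\<Sum>(s, i, R)\<leftarrow>zs. s * a i j' * laplace_det a R J)"
proof -
  have "frac_le D (of_nat N * (S * (of_nat N * S) ^ length J)) (1 + length J) (\<Sum>(s, i, R)\<leftarrow>zs. s * a i j' * laplace_det a R J)"
  proof (rule frac_le_sum_list)
    fix q assume qs: "q \<in> set zs"
    obtain s i R where "q = (s, i, R)" by (cases q)
    with qs zs have q: "q = (s, i, R)" "(s, i, R) \<in> set (splits_of I)" by auto
    show "frac_le D (S * (of_nat N * S) ^ length J) (1 + length J) (case q of (s, i, R) \<Rightarrow> s * a i j' * laplace_det a R J)"
      unfolding q(1) prod.case by (rule frac_le_laplace_det_term[OF _ I S q(2)]) (rule a)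
  qed (use zs S I in auto)
  then show ?thesis by (simp add: mult.assoc)
qed

lemma frac_le_det1:
  assumes a: "\<And>i j. i \<in> set I \<Longrightarrow> j \<in> set J \<Longrightarrow> frac_le D S 1 (a i j)" and I: "length I \<le> N" and S: "0 \<le> S"
    and zs: "set zs \<subseteq> set (splits_of I)" "length zs \<le> length I"
  shows "frac_le D (of_nat N * (of_nat N * S) ^ length J) (length J) (\<Sum>(s, i, R)\<leftarrow>zs. s * laplace_det a R J)"
proof (rule frac_le_sum_list)
  fix q assume qs: "q \<in> set zs"
  obtain s i R where "q = (s, i, R)" by (cases q)
  with qs zs have q: "q = (s, i, R)" "(s, i, R) \<in> set (splits_of I)" by auto
  note sp = splits_of_elem[OF q(2)]
  have "frac_le D ((of_nat N * S) ^ length J) (length J) (laplace_det a R J)"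
    by (rule frac_le_laplace_det) (use a I S sp in auto)
  then show "frac_le D ((of_nat N * S) ^ length J) (length J) (case q of (s, i, R) \<Rightarrow> s * laplace_det a R J)"
    unfolding q(1) prod.case by (rule frac_le_sign[OF sp(1)])
qed (use I zs S in auto)

section \<open>Evaluation with time bounds\<close>

text \<open>Time is bounded rather than exact, so that different branches and loop iterations can
  share one bound.\<close>

definition ev :: "program \<Rightarrow> nat \<Rightarrow> val list \<Rightarrow> expr \<Rightarrow> val \<Rightarrow> nat \<Rightarrow> bool" where
  "ev P w env e v T \<longleftrightarrow> (\<exists>t\<le>T. eval P w env e v t)"

definition calls :: "program \<Rightarrow> nat \<Rightarrow> nat \<Rightarrow> val \<Rightarrow> val \<Rightarrow> nat \<Rightarrow> bool" where
  "calls P w f u v T \<longleftrightarrow> f < length P \<and> ev P w [u] (P ! f) v T"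

lemma ev_weaken: "ev P w env e v T \<Longrightarrow> v = v' \<Longrightarrow> T \<le> T' \<Longrightarrow> ev P w env e v' T'"
  unfolding ev_def by (meson le_trans)

lemma calls_weaken: "calls P w f u v T \<Longrightarrow> T \<le> T' \<Longrightarrow> calls P w f u v T'"
  unfolding calls_def by (auto intro: ev_weaken)

lemma ev_Var: "i < length env \<Longrightarrow> ev P w env (Var i) (env ! i) 1"
  unfolding ev_def by (blast intro: eval.Var)

lemma ev_Var0: "ev P w (u # env) (Var 0) u 1"
  using ev_Var[of 0 "u # env"] by simp

lemma ev_Var1: "ev P w (u0 # u # env) (Var 1) u 1"
  using ev_Var[of 1 "u0 # u # env"] by simp

lemma ev_Var2: "ev P w (u0 # u1 # u # env) (Var 2) u 1"
  using ev_Var[of 2 "u0 # u1 # u # env"] by simp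

lemma ev_Var3: "ev P w (u0 # u1 # u2 # u # env) (Var 3) u 1"
  using ev_Var[of 3 "u0 # u1 # u2 # u # env"] by simp

lemma ev_Var4: "ev P w (u0 # u1 # u2 # u3 # u # env) (Var 4) u 1"
  using ev_Var[of 4 "u0 # u1 # u2 # u3 # u # env"] by (simp add: numeral_eq_Suc)

lemma ev_Const: "ev P w env (Const q) (Num q) 1"
  unfolding ev_def by (blast intro: eval.Const)

lemma ev_Empty: "ev P w env Empty Null 1"
  unfolding ev_def by (blast intro: eval.Empty)

lemma ev_Mk_Cell:
  "ev P w env e1 u s \<Longrightarrow> ev P w env e2 v t \<Longrightarrow> ev P w env (Mk_Cell e1 e2) (Cell u v) (1 + s + t)"
  unfolding ev_def by (meson eval.Mk_Cell add_mono le_refl)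

lemma ev_First: "ev P w env e (Cell u v) t \<Longrightarrow> ev P w env (First e) u (1 + t)"
  unfolding ev_def by (meson eval.First add_mono le_refl)

lemma ev_Second: "ev P w env e (Cell u v) t \<Longrightarrow> ev P w env (Second e) v (1 + t)"
  unfolding ev_def by (meson eval.Second add_mono le_refl)

lemma ev_Arith:
  "ev P w env e1 (Num a) s \<Longrightarrow> ev P w env e2 (Num b) t \<Longrightarrow> \<not> (f = Div \<and> b = 0) \<Longrightarrow>
   rat_bits (arith f a b) \<le> w \<Longrightarrow> ev P w env (Arith f e1 e2) (Num (arith f a b)) (1 + s + t)"
  unfolding ev_def by (meson eval.Arith add_mono le_refl)

text \<open>Only the branch taken has to evaluate. For the other one value and time are free, and
  later proofs fill in \<open>Null\<close> and \<open>0\<close>.\<close>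

lemma ev_If_Less:
  assumes "ev P w env e1 (Num a) r" "ev P w env e2 (Num b) s"
    and "a < b \<Longrightarrow> ev P w env e3 v1 t1" "\<not> a < b \<Longrightarrow> ev P w env e4 v2 t2"
  shows "ev P w env (If_Less e1 e2 e3 e4) (if a < b then v1 else v2) (1 + r + s + max t1 t2)"
proof (cases "a < b")
  case True
  with assms obtain r' s' t' where "r' \<le> r" "s' \<le> s" "t' \<le> t1" "eval P w env e1 (Num a) r'"
    "eval P w env e2 (Num b) s'" "eval P w env e3 v1 t'"
    unfolding ev_def by blast
  moreover from this True have "eval P w env (If_Less e1 e2 e3 e4) v1 (1 + r' + s' + t')"
    by (blast intro: eval.If_Less_True)
  ultimately show ?thesis unfolding ev_def using True
    by (intro exI[of _ "1 + r' + s' + t'"]) auto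
next
  case False
  with assms obtain r' s' t' where "r' \<le> r" "s' \<le> s" "t' \<le> t2" "eval P w env e1 (Num a) r'"
    "eval P w env e2 (Num b) s'" "eval P w env e4 v2 t'"
    unfolding ev_def by blast
  moreover from this False have "eval P w env (If_Less e1 e2 e3 e4) v2 (1 + r' + s' + t')"
    by (blast intro: eval.If_Less_False)
  ultimately show ?thesis unfolding ev_def using False
    by (intro exI[of _ "1 + r' + s' + t'"]) auto
qed

lemma ev_If_Cell_True:
  "ev P w env e1 (Cell a b) s \<Longrightarrow> ev P w env e2 v t \<Longrightarrow> ev P w env (If_Cell e1 e2 e3) v (1 + s + t)"
  unfolding ev_def by (meson eval.If_Cell_True add_mono le_refl)

lemma ev_If_Cell_False:
  "ev P w env e1 Null s \<Longrightarrow> ev P w env e3 v t \<Longrightarrow> ev P w env (If_Cell e1 e2 e3) v (1 + s + t)"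
  unfolding ev_def by (meson eval.If_Cell_False add_mono le_refl val.distinct)

lemma ev_Bind:
  "ev P w env e1 u s \<Longrightarrow> ev P w (u # env) e2 v t \<Longrightarrow> ev P w env (Bind e1 e2) v (1 + s + t)"
  unfolding ev_def by (meson eval.Bind add_mono le_refl)

lemma ev_Call:
  "ev P w env e u s \<Longrightarrow> calls P w f u v t \<Longrightarrow> ev P w env (Call f e) v (1 + s + t)"
  unfolding ev_def calls_def by (meson eval.Call add_mono le_refl)

lemmas evs = ev_Var0 ev_Var1 ev_Var2 ev_Var3 ev_Var4 ev_Const ev_Empty ev_Mk_Cell ev_First ev_Second
  ev_Arith ev_If_Less ev_Bind ev_Call

lemma callsI: "f < length P \<Longrightarrow> P ! f = e \<Longrightarrow> ev P w [u] e v T \<Longrightarrow> calls P w f u v T"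
  unfolding calls_def by simp

definition enc_list :: "('a \<Rightarrow> val) \<Rightarrow> 'a list \<Rightarrow> val" where
  "enc_list enc xs = list_val (map enc xs)"

lemma enc_list_simps [simp]:
  "enc_list enc [] = Null" "enc_list enc (x # xs) = Cell (enc x) (enc_list enc xs)"
  by (simp_all add: enc_list_def)

text \<open>A right fold over the list in the second component: the tail is processed first, and its
  result is bound in front of the unchanged argument.\<close>

definition rec_body :: "nat \<Rightarrow> expr \<Rightarrow> expr \<Rightarrow> expr" where
  "rec_body f base e = If_Cell (Second (Var 0))
     (Bind (Call f (Mk_Cell (First (Var 0)) (Second (Second (Var 0))))) e) base"

text \<open>The step is required only for suffixes of \<open>xs\<close>, because index and precision
  bounds are known only for parts of the given list. The constants \<open>4\<close> and
  \<open>16\<close> cover the overhead of \<open>rec_body\<close> itself.\<close>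

lemma calls_rec:
  assumes f: "f < length P" "P ! f = rec_body f base e"
    and base: "ev P w [Cell env Null] base (G []) Tb"
    and step: "\<And>x zs. suffix (x # zs) xs \<Longrightarrow>
      ev P w [G zs, Cell env (Cell (enc x) (enc_list enc zs))] e (G (x # zs)) (T x)"
  shows "calls P w f (Cell env (enc_list enc xs)) (G xs) (Tb + 4 + (\<Sum>x\<leftarrow>xs. T x + 16))"
  using step
proof (induction xs)
  case Nil
  have "ev P w [Cell env (enc_list enc [])] (rec_body f base e) (G []) (Tb + 4)"
    unfolding rec_body_def enc_list_simps
    by (rule ev_weaken, (rule ev_If_Cell_False evs base)+) auto
  then show ?case using f unfolding calls_def by simp
next
  case (Cons x xs)
  have IH: "calls P w f (Cell env (enc_list enc xs)) (G xs) (Tb + 4 + (\<Sum>x\<leftarrow>xs. T x + 16))"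
    by (rule Cons.IH, rule Cons.prems) (auto intro: suffix_ConsI)
  have "ev P w [Cell env (enc_list enc (x # xs))] (rec_body f base e) (G (x # xs))
      (Tb + 4 + (\<Sum>x\<leftarrow>x # xs. T x + 16))"
    unfolding rec_body_def enc_list_simps
    by (rule ev_weaken, (rule ev_If_Cell_True evs IH Cons.prems)+) auto
  then show ?case using f unfolding calls_def by simp
qed

section \<open>The program\<close>

text \<open>Equality is expressed by two strict comparisons, the only numerical test of the machine;
  the same holds for \<open>if_eq\<close>.\<close>

definition if_zero :: "expr \<Rightarrow> expr \<Rightarrow> expr \<Rightarrow> expr" where
  "if_zero e e1 e2 = If_Less e (Const 0) e2 (If_Less (Const 0) e e2 e1)"

definition if_eq :: "expr \<Rightarrow> expr \<Rightarrow> expr \<Rightarrow> expr \<Rightarrow> expr" where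
  "if_eq e e' e1 e2 = If_Less e e' e2 (If_Less e' e e2 e1)"

abbreviation (input) f_append :: nat where "f_append \<equiv> 1"
abbreviation (input) f_nth :: nat where "f_nth \<equiv> 2"
abbreviation (input) f_length :: nat where "f_length \<equiv> 3"
abbreviation (input) f_upto :: nat where "f_upto \<equiv> 4"
abbreviation (input) f_nzs :: nat where "f_nzs \<equiv> 5"
abbreviation (input) f_step :: nat where "f_step \<equiv> 6"
abbreviation (input) f_member :: nat where "f_member \<equiv> 7"
abbreviation (input) f_mapcons :: nat where "f_mapcons \<equiv> 8"
abbreviation (input) f_consall :: nat where "f_consall \<equiv> 9"
abbreviation (input) f_choices :: nat where "f_choices \<equiv> 10"
abbreviation (input) f_splmap :: nat where "f_splmap \<equiv> 11"
abbreviation (input) f_spl :: nat where "f_spl \<equiv> 12"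
abbreviation (input) f_det :: nat where "f_det \<equiv> 13"
abbreviation (input) f_detsum :: nat where "f_detsum \<equiv> 14"
abbreviation (input) f_det1 :: nat where "f_det1 \<equiv> 15"
abbreviation (input) f_weights :: nat where "f_weights \<equiv> 16"
abbreviation (input) f_total :: nat where "f_total \<equiv> 17"
abbreviation (input) f_assoc :: nat where "f_assoc \<equiv> 18"
abbreviation (input) f_vec :: nat where "f_vec \<equiv> 19"
abbreviation (input) f_cand :: nat where "f_cand \<equiv> 20"
abbreviation (input) f_cand_rows :: nat where "f_cand_rows \<equiv> 21"
abbreviation (input) f_cand_sets :: nat where "f_cand_sets \<equiv> 22"
abbreviation (input) f_spread :: nat where "f_spread \<equiv> 23"
abbreviation (input) f_nbrs :: nat where "f_nbrs \<equiv> 24"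
abbreviation (input) f_ins :: nat where "f_ins \<equiv> 25"
abbreviation (input) f_ext :: nat where "f_ext \<equiv> 26"
abbreviation (input) f_ext_all :: nat where "f_ext_all \<equiv> 27"
abbreviation (input) f_levels :: nat where "f_levels \<equiv> 28"
abbreviation (input) f_sets :: nat where "f_sets \<equiv> 29"
abbreviation (input) f_init :: nat where "f_init \<equiv> 30"
abbreviation (input) f_subs :: nat where "f_subs \<equiv> 31"
abbreviation (input) f_col_sets :: nat where "f_col_sets \<equiv> 32"
abbreviation (input) f_cands :: nat where "f_cands \<equiv> 33"
abbreviation (input) f_col :: nat where "f_col \<equiv> 34"
abbreviation (input) f_transpose :: nat where "f_transpose \<equiv> 35"
abbreviation (input) f_dot :: nat where "f_dot \<equiv> 36"
abbreviation (input) f_mult :: nat where "f_mult \<equiv> 37"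
abbreviation (input) f_bound :: nat where "f_bound \<equiv> 38"
abbreviation (input) f_nonneg :: nat where "f_nonneg \<equiv> 39"
abbreviation (input) f_sum :: nat where "f_sum \<equiv> 40"
abbreviation (input) f_count :: nat where "f_count \<equiv> 41"
abbreviation (input) f_check :: nat where "f_check \<equiv> 42"
abbreviation (input) f_inner :: nat where "f_inner \<equiv> 43"
abbreviation (input) f_outer :: nat where "f_outer \<equiv> 44"

text \<open>In the step expression of \<open>rec_body\<close> the environment is \<open>[acc, Cell env (Cell x rest)]\<close>.\<close>

abbreviation (input) Acc :: expr where "Acc \<equiv> Var 0"
abbreviation (input) Env :: expr where "Env \<equiv> First (Var 1)"
abbreviation (input) Elem :: expr where "Elem \<equiv> First (Second (Var 1))"
abbreviation (input) Rest :: expr where "Rest \<equiv> Second (Second (Var 1))"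

definition body_append :: expr where
  "body_append = rec_body f_append (First (Var 0)) (Mk_Cell Elem Acc)"
definition body_nth :: expr where
  "body_nth = If_Less (Const 0) (Second (Var 0))
     (Call f_nth (Mk_Cell (Second (First (Var 0))) (Arith Sub (Second (Var 0)) (Const 1))))
     (First (First (Var 0)))"
definition body_length :: expr where
  "body_length = rec_body f_length (Const 0) (Arith Add Acc (Const 1))"
definition body_upto :: expr where
  "body_upto = rec_body f_upto (Mk_Cell (First (Var 0)) Empty)
     (Mk_Cell (Arith Sub (First Acc) (Const 1)) (Mk_Cell (Arith Sub (First Acc) (Const 1)) (Second Acc)))"
definition body_nzs :: expr where
  "body_nzs = rec_body f_nzs Empty (if_zero (Call f_nth (Mk_Cell Env Elem)) Acc (Mk_Cell Elem Acc))"
definition body_step :: expr where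
  "body_step = rec_body f_step Empty (Call f_append (Mk_Cell Acc
     (Call f_nzs (Mk_Cell (Call f_nth (Mk_Cell (First Env) Elem)) (Second Env)))))"
definition body_member :: expr where
  "body_member = rec_body f_member (Const 0) (if_eq Elem Env (Const 1) Acc)"
definition body_mapcons :: expr where
  "body_mapcons = rec_body f_mapcons Empty
     (if_zero (Call f_member (Mk_Cell Env Elem)) (Mk_Cell (Mk_Cell Env Elem) Acc) Acc)"
definition body_consall :: expr where
  "body_consall = rec_body f_consall Empty
     (Call f_append (Mk_Cell Acc (Call f_mapcons (Mk_Cell Elem Env))))"
definition body_choices :: expr where
  "body_choices = rec_body f_choices (Mk_Cell Empty Empty) (Call f_consall (Mk_Cell Acc
     (Call f_nzs (Mk_Cell (Call f_nth (Mk_Cell (First Env) Elem)) (Second Env)))))"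
definition body_splmap :: expr where
  "body_splmap = rec_body f_splmap Empty (Mk_Cell
     (Mk_Cell (Arith Sub (Const 0) (First Elem)) (Mk_Cell (First (Second Elem)) (Mk_Cell Env (Second (Second Elem)))))
     Acc)"
definition body_spl :: expr where
  "body_spl = rec_body f_spl Empty
     (Mk_Cell (Mk_Cell (Const 1) (Mk_Cell Elem Rest)) (Call f_splmap (Mk_Cell Elem Acc)))"
definition body_det :: expr where
  "body_det = If_Cell (Second (Second (Var 0)))
     (Call f_detsum (Mk_Cell (Mk_Cell (First (Var 0)) (Second (Second (Var 0))))
        (Call f_spl (Mk_Cell Empty (First (Second (Var 0)))))))
     (Const 1)"

abbreviation (input) Det_Entry :: expr where
  "Det_Entry \<equiv> Call f_nth (Mk_Cell (Call f_nth (Mk_Cell (First Env) (First (Second Elem)))) (First (Second Env)))"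

text \<open>The test for zero comes before the recursive call of \<open>f_det\<close>; without it
  the expansion would branch once per row instead of at most \<open>l\<close> times per
  column.\<close>

definition body_detsum :: expr where
  "body_detsum = rec_body f_detsum (Const 0) (if_zero Det_Entry Acc
     (Arith Add (Arith Mul (Arith Mul (First Elem) Det_Entry)
        (Call f_det (Mk_Cell (First Env) (Mk_Cell (Second (Second Elem)) (Second (Second Env)))))) Acc))"
definition body_det1 :: expr where
  "body_det1 = rec_body f_det1 (Const 0) (Arith Add (Arith Mul (First Elem)
     (Call f_det (Mk_Cell (First Env) (Mk_Cell (Second (Second Elem)) (Second Env))))) Acc)"
definition body_weights :: expr where
  "body_weights = rec_body f_weights Empty (Mk_Cell (Mk_Cell (First (Second Elem))
     (Arith Mul (First Elem) (Call f_det1 (Mk_Cell (Mk_Cell (First Env) (Second (Second Elem))) (Second Env))))) Acc)"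
definition body_total :: expr where
  "body_total = rec_body f_total (Const 0) (Arith Add (Second Elem) Acc)"
definition body_assoc :: expr where
  "body_assoc = rec_body f_assoc (Const 0) (if_eq (First Elem) Env (Second Elem) Acc)"
definition body_vec :: expr where
  "body_vec = rec_body f_vec Empty
     (Mk_Cell (Arith Div (Call f_assoc (Mk_Cell Elem (First Env))) (Second Env)) Acc)"
definition body_cand :: expr where
  "body_cand = Bind (Call f_weights (Mk_Cell
       (Mk_Cell (First (First (Var 0))) (Call f_spl (Mk_Cell Empty (Second (Second (Var 0))))))
       (Call f_spl (Mk_Cell Empty (First (Second (Var 0)))))))
     (Bind (Call f_total (Mk_Cell Empty (Var 0)))
       (if_zero (Var 0) Empty
         (Mk_Cell (Call f_vec (Mk_Cell (Mk_Cell (Var 1) (Var 0)) (Second (First (Var 2))))) Empty)))"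
definition body_cand_rows :: expr where
  "body_cand_rows = rec_body f_cand_rows Empty (Call f_append (Mk_Cell Acc
     (Call f_cand (Mk_Cell (First Env) (Mk_Cell (Second Env) Elem)))))"
definition body_cand_sets :: expr where
  "body_cand_sets = rec_body f_cand_sets Empty (If_Cell Elem (Call f_append (Mk_Cell Acc
     (Call f_cand_rows (Mk_Cell (Mk_Cell (Mk_Cell (First Env) (Second (Second Env))) Elem)
       (Call f_consall (Mk_Cell (Call f_choices (Mk_Cell (Second Env) (Second Elem))) (Second (Second Env)))))))) Acc)"

text \<open>The search graph is passed as the list \<open>l, idx, A, A\<^sup>T, B, B\<^sup>T\<close> (with a dotted last pair).\<close>

abbreviation (input) G_l :: "expr \<Rightarrow> expr" where "G_l g \<equiv> First g"
abbreviation (input) G_idx :: "expr \<Rightarrow> expr" where "G_idx g \<equiv> First (Second g)"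
abbreviation (input) G_A :: "expr \<Rightarrow> expr" where "G_A g \<equiv> First (Second (Second g))"
abbreviation (input) G_At :: "expr \<Rightarrow> expr" where "G_At g \<equiv> First (Second (Second (Second g)))"
abbreviation (input) G_B :: "expr \<Rightarrow> expr" where "G_B g \<equiv> First (Second (Second (Second (Second g))))"
abbreviation (input) G_Bt :: "expr \<Rightarrow> expr" where "G_Bt g \<equiv> Second (Second (Second (Second (Second g))))"

definition body_spread :: expr where
  "body_spread = Bind
     (Call f_append (Mk_Cell
       (Call f_step (Mk_Cell (Mk_Cell (G_Bt (First (Var 0))) (G_idx (First (Var 0)))) (Second (Var 0))))
       (Call f_step (Mk_Cell (Mk_Cell (G_At (First (Var 0))) (G_idx (First (Var 0)))) (Second (Var 0))))))
     (Call f_append (Mk_Cell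
       (Call f_step (Mk_Cell (Mk_Cell (G_B (First (Var 1))) (G_idx (First (Var 1)))) (Var 0)))
       (Call f_step (Mk_Cell (Mk_Cell (G_A (First (Var 1))) (G_idx (First (Var 1)))) (Var 0)))))"
definition body_nbrs :: expr where
  "body_nbrs = If_Less (G_l (First (Var 0))) (Const 2)
     (Call f_step (Mk_Cell (Mk_Cell (G_B (First (Var 0))) (G_idx (First (Var 0))))
       (Call f_step (Mk_Cell (Mk_Cell (G_At (First (Var 0))) (G_idx (First (Var 0))))
         (Mk_Cell (Second (Var 0)) Empty)))))
     (Call f_spread (Mk_Cell (First (Var 0)) (Call f_spread (Mk_Cell (First (Var 0))
       (Mk_Cell (Second (Var 0)) Empty)))))"
definition body_ins :: expr where
  "body_ins = if_zero (Call f_member (Var 0)) (Var 0) (Second (Var 0))"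
definition body_ext :: expr where
  "body_ext = rec_body f_ext Empty (Mk_Cell (Mk_Cell Elem (Call f_ins (Mk_Cell Elem Env))) Acc)"
definition body_ext_all :: expr where
  "body_ext_all = rec_body f_ext_all Empty (Call f_append (Mk_Cell Acc
     (Call f_ext (Mk_Cell (Second Elem) (Call f_nbrs (Mk_Cell Env (First Elem)))))))"
definition body_levels :: expr where
  "body_levels = If_Less (Const 0) (First (Second (Var 0)))
     (Call f_append (Mk_Cell
       (Call f_levels (Mk_Cell (First (Var 0)) (Mk_Cell (Arith Sub (First (Second (Var 0))) (Const 1))
         (Call f_ext_all (Mk_Cell (First (Var 0)) (Second (Second (Var 0))))))))
       (Second (Second (Var 0)))))
     (Second (Second (Var 0)))"
definition body_sets :: expr where
  "body_sets = rec_body f_sets Empty (Mk_Cell (Second Elem) Acc)"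
definition body_init :: expr where
  "body_init = rec_body f_init Empty (Mk_Cell (Mk_Cell Elem (Mk_Cell Elem Empty)) Acc)"
definition body_subs :: expr where
  "body_subs = rec_body f_subs (Mk_Cell Empty Empty)
     (Call f_append (Mk_Cell Acc (Call f_mapcons (Mk_Cell Elem Acc))))"

abbreviation (input) Walk_Sets :: "expr \<Rightarrow> expr" where
  "Walk_Sets m \<equiv> Call f_sets (Mk_Cell Empty (Call f_levels (Mk_Cell (Second (Var 0)) (Mk_Cell m
     (Call f_init (Mk_Cell Empty (G_idx (Second (Var 0)))))))))"

definition body_col_sets :: expr where
  "body_col_sets = If_Less (G_l (Second (Var 0))) (Const 2)
     (Mk_Cell (G_idx (Second (Var 0))) (Walk_Sets (Call f_length (Mk_Cell Empty (G_idx (Second (Var 0)))))))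
     (If_Less (Arith Mul (First (Var 0)) (G_l (Second (Var 0)))) (Call f_length (Mk_Cell Empty (G_idx (Second (Var 0)))))
       (Walk_Sets (Arith Add (First (Var 0)) (First (Var 0))))
       (Call f_subs (Mk_Cell Empty (G_idx (Second (Var 0))))))"
definition body_cands :: expr where
  "body_cands = Call f_cand_sets (Mk_Cell
     (Mk_Cell (G_A (Second (Var 0))) (Mk_Cell (G_At (Second (Var 0))) (G_idx (Second (Var 0)))))
     (Call f_col_sets (Var 0)))"
definition body_col :: expr where
  "body_col = rec_body f_col Empty (Mk_Cell (Call f_nth (Mk_Cell Elem Env)) Acc)"
definition body_transpose :: expr where
  "body_transpose = rec_body f_transpose Empty (Mk_Cell (Call f_col (Mk_Cell Elem Env)) Acc)"
definition body_dot :: expr where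
  "body_dot = rec_body f_dot (Const 0) (Arith Add (Arith Mul (Call f_nth (Mk_Cell (First Env) Elem))
     (Call f_nth (Mk_Cell (Second Env) Elem))) Acc)"
definition body_mult :: expr where
  "body_mult = rec_body f_mult Empty
     (Mk_Cell (Call f_dot (Mk_Cell (Mk_Cell Elem (Second Env)) (First Env))) Acc)"
definition body_bound :: expr where
  "body_bound = rec_body f_bound (Const 1) (If_Less Env Elem (Const 0) Acc)"
definition body_nonneg :: expr where
  "body_nonneg = rec_body f_nonneg (Const 1) (If_Less Elem (Const 0) (Const 0) Acc)"
definition body_sum :: expr where
  "body_sum = rec_body f_sum (Const 0) (Arith Add Elem Acc)"
definition body_count :: expr where
  "body_count = rec_body f_count (Const 0) (If_Less (Const 0) Elem (Arith Add Acc (Const 1)) Acc)"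

abbreviation (input) Chk_k :: expr where "Chk_k \<equiv> First (First (Var 0))"
abbreviation (input) Chk_x :: expr where "Chk_x \<equiv> First (Second (Var 0))"
abbreviation (input) Chk_y :: expr where "Chk_y \<equiv> Second (Second (Var 0))"
abbreviation (input) Chk_rows :: "expr \<Rightarrow> expr \<Rightarrow> expr" where
  "Chk_rows y M \<equiv> Call f_mult (Mk_Cell (Mk_Cell (First (Second (First (Var 0)))) y) M)"
abbreviation (input) Chk_best :: "expr \<Rightarrow> expr \<Rightarrow> expr" where
  "Chk_best x p \<equiv> Call f_bound (Mk_Cell (Call f_dot (Mk_Cell (Mk_Cell x p) (First (Second (First (Var 0)))))) p)"

definition body_check :: expr where
  "body_check =
     if_zero (Call f_nonneg (Mk_Cell Empty Chk_x)) (Const 0)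
     (if_zero (Call f_nonneg (Mk_Cell Empty Chk_y)) (Const 0)
     (if_eq (Call f_sum (Mk_Cell Empty Chk_x)) (Const 1)
     (if_eq (Call f_sum (Mk_Cell Empty Chk_y)) (Const 1)
     (If_Less Chk_k (Call f_count (Mk_Cell Empty Chk_x)) (Const 0)
     (If_Less Chk_k (Call f_count (Mk_Cell Empty Chk_y)) (Const 0)
     (if_zero (Chk_best Chk_x (Chk_rows Chk_y (First (Second (Second (First (Var 0))))))) (Const 0)
       (Chk_best Chk_y (Chk_rows Chk_x (Second (Second (Second (First (Var 0)))))))))) (Const 0)) (Const 0)))"
definition body_inner :: expr where
  "body_inner = rec_body f_inner Empty
     (if_zero (Call f_check (Mk_Cell (First Env) (Mk_Cell (Second Env) Elem))) Acc (Mk_Cell (Second Env) Elem))"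
definition body_outer :: expr where
  "body_outer = rec_body f_outer Empty
     (If_Cell (Call f_inner (Mk_Cell (Mk_Cell (First Env) Elem) (Second Env)))
       (Call f_inner (Mk_Cell (Mk_Cell (First Env) Elem) (Second Env))) Acc)"

abbreviation (input) In_A :: "expr \<Rightarrow> expr" where "In_A i \<equiv> First (Second (Second i))"
abbreviation (input) In_B :: "expr \<Rightarrow> expr" where "In_B i \<equiv> First (Second (Second (Second i)))"

definition body_main :: expr where
  "body_main =
     Bind (Second (Call f_upto (Mk_Cell (Call f_length (Mk_Cell Empty (In_A (Var 0)))) (In_A (Var 0)))))
     (Bind (Call f_transpose (Mk_Cell (In_A (Var 1)) (Var 0)))
     (Bind (Call f_transpose (Mk_Cell (In_B (Var 2)) (Var 1)))
     (Call f_outer (Mk_Cell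
       (Mk_Cell (Mk_Cell (First (Var 3)) (Mk_Cell (Var 2) (Mk_Cell (In_A (Var 3)) (Var 0))))
         (Call f_cands (Mk_Cell (First (Var 3)) (Mk_Cell (First (Second (Var 3))) (Mk_Cell (Var 2)
           (Mk_Cell (In_A (Var 3)) (Mk_Cell (Var 1) (Mk_Cell (In_B (Var 3)) (Var 0)))))))))
       (Call f_cands (Mk_Cell (First (Var 3)) (Mk_Cell (First (Second (Var 3))) (Mk_Cell (Var 2)
         (Mk_Cell (Var 0) (Mk_Cell (In_B (Var 3)) (Mk_Cell (Var 1) (In_A (Var 3)))))))))))))"

definition prog :: program where
  "prog = [body_main, body_append, body_nth, body_length, body_upto, body_nzs, body_step, body_member,
     body_mapcons, body_consall, body_choices, body_splmap, body_spl, body_det, body_detsum, body_det1,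
     body_weights, body_total, body_assoc, body_vec, body_cand, body_cand_rows, body_cand_sets,
     body_spread, body_nbrs, body_ins, body_ext, body_ext_all, body_levels, body_sets, body_init,
     body_subs, body_col_sets, body_cands, body_col, body_transpose, body_dot, body_mult, body_bound,
     body_nonneg, body_sum, body_count, body_check, body_inner, body_outer]"

lemma prog_nth:
  "prog ! 0 = body_main" "prog ! f_append = body_append" "prog ! f_nth = body_nth"
  "prog ! f_length = body_length" "prog ! f_upto = body_upto" "prog ! f_nzs = body_nzs"
  "prog ! f_step = body_step" "prog ! f_member = body_member" "prog ! f_mapcons = body_mapcons"
  "prog ! f_consall = body_consall" "prog ! f_choices = body_choices" "prog ! f_splmap = body_splmap"
  "prog ! f_spl = body_spl" "prog ! f_det = body_det" "prog ! f_detsum = body_detsum"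
  "prog ! f_det1 = body_det1" "prog ! f_weights = body_weights" "prog ! f_total = body_total"
  "prog ! f_assoc = body_assoc" "prog ! f_vec = body_vec" "prog ! f_cand = body_cand"
  "prog ! f_cand_rows = body_cand_rows" "prog ! f_cand_sets = body_cand_sets"
  "prog ! f_spread = body_spread" "prog ! f_nbrs = body_nbrs" "prog ! f_ins = body_ins"
  "prog ! f_ext = body_ext" "prog ! f_ext_all = body_ext_all" "prog ! f_levels = body_levels"
  "prog ! f_sets = body_sets" "prog ! f_init = body_init" "prog ! f_subs = body_subs"
  "prog ! f_col_sets = body_col_sets" "prog ! f_cands = body_cands" "prog ! f_col = body_col"
  "prog ! f_transpose = body_transpose" "prog ! f_dot = body_dot" "prog ! f_mult = body_mult"
  "prog ! f_bound = body_bound" "prog ! f_nonneg = body_nonneg" "prog ! f_sum = body_sum"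
  "prog ! f_count = body_count" "prog ! f_check = body_check" "prog ! f_inner = body_inner"
  "prog ! f_outer = body_outer"
  by (simp_all add: prog_def nth_Cons')

lemma length_prog: "length prog = 45" by (simp add: prog_def)

lemma ev_if_zero:
  assumes "ev P w env e (Num a) r"
    and "a = 0 \<Longrightarrow> ev P w env e1 v1 t1" "a \<noteq> 0 \<Longrightarrow> ev P w env e2 v2 t2"
  shows "ev P w env (if_zero e e1 e2) (if a = 0 then v1 else v2) (4 + 2 * r + max t1 t2)"
proof -
  have *: "ev P w env (If_Less (Const 0) e e2 e1) (if 0 < a then v2 else v1) (1 + 1 + r + max t2 t1)" if "\<not> a < 0"
    by (rule ev_If_Less[OF ev_Const assms(1)]) (use assms that in auto)
  show ?thesis unfolding if_zero_def
    by (rule ev_weaken[OF ev_If_Less[OF assms(1) ev_Const, of _ e2 v2 t2, OF _ *]]) (use assms in auto)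
qed

lemma ev_if_eq:
  assumes "ev P w env e (Num a) r" "ev P w env e' (Num b) s"
    and "a = b \<Longrightarrow> ev P w env e1 v1 t1" "a \<noteq> b \<Longrightarrow> ev P w env e2 v2 t2"
  shows "ev P w env (if_eq e e' e1 e2) (if a = b then v1 else v2) (2 + 2 * r + 2 * s + max t1 t2)"
proof -
  have *: "ev P w env (If_Less e' e e2 e1) (if b < a then v2 else v1) (1 + s + r + max t2 t1)" if "\<not> a < b"
    by (rule ev_If_Less[OF assms(2,1)]) (use assms that in auto)
  show ?thesis unfolding if_eq_def
    by (rule ev_weaken[OF ev_If_Less[OF assms(1,2), of e2 v2 t2, OF _ *]]) (use assms in auto)
qed

lemma ev_arith:
  "ev P w env e1 (Num a) s \<Longrightarrow> ev P w env e2 (Num b) t \<Longrightarrow> rat_bits (a + b) \<le> w \<Longrightarrow>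
   ev P w env (Arith Add e1 e2) (Num (a + b)) (1 + s + t)"
  "ev P w env e1 (Num a) s \<Longrightarrow> ev P w env e2 (Num b) t \<Longrightarrow> rat_bits (a - b) \<le> w \<Longrightarrow>
   ev P w env (Arith Sub e1 e2) (Num (a - b)) (1 + s + t)"
  "ev P w env e1 (Num a) s \<Longrightarrow> ev P w env e2 (Num b) t \<Longrightarrow> rat_bits (a * b) \<le> w \<Longrightarrow>
   ev P w env (Arith Mul e1 e2) (Num (a * b)) (1 + s + t)"
  "ev P w env e1 (Num a) s \<Longrightarrow> ev P w env e2 (Num b) t \<Longrightarrow> rat_bits (a / b) \<le> w \<Longrightarrow> b \<noteq> 0 \<Longrightarrow>
   ev P w env (Arith Div e1 e2) (Num (a / b)) (1 + s + t)"
  using ev_Arith[of P w env e1 a s e2 b t Add] ev_Arith[of P w env e1 a s e2 b t Sub]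
    ev_Arith[of P w env e1 a s e2 b t Mul] ev_Arith[of P w env e1 a s e2 b t Div] by simp_all

lemmas ev_rules = ev_Var0 ev_Var1 ev_Var2 ev_Var3 ev_Var4 ev_Const ev_Empty ev_Mk_Cell ev_First ev_Second
  ev_arith ev_If_Less ev_if_zero ev_if_eq ev_Bind ev_Call

abbreviation enc_nat :: "nat \<Rightarrow> val" where
  "enc_nat \<equiv> \<lambda>i. Num (of_nat i)"

abbreviation enc_row :: "rat list \<Rightarrow> val" where
  "enc_row \<equiv> enc_list Num"

abbreviation enc_mat :: "rat list list \<Rightarrow> val" where
  "enc_mat \<equiv> enc_list (enc_list Num)"

abbreviation enc_nats :: "nat list \<Rightarrow> val" where
  "enc_nats \<equiv> enc_list (\<lambda>i. Num (of_nat i))"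

text \<open>\<open>V\<close> is the unit of all later cost bounds. Since it is at least
  \<open>2\<close>, a constant factor \<open>2 ^ c\<close> costs an additional exponent
  \<open>c\<close>; since it bounds \<open>n\<close>, a loop over indices costs an additional
  exponent \<open>1\<close>. The condition on \<open>w\<close> covers indices and counters.\<close>

locale machine =
  fixes w V n :: nat
  assumes V2: "2 \<le> V" and nV: "n \<le> V"
    and w_nat: "\<And>m. m \<le> 2 * n + 2 \<Longrightarrow> rat_bits (of_nat m) \<le> w"
begin

abbreviation calls_prog :: "nat \<Rightarrow> val \<Rightarrow> val \<Rightarrow> nat \<Rightarrow> bool" where
  "calls_prog \<equiv> calls prog w"

lemma V1: "1 \<le> V ^ p" using V2 by simp

lemma V_mono: "p \<le> q \<Longrightarrow> V ^ p \<le> V ^ q" using V2 by (simp add: power_increasing)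

lemma V_pow: "2 ^ c \<le> V ^ c" using V2 by (simp add: power_mono)

text \<open>\<open>128 = 2 ^ 7\<close>: an increase of the exponent by seven absorbs a sum of up to
  128 terms \<open>V ^ c\<close>, which suffices for the bodies of the program; hence the steps of
  seven in the exponents below.\<close>

lemma V_ge: "c + 7 \<le> p \<Longrightarrow> 128 * V ^ c \<le> V ^ p"
proof -
  assume "c + 7 \<le> p"
  then have "V ^ (c + 7) \<le> V ^ p" by (rule V_mono)
  moreover have "128 * V ^ c \<le> V ^ 7 * V ^ c" using V_pow[of 7] by (intro mult_right_mono) auto
  moreover have "V ^ 7 * V ^ c = V ^ (c + 7)" by (simp add: power_add mult.commute)
  ultimately show ?thesis by linarith
qed

lemma V_ge': "7 \<le> p \<Longrightarrow> 128 \<le> V ^ p"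
  using V_ge[of 0 p] by simp

lemma nV1: "n \<le> V ^ 1" using nV by simp

lemma w_nat': "rat_bits 0 \<le> w" "rat_bits 1 \<le> w" "m \<le> 2 * n + 1 \<Longrightarrow> rat_bits (of_nat m + 1) \<le> w"
  using w_nat[of 0] w_nat[of 1] w_nat[of "Suc m"] by (auto simp: add.commute)

text \<open>The loop costs at most \<open>22 * V ^ (p + q)\<close>, and
  \<open>22 \<le> 2 ^ 6\<close> explains the \<open>6\<close>.\<close>

lemma calls_rec_V:
  assumes f: "f < length prog" "prog ! f = rec_body f base e"
    and base: "ev prog w [Cell env Null] base (G []) (V ^ p)"
    and xs: "length xs \<le> V ^ q"
    and step: "\<And>x zs. suffix (x # zs) xs \<Longrightarrow>
      ev prog w [G zs, Cell env (Cell (enc x) (enc_list enc zs))] e (G (x # zs)) (V ^ p)"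
    and r: "p + q + 6 \<le> r"
  shows "calls_prog f (Cell env (enc_list enc xs)) (G xs) (V ^ r)"
proof (rule calls_weaken[OF calls_rec[OF f base step]])
  have "(\<Sum>x\<leftarrow>xs. V ^ p + 16) \<le> V ^ q * (V ^ p + 16)" using xs by (simp add: sum_list_triv)
  also have "\<dots> \<le> V ^ q * (V ^ p + 16 * V ^ p)" using V1[of p] by (intro mult_left_mono add_left_mono) auto
  also have "\<dots> = 17 * V ^ (p + q)" by (simp add: power_add)
  finally have "V ^ p + 4 + (\<Sum>x\<leftarrow>xs. V ^ p + 16) \<le> V ^ (p + q) + 4 * V ^ (p + q) + 17 * V ^ (p + q)"
    using V_mono[of p "p + q"] V1[of "p + q"] by linarith
  also have "\<dots> \<le> 2 ^ 6 * V ^ (p + q)" by simp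
  also have "\<dots> \<le> V ^ 6 * V ^ (p + q)" by (intro mult_right_mono V_pow) simp
  also have "\<dots> = V ^ (p + q + 6)" by (simp add: power_add)
  also have "\<dots> \<le> V ^ r" by (rule V_mono[OF r])
  finally show "V ^ p + 4 + (\<Sum>x\<leftarrow>xs. V ^ p + 16) \<le> V ^ r" .
qed

end

section \<open>Running time of the program\<close>

lemma suffix_elem: "suffix (x # zs) xs \<Longrightarrow> x \<in> set xs" "suffix (x # zs) xs \<Longrightarrow> set zs \<subseteq> set xs"
  "suffix (x # zs) xs \<Longrightarrow> length zs < length xs"
  by (auto simp: suffix_def)

section \<open>Cost of the list operations\<close>

context machine
begin

lemma V_pow_mult: "a \<le> V ^ p \<Longrightarrow> b \<le> V ^ q \<Longrightarrow> a * b \<le> V ^ (p + q)"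
  unfolding power_add by (intro mult_mono) auto

lemma V_pow_add: "a \<le> V ^ p \<Longrightarrow> b \<le> V ^ p \<Longrightarrow> a + b \<le> V ^ (p + 1)"
proof -
  assume "a \<le> V ^ p" "b \<le> V ^ p"
  then have "a + b \<le> 2 * V ^ p" by simp
  also have "\<dots> \<le> V * V ^ p" using V2 by (intro mult_right_mono) auto
  finally show ?thesis by simp
qed

text \<open>The recursion runs over the list that ends up in front, stored in the second component.
  Loops therefore pass the accumulated list first and pay only for the new piece.\<close>

lemma calls_append:
  assumes "length xs \<le> V ^ q" "q + 13 \<le> r"
  shows "calls_prog f_append (Cell (enc_list e ys) (enc_list e xs)) (enc_list e (xs @ ys)) (V ^ r)"
  apply (rule calls_rec_V[OF _ prog_nth(2)[unfolded body_append_def], where G = "\<lambda>xs. enc_list e (xs @ ys)" and p = 7 and q = q])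
  subgoal by (simp add: length_prog)
  subgoal by (rule ev_weaken, ((rule ev_rules)+)[1], simp, use V_ge'[of 7] in simp)
  subgoal by (use assms in simp)
  subgoal premises prems for x zs
  proof -
    show ?thesis
      by - (rule ev_weaken, ((rule ev_rules  | assumption)+)[1], simp, use  V_ge'[of 7] in simp)
  qed
  subgoal by (use assms in simp)
  done

lemma calls_nth:
  assumes "i < length xs" "i \<le> n"
  shows "calls_prog f_nth (Cell (enc_list e xs) (Num (of_nat i))) (e (xs ! i)) (V ^ 7)"
proof (rule calls_weaken)
  show "calls_prog f_nth (Cell (enc_list e xs) (Num (of_nat i))) (e (xs ! i)) (20 * (i + 1))"
    using assms
  proof (induction i arbitrary: xs)
    case 0
    then obtain x xs' where xs: "xs = x # xs'" by (cases xs) auto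
    show ?case
      unfolding calls_def length_prog prog_nth body_nth_def xs enc_list_simps of_nat_0
      by (rule conjI, simp, rule ev_weaken,
          rule ev_If_Less[where ?t1.0 = 0 and ?v1.0 = Null], ((rule ev_rules | (simp; fail))+)[1]) (auto intro: ev_rules)
  next
    case (Suc i)
    then obtain x xs' where xs: "xs = x # xs'" by (cases xs) auto
    have IH: "calls_prog f_nth (Cell (enc_list e xs') (Num (of_nat (Suc i) - 1))) (e (xs' ! i)) (20 * (i + 1))"
      using Suc by (simp add: xs)
    have "rat_bits (of_nat (Suc i) - 1) \<le> w" using w_nat[of i] Suc.prems by simp
    then show ?case
      unfolding calls_def length_prog prog_nth body_nth_def xs enc_list_simps
      by - (rule conjI, simp, rule ev_weaken, ((rule ev_rules IH | assumption | (simp; fail))+)[1], auto)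
  qed
  have "20 * (i + 1) \<le> 2 ^ 5 * V ^ 2"
  proof -
    have "i + 1 \<le> V + V" using assms(2) nV V2 by linarith
    also have "\<dots> = 2 * V" by simp
    also have "\<dots> \<le> V ^ 2" using V2 by (simp add: power2_eq_square)
    finally show ?thesis by simp
  qed
  also have "\<dots> \<le> V ^ 5 * V ^ 2" by (intro mult_right_mono V_pow) simp
  finally show "20 * (i + 1) \<le> V ^ 7" by (simp flip: power_add)
qed

lemma calls_length:
  assumes "length xs \<le> n"
  shows "calls_prog f_length (Cell Null (enc_list e xs)) (Num (of_nat (length xs))) (V ^ 14)"
  apply (rule calls_rec_V[OF _ prog_nth(4)[unfolded body_length_def], where G = "\<lambda>xs. Num (of_nat (length xs))" and p = 7 and q = 1])
  subgoal by (simp add: length_prog)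
  subgoal by (rule ev_weaken, ((rule ev_rules)+)[1], simp, use V_ge'[of 7] in simp)
  subgoal by (use assms nV in auto)
  subgoal premises prems for x zs
  proof -
    have "rat_bits (of_nat (length zs) + 1) \<le> w"
      using w_nat'(3)[of "length zs"] suffix_elem(3)[OF prems] assms by simp
    then show ?thesis
      by - (rule ev_weaken, ((rule ev_rules  | assumption)+)[1], simp, use  V_ge'[of 7] in simp)
  qed
  subgoal by simp
  done

text \<open>The number \<open>n\<close> is not part of the input. The index list is built downwards
  while walking along the rows of a matrix, and the first component holds the lower end reached so
  far.\<close>

lemma calls_upto:
  assumes "length xs \<le> n"
  shows "calls_prog f_upto (Cell (Num (of_nat n)) (enc_list e xs)) (Cell (Num (of_nat (n - length xs))) (enc_nats [n - length xs..<n])) (V ^ 14)"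
  apply (rule calls_rec_V[OF _ prog_nth(5)[unfolded body_upto_def], where G = "\<lambda>xs. Cell (Num (of_nat (n - length xs))) (enc_nats [n - length xs..<n])" and p = 7 and q = 1])
  subgoal by (simp add: length_prog)
  subgoal by (rule ev_weaken, ((rule ev_rules)+)[1], simp, use V_ge'[of 7] in simp)
  subgoal by (use assms nV in auto)
  subgoal premises prems for x zs
  proof -
    have l: "length zs < n" using suffix_elem(3)[OF prems] assms by simp
    then have eq: "of_nat (n - length zs) - 1 = (of_nat (n - Suc (length zs)) :: rat)"
      by (simp add: of_nat_diff)
    have up: "[n - Suc (length zs)..<n] = (n - Suc (length zs)) # [n - length zs..<n]"
      using l by (simp add: upt_conv_Cons Suc_diff_Suc)
    have "rat_bits (of_nat (n - length zs) - 1) \<le> w" unfolding eq by (rule w_nat) simp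
    then show ?thesis
      by - (rule ev_weaken, ((rule ev_rules  | assumption)+)[1], simp add: eq up, use  V_ge'[of 7] in simp)
  qed
  subgoal by simp
  done

lemma calls_nzs:
  assumes "length idx \<le> n" "\<And>j. j \<in> set idx \<Longrightarrow> j < length r \<and> j \<le> n"
  shows "calls_prog f_nzs (Cell (enc_row r) (enc_nats idx)) (enc_nats (nzs r idx)) (V ^ 21)"
  apply (rule calls_rec_V[OF _ prog_nth(6)[unfolded body_nzs_def], where G = "\<lambda>idx. enc_nats (nzs r idx)" and p = 14 and q = 1])
  subgoal by (simp add: length_prog)
  subgoal by (rule ev_weaken, ((rule ev_rules)+)[1], simp add: nzs_def, use V_ge'[of 14] in simp)
  subgoal by (use assms nV in auto)
  subgoal premises prems for x zs
  proof -
    have "x < length r" "x \<le> n" using assms(2)[OF suffix_elem(1)[OF prems]] by auto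
    then show ?thesis
      by - (rule ev_weaken, ((rule ev_rules calls_nth | assumption)+)[1], simp add: nzs_def, use V_ge[of 7 14] V_ge'[of 14] in simp)
  qed
  subgoal by simp
  done

lemma calls_member:
  assumes "length xs \<le> n"
  shows "calls_prog f_member (Cell (Num (of_nat j)) (enc_nats xs)) (Num (of_bool (j \<in> set xs))) (V ^ 14)"
  apply (rule calls_rec_V[OF _ prog_nth(8)[unfolded body_member_def], where G = "\<lambda>xs. Num (of_bool (j \<in> set xs))" and p = 7 and q = 1])
  subgoal by (simp add: length_prog)
  subgoal by (rule ev_weaken, ((rule ev_rules)+)[1], simp, use V_ge'[of 7] in simp)
  subgoal by (use assms nV in auto)
  subgoal premises prems for x zs
  proof -
    show ?thesis
      by - (rule ev_weaken, ((rule ev_rules  | assumption)+)[1], simp, use  V_ge'[of 7] in simp)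
  qed
  subgoal by simp
  done

lemma calls_mapcons:
  assumes "length Ls \<le> V ^ q" "\<And>L. L \<in> set Ls \<Longrightarrow> length L \<le> n" "q + 27 \<le> r"
  shows "calls_prog f_mapcons (Cell (Num (of_nat j)) (enc_list enc_nats Ls)) (enc_list enc_nats (mapcons j Ls)) (V ^ r)"
  apply (rule calls_rec_V[OF _ prog_nth(9)[unfolded body_mapcons_def], where G = "\<lambda>Ls. enc_list enc_nats (mapcons j Ls)" and p = 21 and q = q])
  subgoal by (simp add: length_prog)
  subgoal by (rule ev_weaken, ((rule ev_rules)+)[1], simp add: mapcons_def, use V_ge'[of 21] in simp)
  subgoal by (use assms in simp)
  subgoal premises prems for x zs
  proof -
    have "length x \<le> n" using assms(2)[OF suffix_elem(1)[OF prems]] .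
    then show ?thesis
      by - (rule ev_weaken, ((rule ev_rules calls_member | assumption)+)[1], simp add: mapcons_def, use V_ge[of 14 21] V_ge'[of 21] in simp)
  qed
  subgoal by (use assms in simp)
  done

lemma calls_consall:
  assumes "length Ls \<le> V ^ q" "\<And>L. L \<in> set Ls \<Longrightarrow> length L \<le> n" "length is \<le> n" "q + 41 \<le> r"
  shows "calls_prog f_consall (Cell (enc_list enc_nats Ls) (enc_nats is)) (enc_list enc_nats (consall Ls is)) (V ^ r)"
  apply (rule calls_rec_V[OF _ prog_nth(10)[unfolded body_consall_def], where G = "\<lambda>is. enc_list enc_nats (consall Ls is)" and p = "q + 34" and q = 1])
  subgoal by (simp add: length_prog)
  subgoal by (rule ev_weaken, ((rule ev_rules)+)[1], simp add: consall_def, use V_ge'[of "q + 34"] in simp)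
  subgoal by (use assms nV in auto)
  subgoal premises prems for x zs
  proof -
    have "length (mapcons x Ls) \<le> V ^ q"
      using assms(1) le_trans[OF length_filter_le] by (simp add: mapcons_def)
    note app = calls_append[OF this order_refl] and mc = calls_mapcons[OF assms(1,2) order_refl]
    show ?thesis
      by - (rule ev_weaken, ((rule ev_rules app mc | assumption)+)[1], simp add: consall_def, use V_ge[of "q + 27" "q + 34"] V_ge[of "q + 13" "q + 34"] V_ge'[of "q + 34"] in simp)
  qed
  subgoal by (use assms in simp)
  done

lemma length_consall_le: "length (consall Ls is) \<le> length is * length Ls"
  unfolding consall_def mapcons_def
  by (induction "is") (auto intro: add_mono le_trans[OF length_filter_le])

end

section \<open>Determinants on the machine\<close>

fun enc_spl :: "rat \<times> nat \<times> nat list \<Rightarrow> val" where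
  "enc_spl (s, i, R) = Cell (Num s) (Cell (Num (of_nat i)) (enc_nats R))"

fun enc_wt :: "nat \<times> rat \<Rightarrow> val" where
  "enc_wt (j, q) = Cell (Num (of_nat j)) (Num q)"

text \<open>\<open>D\<close> and \<open>S\<close> are the common denominator and the bound on the
  entries, \<open>\<sigma>\<close> the resulting length of minors; \<open>n + 3\<close> leaves some
  room beyond the \<open>n\<close> columns of a minor. The number in the condition on
  \<open>w\<close> follows the final test: a candidate consists of quotients of length
  \<open>2 * \<sigma>\<close>, its payoff vector has entries of length about
  \<open>n * (3 * \<sigma> + 1)\<close>, and one more product with a candidate gives the outer
  factor \<open>n\<close>.\<close>

locale game_machine = machine +
  fixes k l D \<sigma> :: nat and S :: rat
  assumes n1: "1 \<le> n" and l1: "1 \<le> l" and k1: "1 \<le> k" and S1: "1 \<le> S"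
    and frac_size_le: "\<And>q. frac_le D ((of_nat n * S) ^ (n + 3)) (n + 3) q \<Longrightarrow> size_le q \<sigma>"
    and size_le_w: "\<And>q. size_le q (n * (2 * \<sigma> + n * (3 * \<sigma> + 1) + 2) + 1) \<Longrightarrow> rat_bits q \<le> w"
    and w_k: "rat_bits (of_nat (2 * k)) \<le> w" "rat_bits (of_nat (k * l)) \<le> w"
    and V_def: "V = (n + 1) * l ^ (k * l)"
begin

definition valid_mat :: "rat list list \<Rightarrow> bool" where
  "valid_mat M \<longleftrightarrow> length M = n \<and> (\<forall>i<n. length (M ! i) = n) \<and>
     (\<forall>i<n. card {j. j < n \<and> M ! i ! j \<noteq> 0} \<le> l) \<and> (\<forall>j<n. card {i. i < n \<and> M ! i ! j \<noteq> 0} \<le> l) \<and>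
     (\<forall>i<n. \<forall>j<n. frac_le D S 1 (M ! i ! j))"

abbreviation idx :: "nat list" where "idx \<equiv> [0..<n]"

lemma V_double: "2 * V ^ p \<le> V ^ (p + 1)"
  using mult_right_mono[OF V2, of "V ^ p"] by (simp only: power_add power_one_right mult.commute)

lemma nS1: "1 \<le> of_nat n * S"
proof -
  have "(1 :: rat) * 1 \<le> of_nat n * S" using n1 S1 by (intro mult_mono) auto
  then show ?thesis by simp
qed

lemma nS_mono: "m \<le> m' \<Longrightarrow> (of_nat n * S) ^ m \<le> (of_nat n * S) ^ m'"
  using nS1 by (intro power_increasing)

lemma frac_size_le':
  assumes "frac_le D B m q" "B \<le> (of_nat n * S) ^ m'" "m \<le> n + 3" "m' \<le> n + 3"
  shows "size_le q \<sigma>"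
  by (rule frac_size_le, rule frac_le_mono[OF assms(1) order_trans[OF assms(2) nS_mono] assms(3)]) (rule assms(4))

lemma size_le_fits: "size_le q \<sigma> \<Longrightarrow> rat_bits q \<le> w"
proof (rule size_le_w, erule size_le_mono)
  have "1 * (2 * \<sigma> + n * (3 * \<sigma> + 1) + 2) \<le> n * (2 * \<sigma> + n * (3 * \<sigma> + 1) + 2)"
    using n1 by (intro mult_right_mono) auto
  moreover have "\<sigma> \<le> 1 * (2 * \<sigma> + n * (3 * \<sigma> + 1) + 2)" by simp
  ultimately show "\<sigma> \<le> n * (2 * \<sigma> + n * (3 * \<sigma> + 1) + 2) + 1" by (meson le_trans le_add1)
qed

lemma frac_fits:
  assumes "frac_le D B m q" "B \<le> (of_nat n * S) ^ m'" "m \<le> n + 3" "m' \<le> n + 3"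
  shows "rat_bits q \<le> w"
  by (rule size_le_fits[OF frac_size_le'[OF assms]])

lemma valid_mat_size_le: "valid_mat M \<Longrightarrow> i < n \<Longrightarrow> j < n \<Longrightarrow> size_le (M ! i ! j) \<sigma>"
proof (rule frac_size_le'[of S 1 _ 1])
  have "1 * S \<le> of_nat n * S" using n1 S1 by (intro mult_right_mono) auto
  then show "S \<le> (of_nat n * S) ^ 1" by simp
qed (auto simp: valid_mat_def)

lemma length_nzs_le: "valid_mat M \<Longrightarrow> i < n \<Longrightarrow> length (nzs (M ! i) idx) \<le> l"
proof -
  assume "valid_mat M" "i < n"
  moreover have "length (nzs (M ! i) idx) = card {j. j < n \<and> M ! i ! j \<noteq> 0}"
    unfolding nzs_def by (subst distinct_card[symmetric]) (auto intro: arg_cong[of _ _ card])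
  ultimately show ?thesis by (simp add: valid_mat_def)
qed

lemma length_nzs_n: "length (nzs r idx) \<le> n"
  unfolding nzs_def using length_filter_le[of _ idx] by simp

lemma length_step_le: "valid_mat M \<Longrightarrow> set L \<subseteq> {..<n} \<Longrightarrow> length (step_list M idx L) \<le> l * length L"
proof (induction L)
  case (Cons i L)
  then show ?case using length_nzs_le[of M i] by (simp add: step_list_def)
qed (simp add: step_list_def)

lemma length_choices_le: "valid_mat Mt \<Longrightarrow> set J \<subseteq> {..<n} \<Longrightarrow> length (row_choices Mt idx J) \<le> l ^ length J"
proof (induction J)
  case (Cons j J)
  have "length (row_choices Mt idx (j # J)) \<le> length (nzs (Mt ! j) idx) * length (row_choices Mt idx J)"
    using length_consall_le by simp
  also have "\<dots> \<le> l * l ^ length J" using Cons length_nzs_le[of Mt j] by (intro mult_mono) auto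
  finally show ?case by simp
qed simp

lemma calls_nzs_row:
  assumes "valid_mat M" "i < n"
  shows "calls_prog f_nzs (Cell (enc_row (M ! i)) (enc_nats idx)) (enc_nats (nzs (M ! i) idx)) (V ^ 21)"
  by (rule calls_nzs) (use assms in \<open>auto simp: valid_mat_def\<close>)

lemma calls_row:
  assumes "valid_mat M" "i < n"
  shows "calls_prog f_nth (Cell (enc_mat M) (Num (of_nat i))) (enc_row (M ! i)) (V ^ 7)"
  by (rule calls_nth) (use assms in \<open>auto simp: valid_mat_def\<close>)

lemma calls_entry:
  assumes "valid_mat M" "i < n" "j < n"
  shows "calls_prog f_nth (Cell (enc_row (M ! i)) (Num (of_nat j))) (Num (M ! i ! j)) (V ^ 7)"
  by (rule calls_nth) (use assms in \<open>auto simp: valid_mat_def\<close>)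

lemma calls_step:
  assumes M: "valid_mat M" and L: "set L \<subseteq> {..<n}" "length L \<le> V ^ q" and r: "q + 34 \<le> r"
  shows "calls_prog f_step (Cell (Cell (enc_mat M) (enc_nats idx)) (enc_nats L)) (enc_nats (step_list M idx L)) (V ^ r)"
  apply (rule calls_rec_V[OF _ prog_nth(7)[unfolded body_step_def], where G = "\<lambda>L. enc_nats (step_list M idx L)" and p = 28 and q = q])
  subgoal by (simp add: length_prog)
  subgoal by (rule ev_weaken, ((rule ev_rules)+)[1], simp add: step_list_def, use V_ge'[of 28] in simp)
  subgoal by (use L in simp)
  subgoal premises prems for x zs
  proof -
    have x: "x < n" using L suffix_elem(1)[OF prems] by auto
    have "length (nzs (M ! x) idx) \<le> V ^ 1" using length_nzs_n[of "M ! x"] nV by simp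
    note app = calls_append[OF this order_refl]
    note nz = calls_nzs_row[OF M x] calls_row[OF M x]
    show ?thesis
      by - (rule ev_weaken, ((rule ev_rules app nz | assumption)+)[1], simp add: step_list_def, use V_ge[of 7 28] V_ge[of 14 28] V_ge[of 21 28] V_ge'[of 28] in simp)
  qed
  subgoal by (use r in simp)
  done

lemma calls_choices:
  assumes M: "valid_mat Mt" and J: "set J \<subseteq> {..<n}" "length J \<le> n" and q: "l ^ length J \<le> V ^ q" and r: "q + 55 \<le> r"
  shows "calls_prog f_choices (Cell (Cell (enc_mat Mt) (enc_nats idx)) (enc_nats J)) (enc_list enc_nats (row_choices Mt idx J)) (V ^ r)"
  apply (rule calls_rec_V[OF _ prog_nth(11)[unfolded body_choices_def], where G = "\<lambda>J. enc_list enc_nats (row_choices Mt idx J)" and p = "q + 48" and q = 1])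
  subgoal by (simp add: length_prog)
  subgoal by (rule ev_weaken, ((rule ev_rules)+)[1], simp, use V_ge'[of "q + 48"] in simp)
  subgoal by (use J nV in simp)
  subgoal premises prems for x zs
  proof -
    have x: "x < n" and zs: "set zs \<subseteq> {..<n}" "length zs \<le> length J"
      using J suffix_elem[OF prems] by auto
    have "length (row_choices Mt idx zs) \<le> l ^ length zs" by (rule length_choices_le[OF M zs(1)])
    also have "\<dots> \<le> l ^ length J" using zs l1 by (intro power_increasing) auto
    finally have c: "length (row_choices Mt idx zs) \<le> V ^ q" using q by simp
    have e: "length I \<le> n" if "I \<in> set (row_choices Mt idx zs)" for I
      using row_choices_elem(1)[OF that] zs(2) J(2) by simp
    note ca = calls_consall[OF c e length_nzs_n order_refl]
    note nz = calls_nzs_row[OF M x] calls_row[OF M x]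
    show ?thesis
      by - (rule ev_weaken, ((rule ev_rules ca nz | assumption)+)[1], simp, use V_ge[of 7 "q + 48"] V_ge[of 21 "q + 48"] V_ge[of "q + 41" "q + 48"] V_ge'[of "q + 48"] in simp)
  qed
  subgoal by (use r in simp)
  done

lemma calls_splmap:
  assumes "length sp \<le> n" "\<And>s i R. (s, i, R) \<in> set sp \<Longrightarrow> s = 1 \<or> s = - 1"
  shows "calls_prog f_splmap (Cell (Num (of_nat j)) (enc_list enc_spl sp)) (enc_list enc_spl (map (\<lambda>(s, a, R). (- s, a, j # R)) sp)) (V ^ 14)"
  apply (rule calls_rec_V[OF _ prog_nth(12)[unfolded body_splmap_def], where G = "\<lambda>sp. enc_list enc_spl (map (\<lambda>(s, a, R). (- s, a, j # R)) sp)" and p = 7 and q = 1])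
  subgoal by (simp add: length_prog)
  subgoal by (rule ev_weaken, ((rule ev_rules)+)[1], simp, use V_ge'[of 7] in simp)
  subgoal by (use assms nV in auto)
  subgoal premises prems for x zs
  proof -
    obtain s i R where x: "x = (s, i, R)" by (cases x)
    have "s = 1 \<or> s = - 1" using assms(2)[of s i R] suffix_elem(1)[OF prems] x by simp
    then have "rat_bits (0 - s) \<le> w" using w_nat[of 1] by (auto simp: rat_bits_def)
    then show ?thesis unfolding x enc_spl.simps
      by - (rule ev_weaken, ((rule ev_rules | assumption)+)[1], simp, use V_ge'[of 7] in simp)
  qed
  subgoal by simp
  done

lemma calls_spl:
  assumes "length I \<le> n"
  shows "calls_prog f_spl (Cell Null (enc_nats I)) (enc_list enc_spl (splits_of I)) (V ^ 28)"
  apply (rule calls_rec_V[OF _ prog_nth(13)[unfolded body_spl_def], where G = "\<lambda>I. enc_list enc_spl (splits_of I)" and p = 21 and q = 1])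
  subgoal by (simp add: length_prog)
  subgoal by (rule ev_weaken, ((rule ev_rules)+)[1], simp, use V_ge'[of 21] in simp)
  subgoal by (use assms nV in auto)
  subgoal premises prems for x zs
  proof -
    have "length (splits_of zs) \<le> n" using suffix_elem(3)[OF prems] assms by simp
    note sm = calls_splmap[OF this splits_of_elem(1)]
    show ?thesis
      by - (rule ev_weaken, ((rule ev_rules sm | assumption)+)[1], simp, use V_ge[of 14 21] V_ge'[of 21] in simp)
  qed
  subgoal by simp
  done

text \<open>An upper solution of the recurrence of the expansion: \<open>V ^ 30\<close> plus
  \<open>l\<close> determinants with one column less.\<close>

definition det_time :: "nat \<Rightarrow> nat" where
  "det_time m = (m + 1) * l ^ m * V ^ 30"

lemma frac_le_entries:
  "valid_mat M \<Longrightarrow> set I \<subseteq> {..<n} \<Longrightarrow> set J \<subseteq> {..<n} \<Longrightarrow> i \<in> set I \<Longrightarrow> j \<in> set J \<Longrightarrow> frac_le D S 1 (M ! i ! j)"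
  unfolding valid_mat_def by (meson lessThan_iff subsetD)

text \<open>Column \<open>j\<close> has at most \<open>l\<close> nonzero entries and
  \<open>I\<close> is distinct, so the price \<open>t\<close> of a recursive call is paid at most
  \<open>l\<close> times.\<close>

lemma nonzero_rows_le:
  assumes M: "valid_mat M" and I: "set I \<subseteq> {..<n}" "distinct I" and j: "j < n"
  shows "(\<Sum>(s, i, R)\<leftarrow>(splits_of I :: (rat \<times> nat \<times> nat list) list). if M ! i ! j = 0 then 0 else t) \<le> l * (t :: nat)"
proof -
  have "(\<Sum>(s, i, R)\<leftarrow>(splits_of I :: (rat \<times> nat \<times> nat list) list). if M ! i ! j = 0 then 0 else t) =
      (\<Sum>i\<leftarrow>map (\<lambda>(s, i, R). i) (splits_of I :: (rat \<times> nat \<times> nat list) list). if M ! i ! j = 0 then 0 else t)"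
    by (simp only: map_map o_def split_def)
  also have "\<dots> = (\<Sum>i\<leftarrow>I. if M ! i ! j = 0 then 0 else t)" unfolding map_splits_of_index ..
  also have "\<dots> = length (filter (\<lambda>i. M ! i ! j \<noteq> 0) I) * t" by (induction I) auto
  also have "length (filter (\<lambda>i. M ! i ! j \<noteq> 0) I) = card {i \<in> set I. M ! i ! j \<noteq> 0}"
    using I(2) by (subst distinct_card[symmetric]) auto
  also have "\<dots> \<le> card {i. i < n \<and> M ! i ! j \<noteq> 0}" using I(1) by (intro card_mono) auto
  also have "\<dots> \<le> l" using M j by (simp add: valid_mat_def)
  finally show ?thesis by simp
qed

lemma calls_detsum:
  assumes M: "valid_mat M" and I: "set I \<subseteq> {..<n}" "distinct I" "length I \<le> n" and J: "set (j # J) \<subseteq> {..<n}" "length (j # J) \<le> n"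
    and det: "\<And>(s :: rat) i R. (s, i, R) \<in> set (splits_of I) \<Longrightarrow>
      calls_prog f_det (Cell (enc_mat M) (Cell (enc_nats R) (enc_nats J))) (Num (laplace_det (entry M) R J)) t"
  shows "calls_prog f_detsum (Cell (Cell (enc_mat M) (enc_nats (j # J))) (enc_list enc_spl (splits_of I)))
    (Num (laplace_det (entry M) I (j # J))) (V ^ 29 + l * t)"
proof (rule calls_weaken)
  let ?G = "\<lambda>zs. Num (\<Sum>(s, i, R)\<leftarrow>zs. s * entry M i j * laplace_det (entry M) R J)"
  \<comment> \<open>The recursive determinant is charged only where the entry does not vanish, as
    the body tests the entry first.\<close>
  let ?T = "\<lambda>(s :: rat, i, R :: nat list). V ^ 21 + (if entry M i j = 0 then 0 else t)"
  have jn: "j < n" using J by simp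
  have "calls_prog f_detsum (Cell (Cell (enc_mat M) (enc_nats (j # J))) (enc_list enc_spl (splits_of I)))
    (?G (splits_of I)) (1 + 4 + (\<Sum>x\<leftarrow>splits_of I. ?T x + 16))"
  proof (rule calls_rec[OF _ prog_nth(15)[unfolded body_detsum_def], where G = ?G and T = ?T])
    show "f_detsum < length prog" by (simp add: length_prog)
    show "ev prog w [Cell (Cell (enc_mat M) (enc_nats (j # J))) Null] (Const 0) (?G []) 1"
      by (rule ev_weaken, rule ev_rules) auto
    fix x :: "rat \<times> nat \<times> nat list" and zs assume suf: "suffix (x # zs) (splits_of I)"
    obtain s i R where x: "x = (s, i, R)" by (cases x)
    have xs: "(s, i, R) \<in> set (splits_of I)" using suffix_elem(1)[OF suf] x by simp
    note e = splits_of_elem[OF xs]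
    have i: "i < n" using I e by auto
    note calls = calls_row[OF M i] calls_entry[OF M i jn] det[OF xs]
    have fe: "\<And>i j'. i \<in> set I \<Longrightarrow> j' \<in> set (j # J) \<Longrightarrow> frac_le D S 1 (M ! i ! j')"
      by (rule frac_le_entries[OF M I(1) J(1)])
    have S0: "0 \<le> S" using S1 by simp
    have sle: "S * (of_nat n * S) ^ m \<le> (of_nat n * S) ^ Suc m" for m
    proof -
      have "1 * S \<le> of_nat n * S" using n1 S1 by (intro mult_right_mono) auto
      then show ?thesis using nS1 by (simp add: mult_right_mono)
    qed
    have len: "length (x # zs) \<le> length I" "length zs \<le> length I"
      using suffix_length_le[OF suf] by simp_all
    have sub: "set (x # zs) \<subseteq> set (splits_of I)" using suf by (auto simp: suffix_def)
    \<comment> \<open>\<open>b1\<close>, \<open>b2\<close> and \<open>b3\<close> concern the three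
      results that the machine checks here: the signed entry, the term, and the partial sum.\<close>
    have b1: "rat_bits (s * entry M i j) \<le> w"
      by (rule frac_fits[OF frac_le_sign[OF e(1)], of S 1 _ 1]) (use fe e sle[of 0] in auto)
    have b2: "rat_bits (s * entry M i j * laplace_det (entry M) R J) \<le> w"
      by (rule frac_fits[OF frac_le_laplace_det_term[OF fe I(3) S0 xs] sle]) (use J in auto)
    have "frac_le D ((of_nat n * S) ^ Suc (length J)) (Suc (length J)) (\<Sum>(s, i, R)\<leftarrow>x # zs. s * entry M i j * laplace_det (entry M) R J)"
      by (rule frac_le_laplace_det_sum[OF fe I(3) S0 sub len(1)])
    then have "rat_bits (\<Sum>(s, i, R)\<leftarrow>x # zs. s * entry M i j * laplace_det (entry M) R J) \<le> w"
      by (rule frac_fits[OF _ order_refl]) (use J in auto)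
    then have b3: "rat_bits (s * entry M i j * laplace_det (entry M) R J + (\<Sum>(s, i, R)\<leftarrow>zs. s * entry M i j * laplace_det (entry M) R J)) \<le> w"
      by (simp add: x)
    show "ev prog w [?G zs, Cell (Cell (enc_mat M) (enc_nats (j # J))) (Cell (enc_spl x) (enc_list enc_spl zs))]
      (if_zero Det_Entry Acc (Arith Add (Arith Mul (Arith Mul (First Elem) Det_Entry)
        (Call f_det (Mk_Cell (First Env) (Mk_Cell (Second (Second Elem)) (Second (Second Env)))))) Acc)) (?G (x # zs)) (?T x)"
    proof (cases "entry M i j = 0")
      case True
      show ?thesis unfolding x enc_spl.simps enc_list_simps
        by (rule ev_weaken, rule ev_if_zero[where ?t2.0 = 0 and ?v2.0 = Null], ((rule ev_rules calls)+)[1], rule ev_rules)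
          (use True V_ge[of 7 21] V_ge'[of 21] in auto)
    next
      case False
      show ?thesis unfolding x enc_spl.simps enc_list_simps
        by (rule ev_weaken, ((rule ev_rules calls | (rule b1 b2 b3))+)[1])
          (use False V_ge[of 7 21] V_ge'[of 21] in auto)
    qed
  qed
  then show "calls_prog f_detsum (Cell (Cell (enc_mat M) (enc_nats (j # J))) (enc_list enc_spl (splits_of I)))
    (Num (laplace_det (entry M) I (j # J))) (1 + 4 + (\<Sum>x\<leftarrow>splits_of I. ?T x + 16))" by simp
  have "(\<Sum>x\<leftarrow>splits_of I. ?T x + 16) = (\<Sum>x\<leftarrow>(splits_of I :: (rat \<times> nat \<times> nat list) list). V ^ 21 + 16) +
      (\<Sum>(s, i, R)\<leftarrow>(splits_of I :: (rat \<times> nat \<times> nat list) list). if entry M i j = 0 then 0 else t)"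
    unfolding sum_list_addf[symmetric] by (intro arg_cong[of _ _ sum_list] map_cong refl) auto
  also have "\<dots> \<le> length I * (V ^ 21 + 16) + l * t"
    using nonzero_rows_le[OF M I(1,2) jn, of t] by (simp add: sum_list_triv)
  also have "length I * (V ^ 21 + 16) \<le> V ^ 23"
    using V_pow_mult[of "length I" 1 "V ^ 21 + 16" 22] I(3) nV V_ge'[of 21] V_double[of 21] by simp
  finally show "1 + 4 + (\<Sum>x\<leftarrow>splits_of I. ?T x + 16) \<le> V ^ 29 + l * t"
    using V_ge'[of 28] V_mono[of 23 28] V_double[of 28] by simp
qed

lemma calls_det:
  assumes M: "valid_mat M" and "set I \<subseteq> {..<n}" "distinct I" "length I \<le> n" "set J \<subseteq> {..<n}" "length J \<le> n"
  shows "calls_prog f_det (Cell (enc_mat M) (Cell (enc_nats I) (enc_nats J))) (Num (laplace_det (entry M) I J)) (det_time (length J))"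
  using assms(2-)
proof (induction J arbitrary: I)
  case Nil
  have "ev prog w [Cell (enc_mat M) (Cell (enc_nats I) (enc_nats []))] body_det (Num (laplace_det (entry M) I [])) (V ^ 30)"
    unfolding body_det_def enc_list_simps
    by (rule ev_weaken, rule ev_If_Cell_False, ((rule ev_rules)+)[2]) (use V_ge'[of 30] in auto)
  then show ?case unfolding calls_def prog_nth length_prog det_time_def by simp
next
  case (Cons j J)
  have "calls_prog f_det (Cell (enc_mat M) (Cell (enc_nats R) (enc_nats J))) (Num (laplace_det (entry M) R J)) (det_time (length J))"
    if "(s, i, R) \<in> set (splits_of I)" for s :: rat and i R
    by (rule Cons.IH) (use Cons.prems splits_of_elem[OF that] in auto)
  note ds = calls_detsum[OF M Cons.prems(1-5) this, unfolded enc_list_simps]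
  have "ev prog w [Cell (enc_mat M) (Cell (enc_nats I) (enc_nats (j # J)))] body_det (Num (laplace_det (entry M) I (j # J)))
      (V ^ 30 + l * det_time (length J))"
    unfolding body_det_def enc_list_simps
    by (rule ev_weaken, rule ev_If_Cell_True, ((rule ev_rules ds calls_spl[OF Cons.prems(3)])+)[2])
      (use V_ge'[of 28] V_double[of 28] V_double[of 29] in auto)
  moreover have "V ^ 30 + l * det_time (length J) \<le> det_time (length (j # J))"
    using l1 by (simp add: det_time_def algebra_simps)
  ultimately show ?case unfolding calls_def prog_nth length_prog by (auto intro: ev_weaken)
qed

lemma calls_det_V:
  assumes M: "valid_mat M" and I: "set I \<subseteq> {..<n}" "distinct I" "length I \<le> n" and J: "set J \<subseteq> {..<n}" "length J \<le> n"
    and l: "l ^ length J \<le> V ^ 3"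
  shows "calls_prog f_det (Cell (enc_mat M) (Cell (enc_nats I) (enc_nats J))) (Num (laplace_det (entry M) I J)) (V ^ 35)"
proof (rule calls_weaken[OF calls_det[OF M I J]])
  have "length J + 1 \<le> V ^ 2"
  proof -
    have "length J + 1 \<le> V + V" using J(2) nV V2 by linarith
    also have "\<dots> \<le> V ^ 2" using V_double[of 1] by (simp add: numeral_2_eq_2)
    finally show ?thesis .
  qed
  from V_pow_mult[OF V_pow_mult[OF this l] order_refl[of "V ^ 30"]]
  show "det_time (length J) \<le> V ^ 35" by (simp add: det_time_def)
qed

end

fun enc_st :: "nat \<times> nat list \<Rightarrow> val" where
  "enc_st (c, S) = Cell (Num (of_nat c)) (enc_nats S)"

definition enc_graph :: "nat \<Rightarrow> nat list \<Rightarrow> rat list list \<Rightarrow> rat list list \<Rightarrow> rat list list \<Rightarrow> rat list list \<Rightarrow> val" where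
  "enc_graph l idx A At B Bt =
     Cell (Num (of_nat l)) (Cell (enc_nats idx) (Cell (enc_mat A) (Cell (enc_mat At) (Cell (enc_mat B) (enc_mat Bt)))))"

section \<open>Candidate strategies of given column sets\<close>

context game_machine
begin

text \<open>The exponent \<open>3\<close> comes from walks of up to \<open>2 * k\<close> steps,
  which visit at most \<open>2 * k + 1 \<le> 3 * k\<close> columns. Column sets larger than
  \<open>k\<close> thus do get processed; the bound \<open>k\<close> on the support is enforced by
  the final test.\<close>

definition valid_cols :: "nat list \<Rightarrow> bool" where
  "valid_cols J \<longleftrightarrow> distinct J \<and> set J \<subseteq> {..<n} \<and> l ^ length J \<le> V ^ 3"

lemma distinct_length_le: "distinct J \<Longrightarrow> set J \<subseteq> {..<n} \<Longrightarrow> length J \<le> n"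
  by (metis card_lessThan card_mono distinct_card finite_lessThan)

lemma valid_cols_length: "valid_cols J \<Longrightarrow> length J \<le> n"
  by (simp add: valid_cols_def distinct_length_le)

lemma l_power_mono: "m \<le> m' \<Longrightarrow> l ^ m \<le> l ^ m'"
  using l1 by (simp add: power_increasing)

lemma valid_cols_spl:
  assumes "valid_cols J" "(s, j, R) \<in> set (splits_of J)"
  shows "set R \<subseteq> {..<n}" "length R \<le> n" "l ^ length R \<le> V ^ 3" "Suc (length R) \<le> n" "j < n"
  using assms splits_of_elem[OF assms(2)] valid_cols_length[OF assms(1)] le_trans[OF l_power_mono[of "length R" "length J"]]
  by (auto simp: valid_cols_def)

lemma n_nS: "of_nat n * (of_nat n * S) ^ m \<le> (of_nat n * S) ^ Suc m"
proof -
  have "of_nat n * 1 \<le> of_nat n * S" using S1 by (intro mult_left_mono) auto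
  then show ?thesis using nS1 by (simp add: mult_right_mono)
qed

lemma calls_det1:
  assumes M: "valid_mat M" and I: "set I \<subseteq> {..<n}" "distinct I" and R: "set R \<subseteq> {..<n}" "length R \<le> n" "l ^ length R \<le> V ^ 3"
  shows "calls_prog f_det1 (Cell (Cell (enc_mat M) (enc_nats R)) (enc_list enc_spl (splits_of I))) (Num (det1 (entry M) I R)) (V ^ 49)"
  unfolding det1_def
  apply (rule calls_rec_V[OF _ prog_nth(16)[unfolded body_det1_def], where G = "\<lambda>zs. Num (\<Sum>(s, i, R')\<leftarrow>zs. s * laplace_det (entry M) R' R)" and p = 42 and q = 1])
  subgoal by (simp add: length_prog)
  subgoal by (rule ev_weaken, ((rule ev_rules)+)[1], simp, use V_ge'[of 42] in simp)
  subgoal by (use distinct_length_le[OF I(2,1)] nV in simp)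
  subgoal premises prems for x zs
  proof -
    obtain s i R' where x: "x = (s, i, R')" by (cases x)
    have xs: "(s, i, R') \<in> set (splits_of I)" using suffix_elem(1)[OF prems] x by simp
    note e = splits_of_elem[OF xs]
    have In: "length I \<le> n" using distinct_length_le[OF I(2,1)] .
    have fe: "\<And>i j'. i \<in> set I \<Longrightarrow> j' \<in> set R \<Longrightarrow> frac_le D S 1 (M ! i ! j')"
      by (rule frac_le_entries[OF M I(1) R(1)])
    have S0: "0 \<le> S" using S1 by simp
    have det: "calls_prog f_det (Cell (enc_mat M) (Cell (enc_nats R') (enc_nats R))) (Num (laplace_det (entry M) R' R)) (V ^ 35)"
      by (rule calls_det_V[OF M _ _ _ R]) (use e I In in auto)
    have "frac_le D ((of_nat n * S) ^ length R) (length R) (laplace_det (entry M) R' R)"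
      by (rule frac_le_laplace_det) (use fe e In S0 in auto)
    then have b1: "rat_bits (s * laplace_det (entry M) R' R) \<le> w"
      by (intro frac_fits[OF frac_le_sign[OF e(1)] order_refl]) (use R in auto)
    have "frac_le D (of_nat n * (of_nat n * S) ^ length R) (length R) (\<Sum>(s, i, R')\<leftarrow>x # zs. s * laplace_det (entry M) R' R)"
      by (rule frac_le_det1[OF fe In S0]) (use suffix_elem[OF prems] in auto)
    then have "rat_bits (\<Sum>(s, i, R')\<leftarrow>x # zs. s * laplace_det (entry M) R' R) \<le> w"
      by (rule frac_fits[OF _ n_nS]) (use R in auto)
    then have b2: "rat_bits (s * laplace_det (entry M) R' R + (\<Sum>(s, i, R')\<leftarrow>zs. s * laplace_det (entry M) R' R)) \<le> w"
      by (simp add: x)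
    then show ?thesis unfolding x enc_spl.simps enc_list_simps
      by - (rule ev_weaken, ((rule ev_rules det b1 b2 | assumption)+)[1], simp, use V_ge[of 35 42] V_ge'[of 42] in simp)
  qed
  subgoal by simp
  done

lemma weights_frac:
  assumes M: "valid_mat M" and I: "set I \<subseteq> {..<n}" "distinct I" and J: "valid_cols J" and x: "(s, j, R) \<in> set (splits_of J)"
  shows "frac_le D ((of_nat n * S) ^ n) n (s * det1 (entry M) I R)"
proof -
  note e = splits_of_elem[OF x] and R = valid_cols_spl[OF J x]
  have In: "length I \<le> n" using distinct_length_le[OF I(2,1)] .
  have S0: "0 \<le> S" using S1 by simp
  have "frac_le D (of_nat n * (of_nat n * S) ^ length R) (length R) (det1 (entry M) I R)"
    unfolding det1_def
    by (rule frac_le_det1[OF frac_le_entries[OF M I(1) R(1)] In S0]) auto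
  from frac_le_sign[OF e(1) this] show ?thesis
    by (rule frac_le_mono) (use R order_trans[OF n_nS nS_mono[OF R(4)]] in auto)
qed

lemma calls_weights:
  assumes M: "valid_mat M" and I: "set I \<subseteq> {..<n}" "distinct I" and J: "valid_cols J"
  shows "calls_prog f_weights (Cell (Cell (enc_mat M) (enc_list enc_spl (splits_of I))) (enc_list enc_spl (splits_of J))) (enc_list enc_wt (weights M I (splits_of J))) (V ^ 63)"
  apply (rule calls_rec_V[OF _ prog_nth(17)[unfolded body_weights_def], where G = "\<lambda>zs. enc_list enc_wt (weights M I zs)" and p = 56 and q = 1])
  subgoal by (simp add: length_prog)
  subgoal by (rule ev_weaken, ((rule ev_rules)+)[1], simp add: weights_def, use V_ge'[of 56] in simp)
  subgoal by (use valid_cols_length[OF J] nV in simp)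
  subgoal premises prems for x zs
  proof -
    obtain s j R where x: "x = (s, j, R)" by (cases x)
    have xs: "(s, j, R) \<in> set (splits_of J)" using suffix_elem(1)[OF prems] x by simp
    have b: "rat_bits (s * det1 (entry M) I R) \<le> w"
      by (rule frac_fits[OF weights_frac[OF M I J xs] order_refl]) auto
    note d = calls_det1[OF M I valid_cols_spl(1-3)[OF J xs]]
    show ?thesis unfolding x enc_spl.simps
      by - (rule ev_weaken, ((rule ev_rules d b | assumption)+)[1], simp add: weights_def, use V_ge[of 49 56] V_ge'[of 56] in simp)
  qed
  subgoal by simp
  done

lemma calls_total:
  assumes "length W \<le> n" "\<And>zs. suffix zs W \<Longrightarrow> rat_bits (sum_list (map snd zs)) \<le> w"
  shows "calls_prog f_total (Cell Null (enc_list enc_wt W)) (Num (sum_list (map snd W))) (V ^ 14)"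
  apply (rule calls_rec_V[OF _ prog_nth(18)[unfolded body_total_def], where G = "\<lambda>W. Num (sum_list (map snd W))" and p = 7 and q = 1])
  subgoal by (simp add: length_prog)
  subgoal by (rule ev_weaken, ((rule ev_rules)+)[1], simp, use V_ge'[of 7] in simp)
  subgoal by (use assms nV in auto)
  subgoal premises prems for x zs
  proof -
    obtain j q where x: "x = (j, q)" by (cases x)
    have b: "rat_bits (q + sum_list (map snd zs)) \<le> w" using assms(2)[OF prems] by (simp add: x)
    then show ?thesis unfolding x enc_wt.simps
      by - (rule ev_weaken, ((rule ev_rules b | assumption)+)[1], simp, use  V_ge'[of 7] in simp)
  qed
  subgoal by simp
  done

lemma calls_assoc:
  assumes "length W \<le> n"
  shows "calls_prog f_assoc (Cell (Num (of_nat j)) (enc_list enc_wt W)) (Num (assoc j W)) (V ^ 14)"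
  apply (rule calls_rec_V[OF _ prog_nth(19)[unfolded body_assoc_def], where G = "\<lambda>W. Num (assoc j W)" and p = 7 and q = 1])
  subgoal by (simp add: length_prog)
  subgoal by (rule ev_weaken, ((rule ev_rules)+)[1], simp, use V_ge'[of 7] in simp)
  subgoal by (use assms nV in auto)
  subgoal premises prems for x zs
  proof -
    obtain i q where x: "x = (i, q)" by (cases x)
    show ?thesis unfolding x enc_wt.simps
      by - (rule ev_weaken, ((rule ev_rules  | assumption)+)[1], simp, use  V_ge'[of 7] in simp)
  qed
  subgoal by simp
  done

lemma calls_vec:
  assumes "length W \<le> n" "t \<noteq> 0" "length is \<le> n" "\<And>j. j \<in> set is \<Longrightarrow> rat_bits (assoc j W / t) \<le> w"
  shows "calls_prog f_vec (Cell (Cell (enc_list enc_wt W) (Num t)) (enc_nats is)) (enc_row (map (\<lambda>j. assoc j W / t) is)) (V ^ 28)"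
  apply (rule calls_rec_V[OF _ prog_nth(20)[unfolded body_vec_def], where G = "\<lambda>is. enc_row (map (\<lambda>j. assoc j W / t) is)" and p = 21 and q = 1])
  subgoal by (simp add: length_prog)
  subgoal by (rule ev_weaken, ((rule ev_rules)+)[1], simp, use V_ge'[of 21] in simp)
  subgoal by (use assms nV in auto)
  subgoal premises prems for x zs
  proof -
    have b: "rat_bits (assoc x W / t) \<le> w" by (rule assms(4)[OF suffix_elem(1)[OF prems]])
    then show ?thesis
      by - (rule ev_weaken, ((rule ev_rules calls_assoc[OF assms(1)] b assms(2) | assumption)+)[1], simp, use V_ge[of 14 21] V_ge'[of 21] in simp)
  qed
  subgoal by simp
  done

text \<open>The suffixes \<open>zs\<close> occur because \<open>f_total\<close> adds up from the end
  of the list, and each partial total is subject to the precision.\<close>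

lemma weights_size_le:
  assumes M: "valid_mat M" and I: "set I \<subseteq> {..<n}" "distinct I" and J: "valid_cols J"
  shows "size_le (assoc j (weights M I (splits_of J))) \<sigma>"
    and "suffix zs (weights M I (splits_of J)) \<Longrightarrow> size_le (sum_list (map snd zs)) \<sigma>"
proof -
  let ?W = "weights M I (splits_of J)"
  have W: "frac_le D ((of_nat n * S) ^ n) n (snd p)" if "p \<in> set ?W" for p
    using that weights_frac[OF M I J] by (auto simp: weights_def)
  show "size_le (assoc j ?W) \<sigma>"
  proof (rule frac_size_le'[OF _ order_refl])
    have "frac_le D ((of_nat n * S) ^ n) n 0" using nS1 by (simp add: frac_le_def)
    then have "(\<And>p. p \<in> set W \<Longrightarrow> frac_le D ((of_nat n * S) ^ n) n (snd p)) \<Longrightarrow>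
        frac_le D ((of_nat n * S) ^ n) n (assoc j W)" for W
      by (induction W) auto
    from this[OF W] show "frac_le D ((of_nat n * S) ^ n) n (assoc j ?W)" .
  qed auto
  assume suf: "suffix zs ?W"
  have "frac_le D (of_nat n * (of_nat n * S) ^ n) n (\<Sum>p\<leftarrow>zs. snd p)"
  proof (rule frac_le_sum_list)
    show "length zs \<le> n" using suffix_length_le[OF suf] valid_cols_length[OF J] by (simp add: weights_def)
    show "0 \<le> (of_nat n * S) ^ n" using nS1 by simp
    fix p assume "p \<in> set zs"
    then have "p \<in> set ?W" using set_mono_suffix[OF suf] by blast
    then show "frac_le D ((of_nat n * S) ^ n) n (snd p)" by (rule W)
  qed
  then show "size_le (sum_list (map snd zs)) \<sigma>" by (rule frac_size_le'[OF _ n_nS]) auto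
qed

lemma size_le2_fits: "size_le q (2 * \<sigma>) \<Longrightarrow> rat_bits q \<le> w"
proof (rule size_le_w, erule size_le_mono)
  have "1 * (2 * \<sigma> + n * (3 * \<sigma> + 1) + 2) \<le> n * (2 * \<sigma> + n * (3 * \<sigma> + 1) + 2)"
    using n1 by (intro mult_right_mono) auto
  moreover have "2 * \<sigma> \<le> 1 * (2 * \<sigma> + n * (3 * \<sigma> + 1) + 2)" by simp
  ultimately show "2 * \<sigma> \<le> n * (2 * \<sigma> + n * (3 * \<sigma> + 1) + 2) + 1" by (meson le_trans le_add1)
qed

lemma cand_size_le:
  assumes M: "valid_mat M" and I: "set I \<subseteq> {..<n}" "distinct I" and J: "valid_cols J"
  shows "size_le (assoc j (weights M I (splits_of J)) / sum_list (map snd (weights M I (splits_of J)))) (2 * \<sigma>)"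
  using size_le_divide[OF weights_size_le(1)[OF assms] weights_size_le(2)[OF assms suffix_order.refl]] by (simp add: mult_2)

lemma calls_cand:
  assumes M: "valid_mat M" and I: "set I \<subseteq> {..<n}" "distinct I" and J: "valid_cols J"
  shows "calls_prog f_cand (Cell (Cell (enc_mat M) (enc_nats idx)) (Cell (enc_nats J) (enc_nats I)))
    (enc_mat (cand M idx J I)) (V ^ 70)"
proof -
  let ?W = "weights M I (splits_of J)"
  have lenW: "length ?W \<le> n" using valid_cols_length[OF J] by (simp add: weights_def)
  have b: "rat_bits (sum_list (map snd zs)) \<le> w" if "suffix zs ?W" for zs
    by (rule size_le_fits[OF weights_size_le(2)[OF assms that]])
  have b': "rat_bits (assoc j ?W / sum_list (map snd ?W)) \<le> w" for j
    by (rule size_le2_fits[OF cand_size_le[OF assms]])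
  have len: "length idx \<le> n" by simp
  note c = calls_weights[OF assms] calls_spl[OF valid_cols_length[OF J]] calls_spl[OF distinct_length_le[OF I(2,1)]]
    calls_total[OF lenW b] calls_vec[OF lenW _ len b']
  have "ev prog w [Cell (Cell (enc_mat M) (enc_nats idx)) (Cell (enc_nats J) (enc_nats I))] body_cand
    (enc_mat (cand M idx J I)) (V ^ 70)"
    unfolding body_cand_def
    by (rule ev_weaken, ((rule ev_rules c | assumption)+)[1], simp add: cand_def normalize_def Let_def,
      use V_ge[of 63 70] V_ge[of 28 70] V_ge[of 14 70] V_ge'[of 70] in simp)
  then show ?thesis by (intro callsI[OF _ prog_nth(21)]) (auto simp: length_prog)
qed

lemma length_cand_le: "length (cand M idx J I) \<le> 1"
  by (simp add: cand_def normalize_def Let_def)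

lemma calls_cand_rows:
  assumes M: "valid_mat M" and J: "valid_cols J" and Is: "\<And>I. I \<in> set Is \<Longrightarrow> set I \<subseteq> {..<n} \<and> distinct I" "length Is \<le> V ^ q" and r: "q + 83 \<le> r"
  shows "calls_prog f_cand_rows (Cell (Cell (Cell (enc_mat M) (enc_nats idx)) (enc_nats J)) (enc_list enc_nats Is)) (enc_mat (concat (map (cand M idx J) Is))) (V ^ r)"
  apply (rule calls_rec_V[OF _ prog_nth(22)[unfolded body_cand_rows_def], where G = "\<lambda>Is. enc_mat (concat (map (cand M idx J) Is))" and p = 77 and q = q])
  subgoal by (simp add: length_prog)
  subgoal by (rule ev_weaken, ((rule ev_rules)+)[1], simp, use V_ge'[of 77] in simp)
  subgoal by (use Is in simp)
  subgoal premises prems for x zs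
  proof -
    have x: "set x \<subseteq> {..<n}" "distinct x" using Is(1)[OF suffix_elem(1)[OF prems]] by auto
    have "length (cand M idx J x) \<le> V ^ 0" using length_cand_le by simp
    note c = calls_append[OF this order_refl] calls_cand[OF M x J]
    show ?thesis
      by - (rule ev_weaken, ((rule ev_rules c | assumption)+)[1], simp, use V_ge[of 70 77] V_ge[of "0 + 13" 77] V_ge'[of 77] in simp)
  qed
  subgoal by (use r in simp)
  done

lemma length_concat_le:
  assumes "\<And>x. x \<in> set xs \<Longrightarrow> length (f x) \<le> c"
  shows "length (concat (map f xs)) \<le> length xs * c"
  using assms by (induction xs) (auto intro: add_mono)

lemma row_lists:
  assumes Mt: "valid_mat Mt" and J: "valid_cols J"
  defines "Is \<equiv> consall (row_choices Mt idx (tl J)) idx"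
  shows "length (row_choices Mt idx (tl J)) \<le> V ^ 3" "length Is \<le> V ^ 4"
    "\<And>I. I \<in> set Is \<Longrightarrow> set I \<subseteq> {..<n} \<and> distinct I"
    "\<And>I. I \<in> set (row_choices Mt idx (tl J)) \<Longrightarrow> length I \<le> n"
    "set (tl J) \<subseteq> {..<n}" "length (tl J) \<le> n" "l ^ length (tl J) \<le> V ^ 3"
proof -
  show t: "set (tl J) \<subseteq> {..<n}" "length (tl J) \<le> n"
    using J valid_cols_length[OF J] by (cases J; simp add: valid_cols_def)+
  show l: "l ^ length (tl J) \<le> V ^ 3"
    using J le_trans[OF l_power_mono[of "length (tl J)" "length J"]] by (auto simp: valid_cols_def)
  show c: "length (row_choices Mt idx (tl J)) \<le> V ^ 3"
    using length_choices_le[OF Mt t(1)] l by simp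
  have "length Is \<le> n * length (row_choices Mt idx (tl J))"
    unfolding Is_def using length_consall_le[of _ idx] by simp
  also have "\<dots> \<le> V ^ (1 + 3)" by (rule V_pow_mult[OF nV1 c])
  finally show "length Is \<le> V ^ 4" by simp
  show "set I \<subseteq> {..<n} \<and> distinct I" if I: "I \<in> set Is" for I
  proof -
    obtain i L where L: "I = i # L" "i \<in> set idx" "L \<in> set (row_choices Mt idx (tl J))" "i \<notin> set L"
      using I unfolding Is_def mem_consall by blast
    then show ?thesis using row_choices_elem(2,3)[OF L(3)] by auto
  qed
  show "length I \<le> n" if "I \<in> set (row_choices Mt idx (tl J))" for I
    using row_choices_elem(1)[OF that] t by simp
qed

lemma length_cand_set_le:
  assumes "valid_mat Mt" "valid_cols J"
  shows "length (cand_set M Mt idx J) \<le> V ^ 4"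
proof (cases "J = []")
  case False
  have "length (cand_set M Mt idx J) \<le> length (consall (row_choices Mt idx (tl J)) idx) * 1"
    unfolding cand_set_def
    using False length_concat_le[of "consall (row_choices Mt idx (tl J)) idx" "cand M idx J" 1, OF length_cand_le] by simp
  then show ?thesis using row_lists(2)[OF assms] by simp
qed (simp add: cand_set_def)

lemma calls_cand_sets:
  assumes M: "valid_mat M" "valid_mat Mt" and Js: "\<And>J. J \<in> set Js \<Longrightarrow> valid_cols J" "length Js \<le> V ^ q" and r: "q + 100 \<le> r"
  shows "calls_prog f_cand_sets (Cell (Cell (enc_mat M) (Cell (enc_mat Mt) (enc_nats idx))) (enc_list enc_nats Js))
    (enc_mat (concat (map (cand_set M Mt idx) Js))) (V ^ r)"
  apply (rule calls_rec_V[OF _ prog_nth(23)[unfolded body_cand_sets_def], where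
      G = "\<lambda>Js. enc_mat (concat (map (cand_set M Mt idx) Js))" and p = 94 and q = q])
  subgoal by (simp add: length_prog)
  subgoal by (rule ev_weaken, ((rule ev_rules)+)[1], simp, use V_ge'[of 94] in simp)
  subgoal by (use Js in simp)
  subgoal premises prems for J zs
  proof -
    have J: "valid_cols J" by (rule Js(1)[OF suffix_elem(1)[OF prems]])
    show ?thesis
    proof (cases J)
      case Nil
      show ?thesis unfolding Nil enc_list_simps
        by (rule ev_weaken, rule ev_If_Cell_False, ((rule ev_rules)+)[2], simp add: cand_set_def, use V_ge'[of 94] in simp)
    next
      case (Cons j J')
      note R = row_lists[OF M(2) J, unfolded Cons list.sel]
      have "length (cand_set M Mt idx (j # J')) \<le> V ^ 4" using length_cand_set_le[OF M(2) J] Cons by simp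
      note app = calls_append[OF this[unfolded cand_set_def, simplified] order_refl]
      have len: "length idx \<le> n" by simp
      note c = app calls_cand_rows[OF M(1) J[unfolded Cons] R(3,2) order_refl, unfolded enc_list_simps]
        calls_consall[OF R(1,4) len order_refl] calls_choices[OF M(2) R(5-7) order_refl]
      show ?thesis unfolding Cons enc_list_simps
        by (rule ev_weaken, rule ev_If_Cell_True, ((rule ev_rules c | assumption)+)[2], simp add: cand_set_def,
          use V_ge[of 87 94] V_ge[of 17 94] V_ge[of 44 94] V_ge[of 58 94] V_ge'[of 94] in simp)
    qed
  qed
  subgoal by (use r in simp)
  done

end

section \<open>Enumeration of supports along walks\<close>

context game_machine
begin

lemma step_subset: "set (step_list M idx L) \<subseteq> {..<n}"
  by (auto simp: set_step_list)

lemma length_step_V: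
  assumes "valid_mat M" "set L \<subseteq> {..<n}" "length L \<le> V ^ q"
  shows "length (step_list M idx L) \<le> V ^ (q + 1)"
proof -
  have "length (step_list M idx L) \<le> length L * n"
    unfolding step_list_def by (rule length_concat_le) (rule length_nzs_n)
  also have "\<dots> \<le> V ^ (q + 1)" by (rule V_pow_mult[OF assms(3) nV1])
  finally show ?thesis .
qed

lemma spread_subset: "set (spread idx A At B Bt L) \<subseteq> {..<n}"
  unfolding spread_def Let_def using step_subset by auto

lemma length_spread_le:
  assumes ok: "valid_mat A" "valid_mat At" "valid_mat B" "valid_mat Bt" and L: "set L \<subseteq> {..<n}"
  shows "length (spread idx A At B Bt L) \<le> 4 * l ^ 2 * length L"
proof -
  let ?R = "step_list At idx L @ step_list Bt idx L"
  have R: "set ?R \<subseteq> {..<n}" using step_subset by auto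
  have "length ?R \<le> 2 * l * length L"
    using length_step_le[OF ok(2) L] length_step_le[OF ok(4) L] by simp
  then have "2 * l * length ?R \<le> 2 * l * (2 * l * length L)" by (rule mult_left_mono) simp
  moreover have "length (spread idx A At B Bt L) \<le> 2 * l * length ?R"
    using length_step_le[OF ok(1) R] length_step_le[OF ok(3) R] by (simp add: spread_def Let_def)
  ultimately have "length (spread idx A At B Bt L) \<le> 2 * l * (2 * l * length L)" by (rule le_trans[rotated])
  then show ?thesis by (simp add: power2_eq_square mult_ac)
qed

lemma calls_spread:
  assumes ok: "valid_mat A" "valid_mat At" "valid_mat B" "valid_mat Bt" and L: "set L \<subseteq> {..<n}" "length L \<le> V ^ q"
    and r: "q + 43 \<le> r"
  shows "calls_prog f_spread (Cell (enc_graph l' idx A At B Bt) (enc_nats L)) (enc_nats (spread idx A At B Bt L)) (V ^ r)"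
proof -
  let ?R = "step_list At idx L @ step_list Bt idx L"
  have R: "set ?R \<subseteq> {..<n}" using step_subset by auto
  have lR: "length ?R \<le> V ^ (q + 2)"
    using V_pow_add[OF length_step_V[OF ok(2) L] length_step_V[OF ok(4) L]] by simp
  note c = calls_append[OF length_step_V[OF ok(2) L] order_refl] calls_append[OF length_step_V[OF ok(1) R lR] order_refl]
    calls_step[OF ok(2) L order_refl] calls_step[OF ok(4) L order_refl]
    calls_step[OF ok(1) R lR order_refl] calls_step[OF ok(3) R lR order_refl]
  have "ev prog w [Cell (enc_graph l' idx A At B Bt) (enc_nats L)] body_spread
    (enc_nats (spread idx A At B Bt L)) (V ^ (q + 43))"
    unfolding body_spread_def enc_graph_def
    by (rule ev_weaken, ((rule ev_rules c)+)[1], simp add: spread_def Let_def,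
      use V_ge[of "q + 34" "q + 43"] V_ge[of "q + 2 + 34" "q + 43"] V_ge[of "q + 1 + 13" "q + 43"]
        V_ge[of "q + 2 + 1 + 13" "q + 43"] V_ge'[of "q + 43"] in simp)
  from ev_weaken[OF this refl V_mono[OF r]] show ?thesis
    by (intro callsI[OF _ prog_nth(24)]) (auto simp: length_prog)
qed

text \<open>A bound on the number of neighbours: \<open>spread\<close> yields at most
  \<open>4 * l ^ 2\<close> columns per column and is applied twice. For \<open>l = 1\<close> the
  value \<open>1\<close> is essential, since walks of \<open>n\<close> steps with a larger branching
  factor would not be bounded by a fixed power of \<open>V = n + 1\<close>.\<close>

definition \<Delta> :: nat where "\<Delta> = (if l < 2 then 1 else 16 * l ^ 4)"

lemma length_nbrs_le:
  assumes ok: "valid_mat A" "valid_mat At" "valid_mat B" "valid_mat Bt" and c: "c < n"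
  shows "length (nbrs l idx A At B Bt c) \<le> \<Delta>"
proof (cases "l < 2")
  case True
  then have l: "l = 1" using l1 by simp
  have "length (step_list At idx [c]) \<le> l * length [c]" using c by (intro length_step_le ok) auto
  moreover have "length (step_list B idx (step_list At idx [c])) \<le> l * length (step_list At idx [c])"
    by (intro length_step_le ok step_subset)
  moreover have "\<Delta> = 1" using True by (simp add: \<Delta>_def)
  ultimately show ?thesis using l by (simp add: nbrs_def)
next
  case False
  have "length (spread idx A At B Bt [c]) \<le> 4 * l ^ 2 * length [c]" using c by (intro length_spread_le ok) auto
  then have "4 * l ^ 2 * length (spread idx A At B Bt [c]) \<le> 4 * l ^ 2 * (4 * l ^ 2 * length [c])"
    by (rule mult_left_mono) simp
  moreover have "length (spread idx A At B Bt (spread idx A At B Bt [c])) \<le> 4 * l ^ 2 * length (spread idx A At B Bt [c])"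
    by (intro length_spread_le ok spread_subset)
  ultimately have "length (spread idx A At B Bt (spread idx A At B Bt [c])) \<le> 4 * l ^ 2 * (4 * l ^ 2 * length [c])"
    by (rule le_trans[rotated])
  also have "\<dots> = 16 * l ^ 4" by (simp add: power_add[symmetric])
  finally show ?thesis using False by (simp add: nbrs_def \<Delta>_def)
qed

lemma nbrs_subset: "set (nbrs l idx A At B Bt c) \<subseteq> {..<n}"
  unfolding nbrs_def using step_subset spread_subset by auto

lemma \<Delta>_pos: "1 \<le> \<Delta>" using l1 by (simp add: \<Delta>_def)

lemma lV: "l ^ (k * l) \<le> V" unfolding V_def by simp

lemma lV1: "l \<le> V"
proof -
  have "1 * 1 \<le> k * l" using k1 l1 by (intro mult_mono) auto
  then have "l ^ 1 \<le> l ^ (k * l)" by (intro l_power_mono) simp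
  then show ?thesis using lV by simp
qed

lemma \<Delta>_V: "\<Delta> \<le> V ^ 8"
proof -
  have "16 * l ^ 4 \<le> V ^ (4 + 4)"
    using V_pow[of 4] lV1 by (intro V_pow_mult power_mono) auto
  then show ?thesis using V1[of 8] by (simp add: \<Delta>_def)
qed

lemma calls_nbrs:
  assumes ok: "valid_mat A" "valid_mat At" "valid_mat B" "valid_mat Bt" and c: "c < n"
  shows "calls_prog f_nbrs (Cell (enc_graph l idx A At B Bt) (Num (of_nat c))) (enc_nats (nbrs l idx A At B Bt c)) (V ^ 54)"
proof -
  have c1: "set [c] \<subseteq> {..<n}" "length [c] \<le> V ^ 0" using c by auto
  have "length (spread idx A At B Bt [c]) \<le> 4 * l ^ 2 * length [c]" using c by (intro length_spread_le ok) auto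
  also have "\<dots> \<le> V ^ (2 + 2)"
    using V_pow_mult[OF _ power_mono[OF lV1], of 4 2 2] V_pow[of 2] by simp
  finally have s: "length (spread idx A At B Bt [c]) \<le> V ^ 4" by simp
  note cl = calls_spread[OF ok c1 order_refl, of l, unfolded enc_graph_def enc_list_simps]
    calls_spread[OF ok spread_subset s order_refl, of l, unfolded enc_graph_def]
    calls_step[OF ok(2) c1 order_refl, unfolded enc_list_simps]
    calls_step[OF ok(3) step_subset length_step_V[OF ok(2) c1] order_refl]
  have "ev prog w [Cell (enc_graph l idx A At B Bt) (Num (of_nat c))] body_nbrs
    (enc_nats (nbrs l idx A At B Bt c)) (V ^ 54)"
    unfolding body_nbrs_def enc_graph_def
    by (rule ev_weaken, ((rule ev_rules cl)+)[1], simp add: nbrs_def,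
      use V_ge[of 34 54] V_ge[of 35 54] V_ge[of 43 54] V_ge[of 47 54] V_ge'[of 54] in simp)
  then show ?thesis by (intro callsI[OF _ prog_nth(25)]) (auto simp: length_prog)
qed

lemma calls_ins:
  assumes "length U \<le> n"
  shows "calls_prog f_ins (Cell (Num (of_nat j)) (enc_nats U)) (enc_nats (ins j U)) (V ^ 21)"
proof -
  have "ev prog w [Cell (Num (of_nat j)) (enc_nats U)] body_ins (enc_nats (ins j U)) (V ^ 21)"
    unfolding body_ins_def
    by (rule ev_weaken, ((rule ev_rules calls_member[OF assms])+)[1], simp add: ins_def,
      use V_ge[of 14 21] V_ge'[of 21] in simp)
  then show ?thesis by (intro callsI[OF _ prog_nth(26)]) (auto simp: length_prog)
qed

lemma calls_ext:
  assumes "length U \<le> n" "length ns \<le> V ^ 8"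
  shows "calls_prog f_ext (Cell (enc_nats U) (enc_nats ns)) (enc_list enc_st (ext U ns)) (V ^ 42)"
  apply (rule calls_rec_V[OF _ prog_nth(27)[unfolded body_ext_def], where G = "\<lambda>ns. enc_list enc_st (ext U ns)" and p = 28 and q = 8])
  subgoal by (simp add: length_prog)
  subgoal by (rule ev_weaken, ((rule ev_rules)+)[1], simp add: ext_def, use V_ge'[of 28] in simp)
  subgoal by (use assms in simp)
  subgoal premises prems for x zs
  proof -
    show ?thesis
      by - (rule ev_weaken, ((rule ev_rules calls_ins[OF assms(1)] | assumption)+)[1], simp add: ext_def, use V_ge[of 21 28] V_ge'[of 28] in simp)
  qed
  subgoal by simp
  done

definition valid_walks :: "(nat \<times> nat list) list \<Rightarrow> bool" where
  "valid_walks W \<longleftrightarrow> (\<forall>(c, U)\<in>set W. c < n \<and> distinct U \<and> set U \<subseteq> {..<n})"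

context
  fixes A At B Bt :: "rat list list"
  assumes ok: "valid_mat A" "valid_mat At" "valid_mat B" "valid_mat Bt"
begin

abbreviation graph :: val where "graph \<equiv> enc_graph l idx A At B Bt"

abbreviation nb :: "nat \<Rightarrow> nat list" where "nb \<equiv> nbrs l idx A At B Bt"

lemma valid_walks_ext_all:
  assumes "valid_walks W"
  shows "valid_walks (ext_all nb W)"
  unfolding valid_walks_def
proof safe
  fix c U assume "(c, U) \<in> set (ext_all nb W)"
  then obtain c0 U0 where W: "(c0, U0) \<in> set W" and c: "c \<in> set (nb c0)" and U: "U = ins c U0"
    by (auto simp: ext_all_def ext_def)
  have U0: "distinct U0" "set U0 \<subseteq> {..<n}" using assms W by (auto simp: valid_walks_def)
  show "c < n" using c nbrs_subset by blast
  then show "distinct U" "\<And>x. x \<in> set U \<Longrightarrow> x < n" using U0 by (auto simp: U ins_def split: if_splits)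
qed

lemma length_ext_all: "valid_walks W \<Longrightarrow> length (ext_all nb W) \<le> length W * \<Delta>"
  unfolding ext_all_def
proof (rule length_concat_le)
  fix x assume W: "valid_walks W" "x \<in> set W"
  then show "length (case x of (c, U) \<Rightarrow> ext U (nb c)) \<le> \<Delta>"
    using length_nbrs_le[OF ok] by (cases x) (auto simp: valid_walks_def ext_def)
qed

lemma calls_ext_all:
  assumes W: "valid_walks W" "length W \<le> V ^ q" and r: "q + 67 \<le> r"
  shows "calls_prog f_ext_all (Cell graph (enc_list enc_st W)) (enc_list enc_st (ext_all nb W)) (V ^ r)"
  apply (rule calls_rec_V[OF _ prog_nth(28)[unfolded body_ext_all_def], where G = "\<lambda>W. enc_list enc_st (ext_all nb W)" and p = 61 and q = q])
  subgoal by (simp add: length_prog)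
  subgoal by (rule ev_weaken, ((rule ev_rules)+)[1], simp add: ext_all_def, use V_ge'[of 61] in simp)
  subgoal by (use W in simp)
  subgoal premises prems for x zs
  proof -
    obtain c U where x: "x = (c, U)" by (cases x)
    have c: "c < n" and "length U \<le> n"
      using W(1) suffix_elem(1)[OF prems] distinct_length_le[of U] by (auto simp: valid_walks_def x)
    have ns: "length (nb c) \<le> V ^ 8" using length_nbrs_le[OF ok c] \<Delta>_V by simp
    then have "length (ext U (nb c)) \<le> V ^ 8" by (simp add: ext_def)
    note cl = calls_append[OF this order_refl] calls_ext[OF \<open>length U \<le> n\<close> ns] calls_nbrs[OF ok c]
    show ?thesis unfolding x enc_st.simps
      by - (rule ev_weaken, ((rule ev_rules cl | assumption)+)[1], simp add: ext_all_def, use V_ge[of 54 61] V_ge[of 42 61] V_ge[of 21 61] V_ge'[of 61] in simp)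
  qed
  subgoal by (use r in simp)
  done

text \<open>The quantity \<open>length W * \<Delta> ^ m\<close> does not grow along the recursion:
  one level multiplies the list by at most \<open>\<Delta>\<close> and uses up one power. So a
  single bound \<open>V ^ q\<close> serves all levels.\<close>

lemma calls_levels:
  assumes "valid_walks W" "length W * \<Delta> ^ m \<le> V ^ q" "m \<le> 2 * n"
  shows "calls_prog f_levels (Cell graph (Cell (Num (of_nat m)) (enc_list enc_st W)))
    (enc_list enc_st (levels nb m W)) ((m + 1) * V ^ (q + 74))"
  using assms
proof (induction m arbitrary: W)
  case 0
  show ?case
    unfolding calls_def length_prog prog_nth body_levels_def
    by (rule conjI, simp, rule ev_weaken,
        rule ev_If_Less[where ?t1.0 = 0 and ?v1.0 = Null], ((rule ev_rules)+)[2])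
      (use V_ge'[of "q + 74"] in \<open>auto intro: ev_rules\<close>)
next
  case (Suc m)
  have d: "1 \<le> \<Delta> ^ Suc m" using \<Delta>_pos by simp
  have W: "length W \<le> V ^ q"
    using le_trans[OF mult_left_mono[OF d, of "length W"] Suc.prems(2)] by simp
  have "length (ext_all nb W) * \<Delta> ^ m \<le> length W * \<Delta> * \<Delta> ^ m"
    using length_ext_all[OF Suc.prems(1)] by (intro mult_right_mono) auto
  also have "\<dots> = length W * \<Delta> ^ Suc m" by (simp add: mult.assoc)
  also note Suc.prems(2)
  finally have e: "length (ext_all nb W) * \<Delta> ^ m \<le> V ^ q" .
  have eq: "of_nat (Suc m) - 1 = (of_nat m :: rat)" by simp
  have IH: "calls_prog f_levels (Cell graph (Cell (Num (of_nat (Suc m) - 1)) (enc_list enc_st (ext_all nb W))))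
    (enc_list enc_st (levels nb m (ext_all nb W))) ((m + 1) * V ^ (q + 74))"
    unfolding eq by (rule Suc.IH[OF valid_walks_ext_all[OF Suc.prems(1)] e]) (use Suc.prems in simp)
  have b: "rat_bits (of_nat (Suc m) - 1) \<le> w" unfolding eq by (rule w_nat) (use Suc.prems in simp)
  note cl = calls_append[OF W order_refl] calls_ext_all[OF Suc.prems(1) W order_refl] IH
  show ?case
    unfolding calls_def length_prog prog_nth body_levels_def
    by (rule conjI, simp, rule ev_weaken, ((rule ev_rules cl b)+)[1])
      (use V_ge[of "q + 13" "q + 74"] V_ge[of "q + 67" "q + 74"] V_ge'[of "q + 74"] in auto)
qed

lemma length_levels:
  assumes "valid_walks W"
  shows "length (levels nb m W) \<le> (m + 1) * (length W * \<Delta> ^ m)"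
  using assms
proof (induction m arbitrary: W)
  case (Suc m)
  define X where "X = length W * \<Delta> ^ Suc m"
  have "length (levels nb m (ext_all nb W)) \<le> (m + 1) * (length (ext_all nb W) * \<Delta> ^ m)"
    by (rule Suc.IH[OF valid_walks_ext_all[OF Suc.prems]])
  also have "\<dots> \<le> (m + 1) * (length W * \<Delta> * \<Delta> ^ m)"
    using length_ext_all[OF Suc.prems] by (intro mult_left_mono mult_right_mono) auto
  also have "length W * \<Delta> * \<Delta> ^ m = X" by (simp add: X_def mult.assoc)
  finally have "length (levels nb m (ext_all nb W)) \<le> (m + 1) * X" .
  moreover have "length W * 1 \<le> X" unfolding X_def using \<Delta>_pos by (intro mult_left_mono) auto
  ultimately show ?case unfolding X_def[symmetric] by simp
qed simp

lemma levels_elem: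
  assumes "valid_walks W" "\<And>c U. (c, U) \<in> set W \<Longrightarrow> length U \<le> d" "(c, U) \<in> set (levels nb m W)"
  shows "distinct U \<and> set U \<subseteq> {..<n} \<and> length U \<le> d + m"
  using assms
proof (induction m arbitrary: W d)
  case 0
  then show ?case by (auto simp: valid_walks_def)
next
  case (Suc m)
  consider "(c, U) \<in> set W" | "(c, U) \<in> set (levels nb m (ext_all nb W))" using Suc.prems(3) by auto
  then show ?case
  proof cases
    case 1
    then show ?thesis using Suc.prems(1) Suc.prems(2)[OF 1] by (auto simp: valid_walks_def)
  next
    case 2
    have "length S' \<le> d + 1" if S': "(c', S') \<in> set (ext_all nb W)" for c' S'
    proof -
      obtain c0 S0 where "(c0, S0) \<in> set W" "S' = ins c' S0" using S' by (auto simp: ext_all_def ext_def)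
      then show ?thesis using Suc.prems(2)[of c0 S0] by (simp add: ins_def)
    qed
    from Suc.IH[OF valid_walks_ext_all[OF Suc.prems(1)] this 2] show ?thesis by simp
  qed
qed

lemma calls_sets:
  assumes "length W \<le> V ^ q" "q + 13 \<le> r"
  shows "calls_prog f_sets (Cell Null (enc_list enc_st W)) (enc_list enc_nats (map snd W)) (V ^ r)"
  apply (rule calls_rec_V[OF _ prog_nth(30)[unfolded body_sets_def], where G = "\<lambda>W. enc_list enc_nats (map snd W)" and p = 7 and q = q])
  subgoal by (simp add: length_prog)
  subgoal by (rule ev_weaken, ((rule ev_rules)+)[1], simp, use V_ge'[of 7] in simp)
  subgoal by (use assms in simp)
  subgoal premises prems for x zs
  proof -
    obtain c U where x: "x = (c, U)" by (cases x)
    show ?thesis unfolding x enc_st.simps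
      by - (rule ev_weaken, ((rule ev_rules  | assumption)+)[1], simp, use  V_ge'[of 7] in simp)
  qed
  subgoal by (use assms in simp)
  done

lemma calls_init:
  shows "calls_prog f_init (Cell Null (enc_nats idx)) (enc_list enc_st (map (\<lambda>j. (j, [j])) idx)) (V ^ 14)"
  apply (rule calls_rec_V[OF _ prog_nth(31)[unfolded body_init_def], where G = "\<lambda>is. enc_list enc_st (map (\<lambda>j. (j, [j])) is)" and p = 7 and q = 1])
  subgoal by (simp add: length_prog)
  subgoal by (rule ev_weaken, ((rule ev_rules)+)[1], simp, use V_ge'[of 7] in simp)
  subgoal by (use nV in simp)
  subgoal premises prems for x zs
  proof -
    show ?thesis
      by - (rule ev_weaken, ((rule ev_rules  | assumption)+)[1], simp, use  V_ge'[of 7] in simp)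
  qed
  subgoal by simp
  done

lemma length_subs_le: "length (subs xs) \<le> 2 ^ length xs"
proof (induction xs)
  case (Cons x xs)
  have "length (mapcons x (subs xs)) \<le> length (subs xs)" by (simp add: mapcons_def)
  then show ?case using Cons by simp
qed simp

lemma subs_elem: "distinct xs \<Longrightarrow> L \<in> set (subs xs) \<Longrightarrow> distinct L \<and> set L \<subseteq> set xs"
proof (induction xs arbitrary: L)
  case (Cons x xs)
  then consider "L \<in> set (subs xs)" | L' where "L = x # L'" "L' \<in> set (subs xs)" "x \<notin> set L'"
    by (auto simp: mapcons_def)
  then show ?case
  proof cases
    case 1
    then show ?thesis using Cons.IH[OF _ 1] Cons.prems(1) by auto
  next
    case 2
    then show ?thesis using Cons.IH[OF _ 2(2)] Cons.prems(1) by auto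
  qed
qed simp

lemma calls_subs:
  assumes xs: "length xs \<le> n" "distinct xs" and q: "2 ^ length xs \<le> V ^ q" and r: "q + 41 \<le> r"
  shows "calls_prog f_subs (Cell Null (enc_nats xs)) (enc_list enc_nats (subs xs)) (V ^ r)"
  apply (rule calls_rec_V[OF _ prog_nth(32)[unfolded body_subs_def], where G = "\<lambda>xs. enc_list enc_nats (subs xs)" and p = "q + 34" and q = 1])
  subgoal by (simp add: length_prog)
  subgoal by (rule ev_weaken, ((rule ev_rules)+)[1], simp, use V_ge'[of "q + 34"] in simp)
  subgoal by (use xs nV in simp)
  subgoal premises prems for x zs
  proof -
    have len: "length zs \<le> length xs" and dz: "distinct zs"
      using suffix_elem(3)[OF prems] xs(2) prems by (auto simp: suffix_def)
    have "length (subs zs) \<le> 2 ^ length zs" by (rule length_subs_le)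
    also have "\<dots> \<le> 2 ^ length xs" using len by (intro power_increasing) auto
    finally have s: "length (subs zs) \<le> V ^ q" using q by simp
    then have "length (mapcons x (subs zs)) \<le> V ^ q" using le_trans[OF length_filter_le] by (simp add: mapcons_def)
    note app = calls_append[OF this order_refl]
    have "length L \<le> n" if "L \<in> set (subs zs)" for L
    proof -
      have "length L \<le> length zs" using subs_elem[OF dz that] dz
        by (metis card_mono distinct_card finite_set)
      then show ?thesis using len xs by simp
    qed
    note mc = calls_mapcons[OF s this order_refl]
    show ?thesis
      by - (rule ev_weaken, ((rule ev_rules app mc | assumption)+)[1], simp, use V_ge[of "q + 13" "q + 34"] V_ge[of "q + 27" "q + 34"] V_ge'[of "q + 34"] in simp)
  qed
  subgoal by (use r in simp)
  done

lemma valid_walks_init: "valid_walks (map (\<lambda>j. (j, [j])) idx)"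
  by (auto simp: valid_walks_def)

text \<open>For \<open>l \<ge> 2\<close> the constant disappears through
  \<open>16 * l ^ 4 \<le> l ^ 8\<close>, so that \<open>2 * k\<close> steps give at most
  \<open>l ^ (16 * k)\<close>, which is bounded by \<open>V ^ 16\<close>; the \<open>n\<close>
  starting columns account for the last factor. For \<open>l = 1\<close> the branching factor is
  \<open>1\<close>.\<close>

lemma init_power_le:
  assumes "l < 2 \<or> m \<le> 2 * k"
  shows "length (map (\<lambda>j. (j, [j])) idx) * \<Delta> ^ m \<le> V ^ 17"
proof (cases "l < 2")
  case True
  then show ?thesis using nV V_mono[of 1 17] by (simp add: \<Delta>_def)
next
  case False
  have "(2 :: nat) ^ 4 \<le> l ^ 4" using False by (intro power_mono) auto
  then have "16 * l ^ 4 \<le> l ^ 4 * l ^ 4" by (intro mult_right_mono) auto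
  then have "\<Delta> \<le> l ^ 8" using False by (simp add: \<Delta>_def flip: power_add)
  then have "\<Delta> ^ m \<le> (l ^ 8) ^ m" by (rule power_mono) simp
  also have "\<dots> = l ^ (8 * m)" by (simp add: power_mult)
  also have "\<dots> \<le> l ^ ((k * l) * 16)"
  proof (rule l_power_mono)
    have "k * 1 \<le> k * l" using l1 by (intro mult_left_mono) auto
    then show "8 * m \<le> k * l * 16" using assms False by linarith
  qed
  also have "\<dots> = (l ^ (k * l)) ^ 16" by (simp add: power_mult)
  also have "\<dots> \<le> V ^ 16" using lV by (intro power_mono) auto
  finally show ?thesis using V_pow_mult[OF nV1, of "\<Delta> ^ m" 16] by simp
qed

lemma walk_sets_valid_cols:
  assumes "l < 2 \<or> m \<le> 2 * k" "J \<in> set (map snd (levels nb m (map (\<lambda>j. (j, [j])) idx)))"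
  shows "valid_cols J"
proof -
  obtain c where c: "(c, J) \<in> set (levels nb m (map (\<lambda>j. (j, [j])) idx))" using assms(2) by auto
  have "length U \<le> 1" if "(c', U) \<in> set (map (\<lambda>j. (j, [j])) idx)" for c' and U :: "nat list" using that by auto
  from levels_elem[OF valid_walks_init this c]
  have J: "distinct J" "set J \<subseteq> {..<n}" "length J \<le> 1 + m" by auto
  have "l ^ length J \<le> V ^ 3"
  proof (cases "l < 2")
    case True
    then have "l = 1" using l1 by linarith
    then have "l ^ length J = 1" by simp
    then show ?thesis using V1[of 3] by linarith
  next
    case False
    have "k * 1 \<le> k * l" using l1 by (intro mult_left_mono) auto
    then have "length J \<le> k * l * 3" using J(3) assms(1) False k1 by linarith
    then have "l ^ length J \<le> l ^ (k * l * 3)" by (rule l_power_mono)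
    also have "\<dots> = (l ^ (k * l)) ^ 3" by (simp add: power_mult)
    also have "\<dots> \<le> V ^ 3" using lV by (intro power_mono) auto
    finally show ?thesis .
  qed
  then show ?thesis using J by (simp add: valid_cols_def)
qed

lemma idx_valid_cols:
  assumes "l < 2 \<or> \<not> k * l < n" "distinct J" "set J \<subseteq> {..<n}"
  shows "valid_cols J"
proof -
  have "l ^ length J \<le> V ^ 3"
  proof (cases "l < 2")
    case True
    then have "l = 1" using l1 by linarith
    then have "l ^ length J = 1" by simp
    then show ?thesis using V1[of 3] by linarith
  next
    case False
    then have "l ^ length J \<le> l ^ (k * l)" using assms distinct_length_le[OF assms(2,3)] by (intro l_power_mono) auto
    then show ?thesis using lV V_mono[of 1 3] by simp
  qed
  then show ?thesis using assms by (simp add: valid_cols_def)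
qed

lemma col_sets_valid_cols: "J \<in> set (col_sets k l idx A At B Bt) \<Longrightarrow> valid_cols J"
proof -
  assume J: "J \<in> set (col_sets k l idx A At B Bt)"
  consider "l < 2" | "\<not> l < 2" "k * l < n" | "\<not> l < 2" "\<not> k * l < n" by blast
  then show ?thesis
  proof cases
    case 1
    then consider "J = idx" | "J \<in> set (map snd (levels nb n (map (\<lambda>j. (j, [j])) idx)))"
      using J by (auto simp: col_sets_def Let_def)
    then show ?thesis
    proof cases
      assume "J = idx"
      then show ?thesis using 1 by (intro idx_valid_cols) auto
    next
      assume "J \<in> set (map snd (levels nb n (map (\<lambda>j. (j, [j])) idx)))"
      then show ?thesis using 1 by (intro walk_sets_valid_cols) auto
    qed
  next
    case 2
    then have "J \<in> set (map snd (levels nb (2 * k) (map (\<lambda>j. (j, [j])) idx)))"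
      using J by (simp add: col_sets_def Let_def)
    then show ?thesis by (intro walk_sets_valid_cols) auto
  next
    case 3
    then have "J \<in> set (subs idx)" using J by (simp add: col_sets_def Let_def)
    from subs_elem[OF _ this] show ?thesis using 3 by (intro idx_valid_cols) auto
  qed
qed

lemma succ_2n_V: "m \<le> 2 * n \<Longrightarrow> m + 1 \<le> V ^ 3"
proof -
  assume "m \<le> 2 * n"
  then have "m + 1 \<le> 2 * V ^ 1 + 2 * V ^ 1" using nV V2 by simp
  also have "\<dots> \<le> V ^ 2 + V ^ 2" using V_double[of 1] by (simp add: numeral_2_eq_2)
  also have "\<dots> \<le> V ^ 3" using V_double[of 2] by simp
  finally show ?thesis .
qed

lemma calls_walk_sets:
  assumes m: "l < 2 \<or> m \<le> 2 * k" "m \<le> 2 * n"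
  defines "W \<equiv> map (\<lambda>j. (j, [j])) idx"
  shows "calls_prog f_levels (Cell graph (Cell (Num (of_nat m)) (enc_list enc_st W)))
      (enc_list enc_st (levels nb m W)) (V ^ 94)"
    and "calls_prog f_sets (Cell Null (enc_list enc_st (levels nb m W))) (enc_list enc_nats (map snd (levels nb m W))) (V ^ 33)"
    and "length (levels nb m W) \<le> V ^ 20"
proof -
  show "calls_prog f_levels (Cell graph (Cell (Num (of_nat m)) (enc_list enc_st W)))
      (enc_list enc_st (levels nb m W)) (V ^ 94)"
    unfolding W_def
    by (rule calls_weaken[OF calls_levels[OF valid_walks_init init_power_le[OF m(1)] m(2)]])
      (use V_pow_mult[OF succ_2n_V[OF m(2)] order_refl[of "V ^ 91"]] in simp)
  have "length (levels nb m W) \<le> (m + 1) * (length W * \<Delta> ^ m)" unfolding W_def by (rule length_levels[OF valid_walks_init])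
  also have "\<dots> \<le> V ^ (3 + 17)" unfolding W_def by (rule V_pow_mult[OF succ_2n_V[OF m(2)] init_power_le[OF m(1)]])
  finally show l: "length (levels nb m W) \<le> V ^ 20" by simp
  show "calls_prog f_sets (Cell Null (enc_list enc_st (levels nb m W))) (enc_list enc_nats (map snd (levels nb m W))) (V ^ 33)"
    by (rule calls_sets[OF l]) simp
qed

text \<open>Here \<open>l \<ge> 2\<close> and \<open>n \<le> k * l\<close> pay for trying all
  subsets: \<open>2 ^ n \<le> l ^ (k * l)\<close>.\<close>

lemma two_power_le: "\<not> l < 2 \<Longrightarrow> \<not> k * l < n \<Longrightarrow> 2 ^ length idx \<le> V ^ 1"
proof -
  assume "\<not> l < 2" "\<not> k * l < n"
  then have "(2 :: nat) ^ n \<le> l ^ n" by (intro power_mono) auto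
  also have "\<dots> \<le> l ^ (k * l)" using \<open>\<not> k * l < n\<close> by (intro l_power_mono) simp
  finally show ?thesis using lV by simp
qed

lemma length_col_sets: "length (col_sets k l idx A At B Bt) \<le> V ^ 21"
proof -
  have n: "n \<le> 2 * n" by simp
  have k2: "2 * k \<le> 2 * n" if "k * l < n"
  proof -
    have "k * 1 \<le> k * l" using l1 by (intro mult_left_mono) auto
    then show ?thesis using that by linarith
  qed
  consider "l < 2" | "\<not> l < 2" "k * l < n" | "\<not> l < 2" "\<not> k * l < n" by blast
  then show ?thesis
  proof cases
    case 1
    then show ?thesis using calls_walk_sets(3)[OF disjI1 n] V_double[of 20] V1[of 20]
      by (simp add: col_sets_def Let_def)
  next
    case 2
    then show ?thesis using calls_walk_sets(3)[OF disjI2 k2] V_mono[of 20 21] by (simp add: col_sets_def Let_def)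
  next
    case 3
    have "length (subs idx) \<le> V ^ 1" using length_subs_le[of idx] two_power_le[OF 3] by linarith
    then show ?thesis using 3 V_mono[of 1 21] by (simp add: col_sets_def Let_def)
  qed
qed

lemma calls_col_sets:
  "calls_prog f_col_sets (Cell (Num (of_nat k)) graph) (enc_list enc_nats (col_sets k l idx A At B Bt)) (V ^ 101)"
proof -
  have n: "n \<le> 2 * n" "length idx \<le> n" by simp_all
  have k2: "2 * k \<le> 2 * n" if "k * l < n"
  proof -
    have "k * 1 \<le> k * l" using l1 by (intro mult_left_mono) auto
    then show ?thesis using that by linarith
  qed
  have len: "calls_prog f_length (Cell Null (enc_nats idx)) (Num (of_nat n)) (V ^ 14)"
    using calls_length[OF n(2)] by simp
  note fold = enc_graph_def[of l idx A At B Bt]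
  note cl = len calls_init
  have eqm: "of_nat k + of_nat k = (of_nat (2 * k) :: rat)" "of_nat k * of_nat l = (of_nat (k * l) :: rat)" by simp_all
  have b: "rat_bits (of_nat k + of_nat k) \<le> w" "rat_bits (of_nat k * of_nat l) \<le> w"
    unfolding eqm by (rule w_k)+
  have v: "V ^ 94 * 128 \<le> V ^ 101" "V ^ 33 * 128 \<le> V ^ 101" "V ^ 14 * 128 \<le> V ^ 101" "V ^ 42 * 128 \<le> V ^ 101" "128 \<le> V ^ 101"
    using V_ge[of 94 101] V_ge[of 33 101] V_ge[of 14 101] V_ge[of 42 101] V_ge'[of 101] by simp_all
  have "ev prog w [Cell (Num (of_nat k)) graph] body_col_sets (enc_list enc_nats (col_sets k l idx A At B Bt)) (V ^ 101)"
  \<comment> \<open>The branches are separated beforehand because each cost bound is available only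
    where its branch is taken; the list of all subsets, for instance, may otherwise be far too
    long.\<close>
  proof (cases "l < 2")
    case True
    note wk = calls_walk_sets(1,2)[OF disjI1[OF True] n(1), unfolded fold]
    show ?thesis unfolding body_col_sets_def fold
      by (rule ev_weaken, rule ev_If_Less[where ?t2.0 = 0 and ?v2.0 = Null], ((rule ev_rules cl wk)+)[3])
        (use True v in \<open>auto simp: col_sets_def Let_def\<close>)
  next
    case l2: False
    show ?thesis
    proof (cases "k * l < n")
      case True
      have "calls_prog f_levels (Cell graph (Cell (Num (of_nat k + of_nat k)) (enc_list enc_st (map (\<lambda>j. (j, [j])) idx))))
        (enc_list enc_st (levels nb (2 * k) (map (\<lambda>j. (j, [j])) idx))) (V ^ 94)"
        unfolding eqm using calls_walk_sets(1)[OF disjI2 k2[OF True]] by simp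
      note wk = this[unfolded fold] calls_walk_sets(2)[OF disjI2[OF order_refl] k2[OF True], unfolded fold]
      have kl: "(of_nat k * of_nat l :: rat) < of_nat n" unfolding eqm of_nat_less_iff by (rule True)
      show ?thesis unfolding body_col_sets_def fold
        by (rule ev_weaken, rule ev_If_Less[where ?t1.0 = 0 and ?v1.0 = Null], ((rule ev_rules)+)[2], use l2 in simp,
            rule ev_If_Less[where ?t2.0 = 0 and ?v2.0 = Null], ((rule ev_rules cl b wk)+)[3])
          (use l2 True kl v in \<open>auto simp: col_sets_def Let_def\<close>)
    next
      case False
      have wk: "calls_prog f_subs (Cell Null (enc_nats idx)) (enc_list enc_nats (subs idx)) (V ^ 42)"
        by (rule calls_subs[OF n(2) _ two_power_le[OF l2 False]]) simp_all
      have kl: "\<not> (of_nat k * of_nat l :: rat) < of_nat n" unfolding eqm of_nat_less_iff by (rule False)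
      show ?thesis unfolding body_col_sets_def fold
        by (rule ev_weaken, rule ev_If_Less[where ?t1.0 = 0 and ?v1.0 = Null], ((rule ev_rules)+)[2], use l2 in simp,
            rule ev_If_Less[where ?t1.0 = 0 and ?v1.0 = Null], ((rule ev_rules cl b)+)[2], use kl in simp, ((rule ev_rules wk)+)[1])
          (use l2 False kl v in \<open>auto simp: col_sets_def Let_def\<close>)
    qed
  qed
  then show ?thesis by (intro callsI[OF _ prog_nth(33)]) (auto simp: length_prog)
qed

lemma calls_cands:
  "calls_prog f_cands (Cell (Num (of_nat k)) graph) (enc_mat (cands k l idx A At B Bt)) (V ^ 128)"
proof -
  note cl = calls_col_sets calls_cand_sets[OF ok(1,2) col_sets_valid_cols length_col_sets order_refl]
  have "ev prog w [Cell (Num (of_nat k)) graph] body_cands (enc_mat (cands k l idx A At B Bt)) (V ^ 128)"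
    unfolding body_cands_def enc_graph_def[of l idx A At B Bt]
    by (rule ev_weaken, ((rule ev_rules cl[unfolded enc_graph_def[of l idx A At B Bt]] | assumption)+)[1], simp add: cands_def,
      use V_ge[of 101 128] V_ge[of 121 128] V_ge'[of 128] in simp)
  then show ?thesis by (intro callsI[OF _ prog_nth(34)]) (auto simp: length_prog)
qed

lemma length_cands: "length (cands k l idx A At B Bt) \<le> V ^ 25"
proof -
  have "length (cands k l idx A At B Bt) \<le> length (col_sets k l idx A At B Bt) * V ^ 4"
    unfolding cands_def by (rule length_concat_le) (rule length_cand_set_le[OF ok(2) col_sets_valid_cols])
  also have "\<dots> \<le> V ^ (21 + 4)" by (rule V_pow_mult[OF length_col_sets order_refl])
  finally show ?thesis by simp
qed

lemma cands_elem:
  assumes "q \<in> set (cands k l idx A At B Bt)"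
  shows "length q = n" "\<And>c. c \<in> set q \<Longrightarrow> size_le c (2 * \<sigma>)"
proof -
  obtain J I where J: "J \<in> set (col_sets k l idx A At B Bt)"
    and I: "I \<in> set (consall (row_choices At idx (tl J)) idx)" and q: "q \<in> set (cand A idx J I)"
  proof -
    obtain J where J: "J \<in> set (col_sets k l idx A At B Bt)" "q \<in> set (cand_set A At idx J)"
      using assms by (auto simp: cands_def)
    then show ?thesis using that[OF J(1)] by (auto simp: cand_set_def split: if_splits)
  qed
  have I': "set I \<subseteq> {..<n}" "distinct I" using row_lists(3)[OF ok(2) col_sets_valid_cols[OF J] I] by auto
  have eq: "q = map (\<lambda>j. assoc j (weights A I (splits_of J)) / sum_list (map snd (weights A I (splits_of J)))) idx"
    using q by (auto simp: cand_def normalize_def Let_def split: if_splits)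
  show "length q = n" by (simp add: eq)
  show "size_le c (2 * \<sigma>)" if "c \<in> set q" for c
    using that cand_size_le[OF ok(1) I' col_sets_valid_cols[OF J]] by (auto simp: eq)
qed

end

end

section \<open>Search over pairs of candidates\<close>

definition dot :: "rat list \<Rightarrow> rat list \<Rightarrow> nat list \<Rightarrow> rat" where
  "dot x y is = (\<Sum>j\<leftarrow>is. x ! j * y ! j)"

definition mult_mat :: "nat list \<Rightarrow> rat list list \<Rightarrow> rat list \<Rightarrow> rat list" where
  "mult_mat idx M y = map (\<lambda>r. dot r y idx) M"

definition transp :: "nat list \<Rightarrow> rat list list \<Rightarrow> rat list list" where
  "transp idx M = map (\<lambda>j. map (\<lambda>r. r ! j) M) idx"

definition is_strategy :: "rat list \<Rightarrow> bool" where
  "is_strategy x \<longleftrightarrow> (\<forall>q\<in>set x. 0 \<le> q) \<and> sum_list x = 1"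

definition no_better :: "nat list \<Rightarrow> rat list list \<Rightarrow> rat list \<Rightarrow> rat list \<Rightarrow> bool" where
  "no_better idx M x y \<longleftrightarrow> (\<forall>q\<in>set (mult_mat idx M y). q \<le> dot x (mult_mat idx M y) idx)"

abbreviation pos_count :: "rat list \<Rightarrow> nat" where
  "pos_count x \<equiv> length (filter (\<lambda>q. 0 < q) x)"

definition check :: "nat \<Rightarrow> nat list \<Rightarrow> rat list list \<Rightarrow> rat list list \<Rightarrow> rat list \<Rightarrow> rat list \<Rightarrow> bool" where
  "check k idx A Bt x y \<longleftrightarrow> is_strategy x \<and> is_strategy y \<and> pos_count x \<le> k \<and> pos_count y \<le> k \<and>
     no_better idx A x y \<and> no_better idx Bt y x"

fun search_col :: "(rat list \<Rightarrow> rat list \<Rightarrow> bool) \<Rightarrow> rat list \<Rightarrow> rat list list \<Rightarrow> (rat list \<times> rat list) option" where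
  "search_col C x [] = None"
| "search_col C x (y # Ys) = (if C x y then Some (x, y) else search_col C x Ys)"

fun search :: "(rat list \<Rightarrow> rat list \<Rightarrow> bool) \<Rightarrow> rat list list \<Rightarrow> rat list list \<Rightarrow> (rat list \<times> rat list) option" where
  "search C Ys [] = None"
| "search C Ys (x # Xs) = (case search_col C x Ys of None \<Rightarrow> search C Ys Xs | Some p \<Rightarrow> Some p)"

lemma search_col_Some: "search_col C x Ys = Some (x', y) \<Longrightarrow> x' = x \<and> y \<in> set Ys \<and> C x y"
  by (induction Ys) (auto split: if_splits)

lemma search_col_None: "search_col C x Ys = None \<longleftrightarrow> (\<forall>y\<in>set Ys. \<not> C x y)"
  by (induction Ys) auto

lemma search_Some: "search C Ys Xs = Some (x, y) \<Longrightarrow> x \<in> set Xs \<and> y \<in> set Ys \<and> C x y"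
  by (induction Xs) (auto split: option.splits dest: search_col_Some)

lemma search_None: "search C Ys Xs = None \<longleftrightarrow> (\<forall>x\<in>set Xs. \<forall>y\<in>set Ys. \<not> C x y)"
  by (induction Xs) (auto simp: search_col_None split: option.splits dest: search_col_Some)

fun enc_ans :: "(rat list \<times> rat list) option \<Rightarrow> val" where
  "enc_ans None = Null"
| "enc_ans (Some (x, y)) = Cell (enc_row x) (enc_row y)"

context game_machine
begin

definition big :: nat where "big = n * (2 * \<sigma> + n * (3 * \<sigma> + 1) + 2) + 1"

lemma big_fits: "size_le q s \<Longrightarrow> s \<le> big \<Longrightarrow> rat_bits q \<le> w"
  unfolding big_def by (rule size_le_w) (rule size_le_mono)

text \<open>The lengths met by the final test: the sum of a candidate, an entry of a payoff vector,
  the product of a strategy with such a vector, and a single term of a sum of products.\<close>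

lemma big_ge: "n * (2 * \<sigma> + 1) + 1 \<le> big" "n * (\<sigma> + 2 * \<sigma> + 1) + 1 \<le> big"
  "n * (2 * \<sigma> + (n * (\<sigma> + 2 * \<sigma> + 1) + 1) + 1) + 1 \<le> big" "s + t \<le> n * (s + t + 1) + 1"
proof -
  show "n * (2 * \<sigma> + 1) + 1 \<le> big" unfolding big_def by (intro add_right_mono mult_left_mono) auto
  have "1 * (n * (3 * \<sigma> + 1)) \<le> n * (n * (3 * \<sigma> + 1))" using n1 by (intro mult_right_mono) auto
  also have "\<dots> \<le> n * (2 * \<sigma> + n * (3 * \<sigma> + 1) + 2)" by (intro mult_left_mono) auto
  finally show "n * (\<sigma> + 2 * \<sigma> + 1) + 1 \<le> big" by (simp add: big_def)
  show "n * (2 * \<sigma> + (n * (\<sigma> + 2 * \<sigma> + 1) + 1) + 1) + 1 \<le> big" by (simp add: big_def)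
  have "1 * (s + t + 1) \<le> n * (s + t + 1)" using n1 by (intro mult_right_mono) auto
  moreover have "s + t \<le> 1 * (s + t + 1)" by simp
  ultimately show "s + t \<le> n * (s + t + 1) + 1" by (meson le_trans le_add1)
qed

section \<open>Cost of transposition and of testing pairs of candidates\<close>

lemma calls_col:
  assumes "length M \<le> n" "\<And>r. r \<in> set M \<Longrightarrow> j < length r" "j \<le> n"
  shows "calls_prog f_col (Cell (Num (of_nat j)) (enc_mat M)) (enc_row (map (\<lambda>r. r ! j) M)) (V ^ 21)"
  apply (rule calls_rec_V[OF _ prog_nth(35)[unfolded body_col_def], where G = "\<lambda>M. enc_row (map (\<lambda>r. r ! j) M)" and p = 14 and q = 1])
  subgoal by (simp add: length_prog)
  subgoal by (rule ev_weaken, ((rule ev_rules)+)[1], simp, use V_ge'[of 14] in simp)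
  subgoal by (use assms nV in auto)
  subgoal premises prems for x zs
  proof -
    have "j < length x" "j \<le> n" using assms(2)[OF suffix_elem(1)[OF prems]] assms(3) by auto
    then show ?thesis
      by - (rule ev_weaken, ((rule ev_rules calls_nth | assumption)+)[1], simp, use V_ge[of 7 14] V_ge'[of 14] in simp)
  qed
  subgoal by simp
  done

lemma calls_transpose:
  assumes "length M \<le> n" "\<And>r. r \<in> set M \<Longrightarrow> length r = n"
  shows "calls_prog f_transpose (Cell (enc_mat M) (enc_nats idx)) (enc_mat (transp idx M)) (V ^ 35)"
  apply (rule calls_rec_V[OF _ prog_nth(36)[unfolded body_transpose_def], where G = "\<lambda>is. enc_mat (transp is M)" and p = 28 and q = 1])
  subgoal by (simp add: length_prog)
  subgoal by (rule ev_weaken, ((rule ev_rules)+)[1], simp add: transp_def, use V_ge'[of 28] in simp)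
  subgoal by (use nV in simp)
  subgoal premises prems for x zs
  proof -
    have j: "j < length r" if "r \<in> set M" "j = x" for r j
      using assms(2)[OF that(1)] suffix_elem(1)[OF prems] that(2) by simp
    have "x \<le> n" using suffix_elem(1)[OF prems] by simp
    note cl = calls_col[OF assms(1) j[OF _ refl] this]
    show ?thesis
      by - (rule ev_weaken, ((rule ev_rules cl | assumption)+)[1], simp add: transp_def, use V_ge[of 21 28] V_ge'[of 28] in simp)
  qed
  subgoal by simp
  done

lemma calls_dot:
  assumes x: "length x = n" "\<And>c. c \<in> set x \<Longrightarrow> size_le c s" and y: "length y = n" "\<And>c. c \<in> set y \<Longrightarrow> size_le c t" and b: "n * (s + t + 1) + 1 \<le> big"
  shows "calls_prog f_dot (Cell (Cell (enc_row x) (enc_row y)) (enc_nats idx)) (Num (dot x y idx)) (V ^ 21)"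
  apply (rule calls_rec_V[OF _ prog_nth(37)[unfolded body_dot_def], where G = "\<lambda>is. Num (dot x y is)" and p = 14 and q = 1])
  subgoal by (simp add: length_prog)
  subgoal by (rule ev_weaken, ((rule ev_rules)+)[1], simp add: dot_def, use V_ge'[of 14] in simp)
  subgoal by (use nV in simp)
  subgoal premises prems for j zs
  proof -
    have jn: "j < n" using suffix_elem(1)[OF prems] by simp
    have jx: "j < length x" "j \<le> n" and jy: "j < length y" using jn x y by auto
    have szp: "size_le (x ! i * y ! i) (s + t)" if "i < n" for i
      using that x y by (intro size_le_mult) auto
    have b1: "rat_bits (x ! j * y ! j) \<le> w"
      by (rule big_fits[OF szp[OF jn]]) (rule le_trans[OF big_ge(4) b])
    have "size_le (\<Sum>i\<leftarrow>j # zs. x ! i * y ! i) (n * (s + t + 1) + 1)"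
    proof (rule size_le_sum_list)
      show "length (j # zs) \<le> n" using suffix_length_le[OF prems] by simp
      fix i assume "i \<in> set (j # zs)"
      then have "i < n" using set_mono_suffix[OF prems] by auto
      then show "size_le (x ! i * y ! i) (s + t)" by (rule szp)
    qed
    then have "rat_bits (\<Sum>i\<leftarrow>j # zs. x ! i * y ! i) \<le> w" by (rule big_fits[OF _ b])
    then have b2: "rat_bits (x ! j * y ! j + dot x y zs) \<le> w" by (simp add: dot_def)
    note cl = calls_nth[OF jx, of Num] calls_nth[OF jy jx(2), of Num]
    show ?thesis
      by - (rule ev_weaken, ((rule ev_rules cl b1 b2 | assumption)+)[1], simp add: dot_def, use V_ge[of 7 14] V_ge'[of 14] in simp)
  qed
  subgoal by simp
  done

lemma valid_mat_row:
  assumes M: "valid_mat M" and r: "r \<in> set M"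
  shows "length r = n \<and> (\<forall>c\<in>set r. size_le c \<sigma>)"
proof -
  obtain i where i: "i < length M" "r = M ! i" using r by (metis in_set_conv_nth)
  have "i < n" using i M by (simp add: valid_mat_def)
  moreover have len: "length r = n" using M \<open>i < n\<close> i by (simp add: valid_mat_def)
  ultimately show ?thesis using valid_mat_size_le[OF M \<open>i < n\<close>] i(2) by (metis in_set_conv_nth)
qed

lemma calls_mult:
  assumes M: "valid_mat M" and y: "length y = n" "\<And>c. c \<in> set y \<Longrightarrow> size_le c (2 * \<sigma>)"
  shows "calls_prog f_mult (Cell (Cell (enc_nats idx) (enc_row y)) (enc_mat M)) (enc_row (mult_mat idx M y)) (V ^ 35)"
  apply (rule calls_rec_V[OF _ prog_nth(38)[unfolded body_mult_def], where G = "\<lambda>M. enc_row (mult_mat idx M y)" and p = 28 and q = 1])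
  subgoal by (simp add: length_prog)
  subgoal by (rule ev_weaken, ((rule ev_rules)+)[1], simp add: mult_mat_def, use V_ge'[of 28] in simp)
  subgoal by (use M nV in \<open>simp add: valid_mat_def\<close>)
  subgoal premises prems for x zs
  proof -
    have x: "length x = n" "\<And>c. c \<in> set x \<Longrightarrow> size_le c \<sigma>"
      using valid_mat_row[OF M suffix_elem(1)[OF prems]] by auto
    note cl = calls_dot[OF x y big_ge(2)]
    show ?thesis
      by - (rule ev_weaken, ((rule ev_rules cl | assumption)+)[1], simp add: mult_mat_def, use V_ge[of 21 28] V_ge'[of 28] in simp)
  qed
  subgoal by simp
  done

lemma calls_bound:
  assumes "length p \<le> n"
  shows "calls_prog f_bound (Cell (Num u) (enc_row p)) (Num (of_bool (\<forall>q\<in>set p. q \<le> u))) (V ^ 14)"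
  apply (rule calls_rec_V[OF _ prog_nth(39)[unfolded body_bound_def], where G = "\<lambda>p. Num (of_bool (\<forall>q\<in>set p. q \<le> u))" and p = 7 and q = 1])
  subgoal by (simp add: length_prog)
  subgoal by (rule ev_weaken, ((rule ev_rules)+)[1], simp, use V_ge'[of 7] in simp)
  subgoal by (use assms nV in auto)
  subgoal premises prems for x zs
  proof -
    show ?thesis
      by - (rule ev_weaken, ((rule ev_rules  | assumption)+)[1], simp add: not_le[symmetric], use  V_ge'[of 7] in simp)
  qed
  subgoal by simp
  done

lemma calls_nonneg:
  assumes "length p \<le> n"
  shows "calls_prog f_nonneg (Cell Null (enc_row p)) (Num (of_bool (\<forall>q\<in>set p. 0 \<le> q))) (V ^ 14)"
  apply (rule calls_rec_V[OF _ prog_nth(40)[unfolded body_nonneg_def], where G = "\<lambda>p. Num (of_bool (\<forall>q\<in>set p. 0 \<le> q))" and p = 7 and q = 1])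
  subgoal by (simp add: length_prog)
  subgoal by (rule ev_weaken, ((rule ev_rules)+)[1], simp, use V_ge'[of 7] in simp)
  subgoal by (use assms nV in auto)
  subgoal premises prems for x zs
  proof -
    show ?thesis
      by - (rule ev_weaken, ((rule ev_rules  | assumption)+)[1], simp add: not_le[symmetric], use  V_ge'[of 7] in simp)
  qed
  subgoal by simp
  done

lemma calls_sum:
  assumes x: "length p \<le> n" "\<And>c. c \<in> set p \<Longrightarrow> size_le c (2 * \<sigma>)"
  shows "calls_prog f_sum (Cell Null (enc_row p)) (Num (sum_list p)) (V ^ 14)"
  apply (rule calls_rec_V[OF _ prog_nth(41)[unfolded body_sum_def], where G = "\<lambda>p. Num (sum_list p)" and p = 7 and q = 1])
  subgoal by (simp add: length_prog)
  subgoal by (rule ev_weaken, ((rule ev_rules)+)[1], simp, use V_ge'[of 7] in simp)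
  subgoal by (use assms nV in simp)
  subgoal premises prems for x zs
  proof -
    have "size_le (\<Sum>c\<leftarrow>x # zs. c) (n * (2 * \<sigma> + 1) + 1)"
      by (rule size_le_sum_list) (use suffix_length_le[OF prems] assms set_mono_suffix[OF prems] in auto)
    then have b: "rat_bits (x + sum_list zs) \<le> w" using big_fits[OF _ big_ge(1)] by simp
    then show ?thesis
      by - (rule ev_weaken, ((rule ev_rules b | assumption)+)[1], simp, use  V_ge'[of 7] in simp)
  qed
  subgoal by simp
  done

lemma calls_count:
  assumes "length p \<le> n"
  shows "calls_prog f_count (Cell Null (enc_row p)) (Num (of_nat (pos_count p))) (V ^ 14)"
  apply (rule calls_rec_V[OF _ prog_nth(42)[unfolded body_count_def], where G = "\<lambda>p. Num (of_nat (pos_count p))" and p = 7 and q = 1])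
  subgoal by (simp add: length_prog)
  subgoal by (rule ev_weaken, ((rule ev_rules)+)[1], simp, use V_ge'[of 7] in simp)
  subgoal by (use assms nV in auto)
  subgoal premises prems for x zs
  proof -
    have "pos_count zs \<le> length zs" by (rule length_filter_le)
    then have b: "rat_bits (of_nat (pos_count zs) + 1) \<le> w"
      using suffix_elem(3)[OF prems] assms by (intro w_nat'(3)) linarith
    then show ?thesis
      by - (rule ev_weaken, ((rule ev_rules b | assumption)+)[1], simp, use  V_ge'[of 7] in simp)
  qed
  subgoal by simp
  done

lemma calls_check:
  assumes ok: "valid_mat A" "valid_mat Bt"
    and x: "length x = n" "\<And>c. c \<in> set x \<Longrightarrow> size_le c (2 * \<sigma>)" and y: "length y = n" "\<And>c. c \<in> set y \<Longrightarrow> size_le c (2 * \<sigma>)"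
  shows "calls_prog f_check (Cell (Cell (Num (of_nat k)) (Cell (enc_nats idx) (Cell (enc_mat A) (enc_mat Bt))))
      (Cell (enc_row x) (enc_row y))) (Num (of_bool (check k idx A Bt x y))) (V ^ 42)"
proof -
  have p: "length (mult_mat idx M z) = n" "\<And>c. c \<in> set (mult_mat idx M z) \<Longrightarrow> size_le c (n * (\<sigma> + 2 * \<sigma> + 1) + 1)"
    if M: "valid_mat M" and z: "length z = n" "\<And>c. c \<in> set z \<Longrightarrow> size_le c (2 * \<sigma>)" for M z
  proof -
    show "length (mult_mat idx M z) = n" using M by (simp add: mult_mat_def valid_mat_def)
    fix c assume "c \<in> set (mult_mat idx M z)"
    then obtain r where r: "r \<in> set M" "c = dot r z idx" by (auto simp: mult_mat_def)
    show "size_le c (n * (\<sigma> + 2 * \<sigma> + 1) + 1)" unfolding r(2) dot_def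
      by (rule size_le_sum_list, rule size_le_mult) (use valid_mat_row[OF M r(1)] z in auto)
  qed
  note px = p[OF ok(2) x] and py = p[OF ok(1) y]
  have le: "length x \<le> n" "length y \<le> n" "length (mult_mat idx A y) \<le> n" "length (mult_mat idx Bt x) \<le> n"
    using x y px py by auto
  note cl = calls_nonneg[OF le(1)] calls_nonneg[OF le(2)] calls_sum[OF le(1) x(2)] calls_sum[OF le(2) y(2)]
    calls_count[OF le(1)] calls_count[OF le(2)] calls_mult[OF ok(1) y] calls_mult[OF ok(2) x]
    calls_bound[OF le(3)] calls_bound[OF le(4)] calls_dot[OF x py big_ge(3)] calls_dot[OF y px big_ge(3)]
  have "ev prog w [Cell (Cell (Num (of_nat k)) (Cell (enc_nats idx) (Cell (enc_mat A) (enc_mat Bt))))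
      (Cell (enc_row x) (enc_row y))] body_check (Num (of_bool (check k idx A Bt x y))) (V ^ 42)"
    unfolding body_check_def
    by (rule ev_weaken, ((rule ev_rules cl | assumption)+)[1],
      simp add: check_def is_strategy_def no_better_def not_less,
      use V_ge[of 14 42] V_ge[of 35 42] V_ge[of 21 42] V_ge'[of 35] in simp)
  then show ?thesis by (intro callsI[OF _ prog_nth(43)]) (auto simp: length_prog)
qed

abbreviation chk_val :: "rat list list \<Rightarrow> rat list list \<Rightarrow> val" where
  "chk_val A Bt \<equiv> Cell (Num (of_nat k)) (Cell (enc_nats idx) (Cell (enc_mat A) (enc_mat Bt)))"

lemma calls_inner:
  assumes ok: "valid_mat A" "valid_mat Bt" and x: "length x = n" "\<And>c. c \<in> set x \<Longrightarrow> size_le c (2 * \<sigma>)" and Ys: "length Ys \<le> V ^ 25" "\<And>y. y \<in> set Ys \<Longrightarrow> length y = n" "\<And>y c. y \<in> set Ys \<Longrightarrow> c \<in> set y \<Longrightarrow> size_le c (2 * \<sigma>)"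
  shows "calls_prog f_inner (Cell (Cell (chk_val A Bt) (enc_row x)) (enc_mat Ys)) (enc_ans (search_col (check k idx A Bt) x Ys)) (V ^ 80)"
  apply (rule calls_rec_V[OF _ prog_nth(44)[unfolded body_inner_def], where G = "\<lambda>Ys. enc_ans (search_col (check k idx A Bt) x Ys)" and p = 49 and q = 25])
  subgoal by (simp add: length_prog)
  subgoal by (rule ev_weaken, ((rule ev_rules)+)[1], simp, use V_ge'[of 49] in simp)
  subgoal by (use Ys in simp)
  subgoal premises prems for y zs
  proof -
    have y: "y \<in> set Ys" by (rule suffix_elem(1)[OF prems])
    note cl = calls_check[OF ok x Ys(2)[OF y] Ys(3)[OF y]]
    show ?thesis
      by - (rule ev_weaken, ((rule ev_rules cl | assumption)+)[1], simp, use V_ge[of 42 49] V_ge'[of 49] in simp)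
  qed
  subgoal by simp
  done

lemma calls_outer:
  assumes ok: "valid_mat A" "valid_mat Bt"
    and Xs: "length Xs \<le> V ^ 25" "\<And>y. y \<in> set Xs \<Longrightarrow> length y = n" "\<And>y c. y \<in> set Xs \<Longrightarrow> c \<in> set y \<Longrightarrow> size_le c (2 * \<sigma>)"
    and Ys: "length Ys \<le> V ^ 25" "\<And>y. y \<in> set Ys \<Longrightarrow> length y = n" "\<And>y c. y \<in> set Ys \<Longrightarrow> c \<in> set y \<Longrightarrow> size_le c (2 * \<sigma>)"
  shows "calls_prog f_outer (Cell (Cell (chk_val A Bt) (enc_mat Ys)) (enc_mat Xs)) (enc_ans (search (check k idx A Bt) Ys Xs)) (V ^ 118)"
  apply (rule calls_rec_V[OF _ prog_nth(45)[unfolded body_outer_def], where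
      G = "\<lambda>Xs. enc_ans (search (check k idx A Bt) Ys Xs)" and p = 87 and q = 25])
  subgoal by (simp add: length_prog)
  subgoal by (rule ev_weaken, ((rule ev_rules)+)[1], simp, use V_ge'[of 87] in simp)
  subgoal by (use Xs in simp)
  subgoal premises prems for x zs
  proof -
    have x: "x \<in> set Xs" by (rule suffix_elem(1)[OF prems])
    note cl = calls_inner[OF ok Xs(2)[OF x] Xs(3)[OF x] Ys]
    show ?thesis
    proof (cases "search_col (check k idx A Bt) x Ys")
      case None
      note cl' = cl[unfolded None enc_ans.simps]
      show ?thesis
        by (rule ev_weaken, rule ev_If_Cell_False, ((rule ev_rules cl' | assumption)+)[2], simp add: None,
          use V_ge[of 80 87] V_ge'[of 87] in simp)
    next
      case (Some p)
      obtain x' y' where p: "p = (x', y')" by (cases p)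
      note cl' = cl[unfolded Some p enc_ans.simps]
      show ?thesis
        by (rule ev_weaken, rule ev_If_Cell_True, ((rule ev_rules cl' | assumption)+)[2], simp add: Some p,
          use V_ge[of 80 87] V_ge'[of 87] in simp)
    qed
  qed
  subgoal by simp
  done

text \<open>The row player's candidates are those of the game with the players exchanged: there
  \<open>Bt\<close>, \<open>B\<close>, \<open>At\<close>, \<open>A\<close> stand in the places of
  \<open>A\<close>, \<open>At\<close>, \<open>B\<close>, \<open>Bt\<close>.\<close>

definition answer :: "rat list list \<Rightarrow> rat list list \<Rightarrow> (rat list \<times> rat list) option" where
  "answer A B = (let At = transp idx A; Bt = transp idx B in
     search (check k idx A Bt) (cands k l idx A At B Bt) (cands k l idx Bt B At A))"

lemma calls_main:
  assumes ok: "valid_mat A" "valid_mat B" "valid_mat (transp idx A)" "valid_mat (transp idx B)"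
  shows "calls_prog 0 (Cell (Num (of_nat k)) (Cell (Num (of_nat l)) (Cell (enc_mat A) (Cell (enc_mat B) Null))))
    (enc_ans (answer A B)) (V ^ 135)"
proof -
  let ?At = "transp idx A" and ?Bt = "transp idx B"
  have len: "length A \<le> n" "length A = n" "length B \<le> n" using ok by (auto simp: valid_mat_def)
  have up: "calls_prog f_upto (Cell (Num (of_nat n)) (enc_mat A)) (Cell (Num (of_nat (n - length A))) (enc_nats idx)) (V ^ 14)"
    using calls_upto[OF len(1), of "enc_list Num"] len(2) by simp
  have ln: "calls_prog f_length (Cell Null (enc_mat A)) (Num (of_nat n)) (V ^ 14)"
    using calls_length[OF len(1), of "enc_list Num"] len(2) by simp
  have rows: "length r = n" if "r \<in> set A" for r using valid_mat_row[OF ok(1) that] by simp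
  have rows': "length r = n" if "r \<in> set B" for r using valid_mat_row[OF ok(2) that] by simp
  have ok1: "valid_mat A" "valid_mat ?At" "valid_mat B" "valid_mat ?Bt" and ok2: "valid_mat ?Bt" "valid_mat B" "valid_mat ?At" "valid_mat A"
    using ok by auto
  note cl = up ln calls_transpose[OF len(1) rows] calls_transpose[OF len(3) rows']
    calls_cands[OF ok1, unfolded enc_graph_def] calls_cands[OF ok2, unfolded enc_graph_def]
    calls_outer[OF ok(1,4) length_cands[OF ok2] cands_elem(1)[OF ok2] cands_elem(2)[OF ok2]
      length_cands[OF ok1] cands_elem(1)[OF ok1] cands_elem(2)[OF ok1]]
  have "ev prog w [Cell (Num (of_nat k)) (Cell (Num (of_nat l)) (Cell (enc_mat A) (Cell (enc_mat B) Null)))]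
    body_main (enc_ans (answer A B)) (V ^ 135)"
    unfolding body_main_def
    by (rule ev_weaken, ((rule ev_rules cl | assumption)+)[1], simp add: answer_def Let_def,
      use V_ge[of 14 135] V_ge[of 35 135] V_ge[of 128 135] V_ge[of 118 135] V_ge'[of 135] in simp)
  then show ?thesis by (intro callsI[OF _ prog_nth(1)]) (auto simp: length_prog)
qed

end

section \<open>Correctness\<close>

lemma payoff_rows:
  assumes "M \<in> carrier_mat n n" "x \<in> carrier_vec n" "y \<in> carrier_vec n"
  shows "payoff M x y = (\<Sum>i<n. x $ i * (\<Sum>j<n. real_of_rat (M $$ (i, j)) * y $ j))"
  using assms unfolding payoff_def scalar_prod_def
  by (auto simp: scalar_prod_def atLeast0LessThan intro!: sum.cong)

lemma payoff_cols:
  assumes "M \<in> carrier_mat n n" "x \<in> carrier_vec n" "y \<in> carrier_vec n"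
  shows "payoff M x y = (\<Sum>j<n. y $ j * (\<Sum>i<n. real_of_rat (M $$ (i, j)) * x $ i))"
  unfolding payoff_rows[OF assms] sum_distrib_left
  by (subst sum.swap) (simp add: mult_ac)

text \<open>Pure strategies are the unit vectors, and a mixed strategy averages them; so a bound for
  pure deviations is a bound for all.\<close>

lemma no_better_strategy_iff:
  "(\<forall>x. strategy n x \<longrightarrow> (\<Sum>i<n. x $ i * f i) \<le> c) \<longleftrightarrow> (\<forall>i<n. f i \<le> c)"
proof safe
  fix i assume all: "\<forall>x. strategy n x \<longrightarrow> (\<Sum>i<n. x $ i * f i) \<le> c" and i: "i < n"
  have eq: "(\<Sum>j<n. unit_vec n i $ j * g j) = g i" for g :: "nat \<Rightarrow> real"
  proof -
    have "(\<Sum>j<n. unit_vec n i $ j * g j) = (\<Sum>j<n. if j = i then g j else 0)"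
      using i by (intro sum.cong) auto
    then show ?thesis using i by simp
  qed
  have "strategy n (unit_vec n i)"
    using eq[of "\<lambda>_. 1"] i by (auto simp: strategy_def)
  then show "f i \<le> c" using all eq[of f] by metis
next
  fix x assume f: "\<forall>i<n. f i \<le> c" and x: "strategy n x"
  have "(\<Sum>i<n. x $ i * f i) \<le> (\<Sum>i<n. x $ i * c)"
    using f x by (intro sum_mono mult_left_mono) (auto simp: strategy_def)
  also have "\<dots> = c" using x by (simp add: strategy_def flip: sum_distrib_right)
  finally show "(\<Sum>i<n. x $ i * f i) \<le> c" .
qed

text \<open>A weighted mean of numbers not exceeding \<open>u\<close> equals \<open>u\<close>
  exactly if all numbers of positive weight do. So \<open>u\<close> and \<open>v\<close> can only be
  the mean payoffs, and the equations on the supports are equivalent to the optimality of these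
  means.\<close>

lemma eqm_iff:
  "(\<exists>u v. eqm n a b x y u v) \<longleftrightarrow>
     (\<forall>i<n. 0 \<le> x i) \<and> (\<forall>j<n. 0 \<le> y j) \<and> (\<Sum>i<n. x i) = 1 \<and> (\<Sum>j<n. y j) = 1 \<and>
     (\<forall>i<n. (\<Sum>j<n. a i j * y j) \<le> (\<Sum>i<n. x i * (\<Sum>j<n. a i j * y j))) \<and>
     (\<forall>j<n. (\<Sum>i<n. b j i * x i) \<le> (\<Sum>j<n. y j * (\<Sum>i<n. b j i * x i)))"
proof -
  have fwd: "f i \<le> (\<Sum>i<n. z i * f i)"
    if "\<forall>i<n. 0 \<le> z i" "(\<Sum>i<n. z i) = 1" "\<forall>i<n. f i \<le> u \<and> (0 < z i \<longrightarrow> f i = u)" "i < n" for z f :: "nat \<Rightarrow> real" and u i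
  proof -
    have "(\<Sum>i<n. z i * f i) = (\<Sum>i<n. z i * u)"
    proof (intro sum.cong refl)
      fix i assume "i \<in> {..<n}"
      then show "z i * f i = z i * u" using that(1,3) by (cases "z i = 0") (auto simp: less_le)
    qed
    also have "\<dots> = u" using that(2) by (simp flip: sum_distrib_right)
    finally show ?thesis using that(3,4) by simp
  qed
  have bwd: "f i = (\<Sum>i<n. z i * f i)"
    if z: "\<forall>i<n. 0 \<le> z i" "(\<Sum>i<n. z i) = 1" and f: "\<forall>i<n. f i \<le> (\<Sum>i<n. z i * f i)" and i: "i < n" "0 < z i"
    for z f :: "nat \<Rightarrow> real" and i
  proof -
    define u where "u = (\<Sum>i<n. z i * f i)"
    have "(\<Sum>i<n. z i * (u - f i)) = (\<Sum>i<n. z i) * u - u"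
      by (simp only: right_diff_distrib sum_subtractf sum_distrib_right u_def[symmetric])
    then have "(\<Sum>i<n. z i * (u - f i)) = 0" using z(2) by simp
    moreover have "0 \<le> z i * (u - f i)" if "i \<in> {..<n}" for i using z(1) f that by (simp add: u_def)
    ultimately have "z i * (u - f i) = 0" using i(1) sum_nonneg_0[of "{..<n}" "\<lambda>i. z i * (u - f i)" i] by simp
    then show ?thesis using i(2) by (simp add: u_def)
  qed
  show ?thesis
  proof
    assume "\<exists>u v. eqm n a b x y u v"
    then obtain u v where e: "eqm n a b x y u v" by blast
    note h = e[unfolded eqm_def best_def]
    show "(\<forall>i<n. 0 \<le> x i) \<and> (\<forall>j<n. 0 \<le> y j) \<and> (\<Sum>i<n. x i) = 1 \<and> (\<Sum>j<n. y j) = 1 \<and>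
       (\<forall>i<n. (\<Sum>j<n. a i j * y j) \<le> (\<Sum>i<n. x i * (\<Sum>j<n. a i j * y j))) \<and>
       (\<forall>j<n. (\<Sum>i<n. b j i * x i) \<le> (\<Sum>j<n. y j * (\<Sum>i<n. b j i * x i)))"
    proof (intro conjI allI impI)
      show "(\<Sum>j<n. a i j * y j) \<le> (\<Sum>i<n. x i * (\<Sum>j<n. a i j * y j))" if "i < n" for i
        by (rule fwd[where f = "\<lambda>i. \<Sum>j<n. a i j * y j" and u = u]) (use h that in simp_all)
      show "(\<Sum>i<n. b j i * x i) \<le> (\<Sum>j<n. y j * (\<Sum>i<n. b j i * x i))" if "j < n" for j
        by (rule fwd[where f = "\<lambda>j. \<Sum>i<n. b j i * x i" and u = v]) (use h that in simp_all)
    qed (use h in simp_all)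
  next
    assume h: "(\<forall>i<n. 0 \<le> x i) \<and> (\<forall>j<n. 0 \<le> y j) \<and> (\<Sum>i<n. x i) = 1 \<and> (\<Sum>j<n. y j) = 1 \<and>
       (\<forall>i<n. (\<Sum>j<n. a i j * y j) \<le> (\<Sum>i<n. x i * (\<Sum>j<n. a i j * y j))) \<and>
       (\<forall>j<n. (\<Sum>i<n. b j i * x i) \<le> (\<Sum>j<n. y j * (\<Sum>i<n. b j i * x i)))"
    have "eqm n a b x y (\<Sum>i<n. x i * (\<Sum>j<n. a i j * y j)) (\<Sum>j<n. y j * (\<Sum>i<n. b j i * x i))"
      unfolding eqm_def best_def
    proof (intro conjI allI impI)
      show "(\<Sum>j<n. a i j * y j) = (\<Sum>i<n. x i * (\<Sum>j<n. a i j * y j))" if "i < n" "0 < x i" for i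
        by (rule bwd[where f = "\<lambda>i. \<Sum>j<n. a i j * y j" and z = x]) (use h that in simp_all)
      show "(\<Sum>i<n. b j i * x i) = (\<Sum>j<n. y j * (\<Sum>i<n. b j i * x i))" if "j < n" "0 < y j" for j
        by (rule bwd[where f = "\<lambda>j. \<Sum>i<n. b j i * x i" and z = y]) (use h that in simp_all)
    qed (use h in simp_all)
    then show "\<exists>u v. eqm n a b x y u v" by blast
  qed
qed

lemma nash_iff_eqm:
  assumes A: "A \<in> carrier_mat n n" and B: "B \<in> carrier_mat n n" and x: "x \<in> carrier_vec n" and y: "y \<in> carrier_vec n"
  shows "nash n A B x y \<longleftrightarrow> (\<exists>u v. eqm n (\<lambda>i j. of_rat (A $$ (i, j))) (\<lambda>j i. of_rat (B $$ (i, j))) (($) x) (($) y) u v)"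
proof -
  let ?R = "\<lambda>i. \<Sum>j<n. real_of_rat (A $$ (i, j)) * y $ j"
  let ?C = "\<lambda>j. \<Sum>i<n. real_of_rat (B $$ (i, j)) * x $ i"
  have "\<not> (\<exists>x'. strategy n x' \<and> payoff A x' y > payoff A x y) \<longleftrightarrow>
      (\<forall>x'. strategy n x' \<longrightarrow> (\<Sum>i<n. x' $ i * ?R i) \<le> (\<Sum>i<n. x $ i * ?R i))"
    using payoff_rows[OF A _ y] x by (auto simp: strategy_def not_less)
  also have "\<dots> \<longleftrightarrow> (\<forall>i<n. ?R i \<le> (\<Sum>i<n. x $ i * ?R i))" by (rule no_better_strategy_iff)
  finally have r: "\<not> (\<exists>x'. strategy n x' \<and> payoff A x' y > payoff A x y) \<longleftrightarrow>
      (\<forall>i<n. ?R i \<le> (\<Sum>i<n. x $ i * ?R i))" .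
  have "\<not> (\<exists>y'. strategy n y' \<and> payoff B x y' > payoff B x y) \<longleftrightarrow>
      (\<forall>y'. strategy n y' \<longrightarrow> (\<Sum>j<n. y' $ j * ?C j) \<le> (\<Sum>j<n. y $ j * ?C j))"
    using payoff_cols[OF B x] y by (auto simp: strategy_def not_less)
  also have "\<dots> \<longleftrightarrow> (\<forall>j<n. ?C j \<le> (\<Sum>j<n. y $ j * ?C j))" by (rule no_better_strategy_iff)
  finally have c: "\<not> (\<exists>y'. strategy n y' \<and> payoff B x y' > payoff B x y) \<longleftrightarrow>
      (\<forall>j<n. ?C j \<le> (\<Sum>j<n. y $ j * ?C j))" .
  show ?thesis unfolding nash_def r c eqm_iff using x y by (auto simp: strategy_def)
qed

lemma support_supp: "x \<in> carrier_vec n \<Longrightarrow> support x = supp n (($) x)"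
  by (auto simp: support_def supp_def)

lemma eqm_cong:
  assumes "\<And>i j. i < n \<Longrightarrow> j < n \<Longrightarrow> a i j = a' i j" "\<And>i j. i < n \<Longrightarrow> j < n \<Longrightarrow> b i j = b' i j"
    and "\<And>i. i < n \<Longrightarrow> x i = x' i" "\<And>i. i < n \<Longrightarrow> y i = y' i"
  shows "eqm n a b x y u v \<longleftrightarrow> eqm n a' b' x' y' u v"
proof -
  have "(\<Sum>i<n. x i) = (\<Sum>i<n. x' i)" "(\<Sum>i<n. y i) = (\<Sum>i<n. y' i)" using assms by auto
  moreover have "(\<Sum>j<n. a i j * y j) = (\<Sum>j<n. a' i j * y' j)" "(\<Sum>j<n. b i j * x j) = (\<Sum>j<n. b' i j * x' j)"
    if "i < n" for i using assms that by (auto intro!: sum.cong)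
  ultimately show ?thesis unfolding eqm_def best_def using assms by auto
qed

lemma supp_cong: "(\<And>i. i < n \<Longrightarrow> x i = x' i) \<Longrightarrow> supp n x = supp n x'"
  by (auto simp: supp_def)

section \<open>Correctness of the test\<close>

lemma sum_list_nth_real: "length x = n \<Longrightarrow> real_of_rat (sum_list x) = (\<Sum>i<n. of_rat (x ! i))"
  unfolding of_rat_sum_list by (subst sum_list_sum_nth) (simp add: atLeast0LessThan)

lemma of_rat_dot: "real_of_rat (dot x y [0..<n]) = (\<Sum>j<n. of_rat (x ! j) * of_rat (y ! j))"
  unfolding dot_def of_rat_sum_list
  by (simp add: o_def of_rat_mult sum_list_distinct_conv_sum_set atLeast0LessThan)

lemma no_better_iff:
  assumes M: "length M = n" and x: "length x = n"
  shows "no_better [0..<n] M x y \<longleftrightarrow>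
    (\<forall>i<n. (\<Sum>j<n. mat_fun M i j * of_rat (y ! j)) \<le>
       (\<Sum>i<n. of_rat (x ! i) * (\<Sum>j<n. mat_fun M i j * of_rat (y ! j))))"
proof -
  let ?p = "mult_mat [0..<n] M y"
  have p: "real_of_rat (?p ! i) = (\<Sum>j<n. mat_fun M i j * of_rat (y ! j))" if "i < n" for i
    using that M by (simp add: mult_mat_def of_rat_dot mat_fun_def)
  have d: "real_of_rat (dot x ?p [0..<n]) = (\<Sum>i<n. of_rat (x ! i) * (\<Sum>j<n. mat_fun M i j * of_rat (y ! j)))"
    unfolding of_rat_dot by (intro sum.cong refl) (simp add: p)
  have "no_better [0..<n] M x y \<longleftrightarrow> (\<forall>i<n. ?p ! i \<le> dot x ?p [0..<n])"
    unfolding no_better_def using M by (auto simp: all_set_conv_all_nth mult_mat_def)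
  also have "\<dots> \<longleftrightarrow> (\<forall>i<n. real_of_rat (?p ! i) \<le> real_of_rat (dot x ?p [0..<n]))"
    by (simp only: of_rat_less_eq)
  finally show ?thesis unfolding d using p by simp
qed

lemma pos_count_supp: "length x = n \<Longrightarrow> pos_count x = card (supp n (\<lambda>i. real_of_rat (x ! i)))"
  unfolding length_filter_conv_card supp_def by simp

lemma check_iff_eqm:
  assumes M: "length A = n" "length Bt = n" and x: "length x = n" and y: "length y = n"
  shows "check k [0..<n] A Bt x y \<longleftrightarrow>
    (\<exists>u v. eqm n (mat_fun A) (mat_fun Bt) (\<lambda>i. of_rat (x ! i)) (\<lambda>j. of_rat (y ! j)) u v) \<and>
    card (supp n (\<lambda>i. real_of_rat (x ! i))) \<le> k \<and> card (supp n (\<lambda>j. real_of_rat (y ! j))) \<le> k"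
proof -
  have s: "is_strategy z \<longleftrightarrow> (\<forall>i<n. 0 \<le> real_of_rat (z ! i)) \<and> (\<Sum>i<n. real_of_rat (z ! i)) = 1"
    if "length z = n" for z
    unfolding is_strategy_def sum_list_nth_real[OF that, symmetric] using that by (auto simp: all_set_conv_all_nth)
  show ?thesis
    unfolding check_def eqm_iff s[OF x] s[OF y] no_better_iff[OF M(1) x] no_better_iff[OF M(2) y]
      pos_count_supp[OF x] pos_count_supp[OF y] by blast
qed

lemma mat_to_list_nth:
  assumes "A \<in> carrier_mat n n"
  shows "length (mat_to_list A) = n" "i < n \<Longrightarrow> length (mat_to_list A ! i) = n"
    "i < n \<Longrightarrow> j < n \<Longrightarrow> mat_to_list A ! i ! j = A $$ (i, j)"
  using assms by (auto simp: mat_to_list_def)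

lemma transp_nth:
  assumes "length M = n"
  shows "length (transp [0..<n] M) = n" "j < n \<Longrightarrow> length (transp [0..<n] M ! j) = n"
    "i < n \<Longrightarrow> j < n \<Longrightarrow> transp [0..<n] M ! j ! i = M ! i ! j"
  using assms by (auto simp: transp_def)

lemma enc_row_vec: "enc_row x = vec_val (vec_of_list x)"
  by (simp add: vec_val_def enc_list_def list_vec)

lemma check_imp_small_nash:
  assumes A: "A \<in> carrier_mat n n" and B: "B \<in> carrier_mat n n" and len: "length AL = n" "length Bt = n"
    and AL: "\<And>i j. i < n \<Longrightarrow> j < n \<Longrightarrow> AL ! i ! j = A $$ (i, j)"
    and Bt: "\<And>i j. i < n \<Longrightarrow> j < n \<Longrightarrow> Bt ! j ! i = B $$ (i, j)"
    and c: "check k [0..<n] AL Bt x y" and x: "length x = n" and y: "length y = n"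
  shows "small_nash k n A B (map_vec real_of_rat (vec_of_list x)) (map_vec real_of_rat (vec_of_list y))"
proof -
  define xv yv where "xv = map_vec real_of_rat (vec_of_list x)" and "yv = map_vec real_of_rat (vec_of_list y)"
  have "dim_vec xv = n" using x by (simp add: xv_def)
  then have xc: "xv \<in> carrier_vec n" by (rule carrier_vecI)
  have "dim_vec yv = n" using y by (simp add: yv_def)
  then have yc: "yv \<in> carrier_vec n" by (rule carrier_vecI)
  have xi: "xv $ i = of_rat (x ! i)" if "i < n" for i
    using that x by (simp add: vec_of_list_index xv_def)
  have yi: "yv $ i = of_rat (y ! i)" if "i < n" for i
    using that y by (simp add: vec_of_list_index yv_def)
  obtain u v where e: "eqm n (mat_fun AL) (mat_fun Bt) (\<lambda>i. of_rat (x ! i)) (\<lambda>j. of_rat (y ! j)) u v"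
    and k: "card (supp n (\<lambda>i. real_of_rat (x ! i))) \<le> k" "card (supp n (\<lambda>j. real_of_rat (y ! j))) \<le> k"
    using check_iff_eqm[OF len x y, of k] c by blast
  have "eqm n (\<lambda>i j. of_rat (A $$ (i, j))) (\<lambda>j i. of_rat (B $$ (i, j))) (($) xv) (($) yv) u v"
    by (rule eqm_cong[THEN iffD1, OF _ _ _ _ e]) (simp_all add: mat_fun_def AL Bt xi yi)
  then have "nash n A B xv yv" unfolding nash_iff_eqm[OF A B xc yc] by blast
  moreover have "supp n (($) xv) = supp n (\<lambda>i. real_of_rat (x ! i))"
    by (rule supp_cong) (rule xi)
  moreover have "supp n (($) yv) = supp n (\<lambda>i. real_of_rat (y ! i))"
    by (rule supp_cong) (rule yi)
  ultimately have "small_nash k n A B xv yv" using k by (simp add: small_nash_def support_supp[OF xc] support_supp[OF yc])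
  then show ?thesis by (simp add: xv_def yv_def)
qed

lemma sparse_fun_mat_fun:
  assumes A: "A \<in> carrier_mat n n" and s: "sparse_mat l A"
  shows "(\<And>i j. i < n \<Longrightarrow> j < n \<Longrightarrow> AL ! i ! j = A $$ (i, j)) \<Longrightarrow> sparse_fun l n (mat_fun AL)"
    and "(\<And>i j. i < n \<Longrightarrow> j < n \<Longrightarrow> At ! j ! i = A $$ (i, j)) \<Longrightarrow> sparse_fun l n (mat_fun At)"
proof -
  assume AL: "\<And>i j. i < n \<Longrightarrow> j < n \<Longrightarrow> AL ! i ! j = A $$ (i, j)"
  have "{j. j < n \<and> mat_fun AL i j \<noteq> 0} = {j. j < dim_col A \<and> A $$ (i, j) \<noteq> 0}"
    "{j. j < n \<and> mat_fun AL j i \<noteq> 0} = {j. j < dim_row A \<and> A $$ (j, i) \<noteq> 0}" if "i < n" for i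
    using A that AL by (auto simp: mat_fun_def)
  then show "sparse_fun l n (mat_fun AL)" using s A by (simp add: sparse_fun_def sparse_mat_def)
next
  assume At: "\<And>i j. i < n \<Longrightarrow> j < n \<Longrightarrow> At ! j ! i = A $$ (i, j)"
  have "{j. j < n \<and> mat_fun At i j \<noteq> 0} = {j. j < dim_row A \<and> A $$ (j, i) \<noteq> 0}"
    "{j. j < n \<and> mat_fun At j i \<noteq> 0} = {j. j < dim_col A \<and> A $$ (i, j) \<noteq> 0}" if "i < n" for i
    using A that At by (auto simp: mat_fun_def)
  then show "sparse_fun l n (mat_fun At)" using s A by (simp add: sparse_fun_def sparse_mat_def)
qed

text \<open>The given equilibrium itself may be missed by the candidates. It implies a minimal one,
  whose strategies appear in the separately computed lists, that of the row player after exchanging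
  the players; since both belong to the same minimal equilibrium, the pair passes the test.\<close>

lemma small_nash_imp_candidates:
  assumes A: "A \<in> carrier_mat n n" and B: "B \<in> carrier_mat n n" and l: "1 \<le> l"
    and sp: "sparse_mat l A" "sparse_mat l B" and len: "length AL = n" "length Bt = n"
    and AL: "\<And>i j. i < n \<Longrightarrow> j < n \<Longrightarrow> AL ! i ! j = A $$ (i, j)"
    and At: "\<And>i j. i < n \<Longrightarrow> j < n \<Longrightarrow> At ! j ! i = A $$ (i, j)"
    and BL: "\<And>i j. i < n \<Longrightarrow> j < n \<Longrightarrow> BL ! i ! j = B $$ (i, j)"
    and Bt: "\<And>i j. i < n \<Longrightarrow> j < n \<Longrightarrow> Bt ! j ! i = B $$ (i, j)"
    and sn: "small_nash k n A B x y"
  shows "\<exists>x1\<in>set (cands k l [0..<n] Bt BL At AL). \<exists>y1\<in>set (cands k l [0..<n] AL At BL Bt). check k [0..<n] AL Bt x1 y1"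
proof -
  have xy: "x \<in> carrier_vec n" "y \<in> carrier_vec n" using sn by (auto simp: small_nash_def nash_def strategy_def)
  note spa = sparse_fun_mat_fun(1)[OF A sp(1) AL] and spb = sparse_fun_mat_fun(2)[OF B sp(2) Bt]
  have "nash n A B x y" using sn by (simp add: small_nash_def)
  then obtain u v where e0: "eqm n (\<lambda>i j. of_rat (A $$ (i, j))) (\<lambda>j i. of_rat (B $$ (i, j))) (($) x) (($) y) u v"
    using nash_iff_eqm[OF A B xy] by blast
  have "eqm n (mat_fun AL) (mat_fun Bt) (($) x) (($) y) u v"
    by (rule eqm_cong[THEN iffD1, OF _ _ _ _ e0]) (simp_all add: mat_fun_def AL Bt)
  moreover have "card (supp n (($) x)) \<le> k" "card (supp n (($) y)) \<le> k"
    using sn support_supp[OF xy(1)] support_supp[OF xy(2)] by (simp_all add: small_nash_def)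
  ultimately obtain x' y' u' v' where m: "min_eqm k n (mat_fun AL) (mat_fun Bt) x' y' u' v'"
    by (rule min_eqm_exists)
  have m': "min_eqm k n (mat_fun Bt) (mat_fun AL) y' x' v' u'" using m min_eqm_swap by blast
  have e: "eqm n (mat_fun AL) (mat_fun Bt) x' y' u' v'" and k: "card (supp n x') \<le> k" "card (supp n y') \<le> k"
    using m by (auto simp: min_eqm_def)
  have t1: "At ! j ! i = AL ! i ! j" "Bt ! j ! i = BL ! i ! j" if "i < n" "j < n" for i j
    using that by (simp_all add: AL At BL Bt)
  have t2: "BL ! j ! i = Bt ! i ! j" "AL ! j ! i = At ! i ! j" if "i < n" "j < n" for i j
    using that by (simp_all add: AL At BL Bt)
  obtain J where J: "J \<in> set (col_sets k l [0..<n] AL At BL Bt)" "distinct J" "set J = supp n y'"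
    using col_sets_complete[OF m l spa spb t1] by blast
  obtain I where I: "I \<in> set (col_sets k l [0..<n] Bt BL At AL)" "distinct I" "set I = supp n x'"
    using col_sets_complete[OF m' l spb spa t2] by blast
  obtain y1 where y1: "y1 \<in> set (cand_set AL At [0..<n] J)" "length y1 = n" "\<And>j. j < n \<Longrightarrow> real_of_rat (y1 ! j) = y' j"
    using cands_complete[OF m J(2,3) t1(1)] by blast
  obtain x1 where x1: "x1 \<in> set (cand_set Bt BL [0..<n] I)" "length x1 = n" "\<And>j. j < n \<Longrightarrow> real_of_rat (x1 ! j) = x' j"
    using cands_complete[OF m' I(2,3) t2(1)] by blast
  have "eqm n (mat_fun AL) (mat_fun Bt) (\<lambda>i. of_rat (x1 ! i)) (\<lambda>j. of_rat (y1 ! j)) u' v'"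
    by (rule eqm_cong[THEN iffD2, OF _ _ _ _ e]) (simp_all add: x1 y1)
  moreover have "supp n (\<lambda>i. real_of_rat (x1 ! i)) = supp n x'" by (rule supp_cong) (rule x1(3))
  moreover have "supp n (\<lambda>i. real_of_rat (y1 ! i)) = supp n y'" by (rule supp_cong) (rule y1(3))
  ultimately have "check k [0..<n] AL Bt x1 y1"
    unfolding check_iff_eqm[OF len x1(2) y1(2)] using k by auto
  moreover have "x1 \<in> set (cands k l [0..<n] Bt BL At AL)" "y1 \<in> set (cands k l [0..<n] AL At BL Bt)"
    using x1(1) y1(1) I(1) J(1) unfolding cands_def by auto
  ultimately show ?thesis by blast
qed


section \<open>Precision in terms of the input length\<close>

context
  fixes W :: nat
  assumes W4: "4 \<le> W"
begin

lemma W_mult: "a \<le> W ^ p \<Longrightarrow> b \<le> W ^ q \<Longrightarrow> a * b \<le> W ^ (p + q)"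
  unfolding power_add by (intro mult_mono) auto

lemma W_add: "a \<le> W ^ p \<Longrightarrow> b \<le> W ^ p \<Longrightarrow> a + b \<le> W ^ (p + 1)"
proof -
  assume "a \<le> W ^ p" "b \<le> W ^ p"
  then have "a + b \<le> 2 * W ^ p" by simp
  also have "\<dots> \<le> W * W ^ p" using W4 by (intro mult_right_mono) auto
  finally show ?thesis by simp
qed

lemma W_mono: "a \<le> W ^ p \<Longrightarrow> p \<le> q \<Longrightarrow> a \<le> W ^ q"
  using W4 power_increasing[of p q W] by linarith

text \<open>Each of the constants and each addition costs at most one factor \<open>W\<close>, so a
  fixed exponent suffices; it is chosen generously.\<close>

lemma precision_bound:
  assumes "n \<le> W"
  defines "s \<equiv> 3 * W * (n + 3) + 1"
  shows "2 * (n * (2 * s + n * (3 * s + 1) + 2) + 1) \<le> W ^ 20"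
proof -
  have n: "n \<le> W ^ 1" and W: "W \<le> W ^ 1" using assms by simp_all
  have c1: "1 \<le> W ^ p" for p using W4 by simp
  have c3: "3 \<le> W ^ p" if "0 < p" for p using W_mono[of 3 1 p] W4 that by simp
  have c2: "2 \<le> W ^ p" if "0 < p" for p using c3[OF that] by simp
  have "3 * W * (n + 3) \<le> W ^ (1 + 1 + (1 + 1))" by (rule W_mult[OF W_mult[OF c3 W] W_add[OF n c3]]) simp_all
  then have "3 * W * (n + 3) \<le> W ^ 4" by (rule W_mono) simp
  from W_add[OF this c1] have s: "s \<le> W ^ 5" unfolding s_def by (rule W_mono) simp
  have "3 * s \<le> W ^ (1 + 5)" by (rule W_mult[OF c3 s]) simp
  from W_add[OF this c1] have "3 * s + 1 \<le> W ^ 7" by (rule W_mono) simp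
  from W_mult[OF n this] have n3: "n * (3 * s + 1) \<le> W ^ 8" by (rule W_mono) simp
  have "2 * s \<le> W ^ (1 + 5)" by (rule W_mult[OF c2 s]) simp
  then have "2 * s \<le> W ^ 8" by (rule W_mono) simp
  from W_add[OF this n3] have "2 * s + n * (3 * s + 1) \<le> W ^ 9" by (rule W_mono) simp
  from W_add[OF this c2] have "2 * s + n * (3 * s + 1) + 2 \<le> W ^ (9 + 1)" by simp
  from W_mult[OF n this] have "n * (2 * s + n * (3 * s + 1) + 2) \<le> W ^ 11" by (rule W_mono) simp
  from W_add[OF this c1] have t: "n * (2 * s + n * (3 * s + 1) + 2) + 1 \<le> W ^ (11 + 1)" .
  have "2 * (n * (2 * s + n * (3 * s + 1) + 2) + 1) \<le> W ^ (1 + (11 + 1))" by (rule W_mult[OF c2 t]) simp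
  then show ?thesis by (rule W_mono) simp
qed

text \<open>\<open>4 * W + 6\<close> is twice \<open>2 * W + 3\<close>, and \<open>2 * n + 3\<close>
  is the length granted to numbers up to \<open>2 * n + 2\<close>.\<close>

lemma small_numbers_fit: "4 * W + 6 \<le> W ^ 20"
proof -
  have "4 * W \<le> W ^ 2" "6 \<le> W ^ 2" using W4 mult_mono[of 4 W W W] mult_mono[of 4 W 4 W] by (simp_all add: power2_eq_square)
  from W_add[OF this] show ?thesis by (rule W_mono) simp
qed

end

lemma sum_list_concat_map: "(\<Sum>q\<leftarrow>concat Ls. f q) = (\<Sum>L\<leftarrow>Ls. \<Sum>q\<leftarrow>L. (f q :: nat))"
  by (induction Ls) auto

lemma mat_bits_list:
  assumes "A \<in> carrier_mat n n"
  shows "(\<Sum>q\<leftarrow>concat (mat_to_list A). rat_bits q) = mat_bits A"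
  using assms unfolding sum_list_concat_map mat_bits_def mat_to_list_def
  by (simp add: o_def sum_list_distinct_conv_sum_set atLeast0LessThan)

lemma mat_to_list_mem:
  assumes "A \<in> carrier_mat n n" "i < n" "j < n"
  shows "A $$ (i, j) \<in> set (concat (mat_to_list A))"
proof -
  note L = mat_to_list_nth[OF assms(1)]
  have "mat_to_list A ! i \<in> set (mat_to_list A)" using L(1) assms(2) by (intro nth_mem) simp
  moreover have "mat_to_list A ! i ! j \<in> set (mat_to_list A ! i)" using L(2) assms(2,3) by (intro nth_mem) simp
  ultimately show ?thesis using L(3)[OF assms(2,3)] by auto
qed

text \<open>Even the entry \<open>0\<close> has a denominator and takes at least one bit, so the
  input length dominates the dimension; a precision polynomial in the input length may therefore
  depend on \<open>n\<close>.\<close>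

lemma mat_bits_ge:
  assumes "A \<in> carrier_mat n n" "1 \<le> n"
  shows "n \<le> mat_bits A" "i < n \<Longrightarrow> j < n \<Longrightarrow> rat_bits (A $$ (i, j)) \<le> mat_bits A"
proof -
  have "n * 1 \<le> n * n" using assms(2) by (intro mult_left_mono) auto
  also have "n * n = (\<Sum>i<n. \<Sum>j<n. 1)" by simp
  also have "\<dots> \<le> (\<Sum>i<n. \<Sum>j<n. rat_bits (A $$ (i, j)))" by (intro sum_mono rat_bits_pos)
  also have "\<dots> = mat_bits A" using assms by (simp add: mat_bits_def)
  finally show "n \<le> mat_bits A" by simp
  assume ij: "i < n" "j < n"
  have "rat_bits (A $$ (i, j)) \<le> (\<Sum>j<n. rat_bits (A $$ (i, j)))" using ij by (intro member_le_sum) auto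
  also have "\<dots> \<le> (\<Sum>i<n. \<Sum>j<n. rat_bits (A $$ (i, j)))"
    using ij by (intro member_le_sum[of i "{..<n}" "\<lambda>i. \<Sum>j<n. rat_bits (A $$ (i, j))"]) auto
  finally show "rat_bits (A $$ (i, j)) \<le> mat_bits A" using assms by (simp add: mat_bits_def)
qed

lemma (in game_machine) valid_mat_mat_list:
  assumes A: "A \<in> carrier_mat n n" and s: "sparse_mat l A" and f: "\<And>i j. i < n \<Longrightarrow> j < n \<Longrightarrow> frac_le D S 1 (A $$ (i, j))"
  shows "valid_mat (mat_to_list A)" "valid_mat (transp idx (mat_to_list A))"
proof -
  let ?L = "mat_to_list A" and ?T = "transp idx (mat_to_list A)"
  note L = mat_to_list_nth[OF A] and T = transp_nth[OF mat_to_list_nth(1)[OF A]]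
  have TA: "?T ! j ! i = A $$ (i, j)" if "i < n" "j < n" for i j using T(3)[OF that] L(3)[OF that] by simp
  have e: "{j. j < n \<and> mat_fun M i j \<noteq> 0} = {j. j < n \<and> M ! i ! j \<noteq> 0}"
    "{j. j < n \<and> mat_fun M j i \<noteq> 0} = {j. j < n \<and> M ! j ! i \<noteq> 0}" for M i
    by (simp_all add: mat_fun_def)
  have "sparse_fun l n (mat_fun ?L)" "sparse_fun l n (mat_fun ?T)"
    using sparse_fun_mat_fun(1)[OF A s L(3)] sparse_fun_mat_fun(2)[OF A s TA] by auto
  then show "valid_mat ?L" "valid_mat ?T"
    unfolding valid_mat_def sparse_fun_def e using L T(1,2) TA f by simp_all
qed

theorem theorem3:
  shows "\<exists>(P :: program) (c :: nat).
    \<forall>(k :: nat) (l :: nat) (n :: nat) (A :: rat mat) (B :: rat mat).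
      k \<ge> 1 \<longrightarrow> l \<ge> 1 \<longrightarrow> n \<ge> 1 \<longrightarrow>
      A \<in> carrier_mat n n \<longrightarrow> B \<in> carrier_mat n n \<longrightarrow>
      sparse_mat l A \<longrightarrow> sparse_mat l B \<longrightarrow>
      (\<exists>out t.
         run P (c * instance_bits k l A B ^ c) (instance_val k l A B) out t \<and>
         correct_answer k n A B out \<and>
         t \<le> c * l ^ (c * k * l) * n ^ c)"
proof (rule exI[of _ prog], rule exI[of _ "2 ^ 136"], intro allI impI)
  fix k l n :: nat and A B :: "rat mat"
  assume k: "1 \<le> k" and l: "1 \<le> l" and n: "1 \<le> n" and A: "A \<in> carrier_mat n n" and B: "B \<in> carrier_mat n n"
    and sA: "sparse_mat l A" and sB: "sparse_mat l B"
  \<comment> \<open>The exponent is the \<open>135\<close> of \<open>calls_main\<close> plus one for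
    a doubling that absorbs the call of the main function; the base \<open>2\<close> comes from
    \<open>n + 1 \<le> 2 * n\<close>.\<close>
  define c :: nat where "c = 2 ^ 136"
  have c: "136 \<le> c" by (simp add: c_def)
  define W where "W = instance_bits k l A B"
  define w where "w = c * W ^ c"
  define V where "V = (n + 1) * l ^ (k * l)"
  \<comment> \<open>\<open>2 * W * (n + 3)\<close> bits pay for the power of
    \<open>of_nat n * S\<close>, both factors being at most \<open>2 ^ W\<close>, and
    \<open>W * (n + 3)\<close> bits for the denominator \<open>D ^ (n + 3)\<close>.\<close>
  define \<sigma> where "\<sigma> = 3 * W * (n + 3) + 1"
  define S :: rat where "S = 2 ^ W"
  note bA = mat_bits_ge[OF A n] and bB = mat_bits_ge[OF B n]
  have W: "W = rat_bits (of_nat k) + rat_bits (of_nat l) + mat_bits A + mat_bits B"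
    by (simp add: W_def instance_bits_def)
  have W4: "4 \<le> W" using rat_bits_pos[of "of_nat k"] rat_bits_pos[of "of_nat l"] bA(1) bB(1) n W by linarith
  have nW: "n \<le> W" using bA(1) W by linarith
  have kW: "rat_bits (of_nat k) \<le> W" "rat_bits (of_nat k) + rat_bits (of_nat l) \<le> W" using W by simp_all
  have w20: "W ^ 20 \<le> w"
  proof -
    have "W ^ 20 \<le> W ^ c" using W4 c by (intro power_increasing) auto
    also have "\<dots> \<le> c * W ^ c" using c by simp
    finally show ?thesis by (simp add: w_def)
  qed
  obtain D where D: "0 < D" "D \<le> 2 ^ (\<Sum>q\<leftarrow>concat (mat_to_list A) @ concat (mat_to_list B). rat_bits q)"
    and Dq: "\<And>q. q \<in> set (concat (mat_to_list A) @ concat (mat_to_list B)) \<Longrightarrow> \<exists>z :: int. q * of_nat D = of_int z"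
    using common_denominator by blast
  have "(\<Sum>q\<leftarrow>concat (mat_to_list A) @ concat (mat_to_list B). rat_bits q) \<le> W"
    using mat_bits_list[OF A] mat_bits_list[OF B] W by simp
  then have "(2 :: nat) ^ (\<Sum>q\<leftarrow>concat (mat_to_list A) @ concat (mat_to_list B). rat_bits q) \<le> 2 ^ W"
    by (rule power_increasing) simp
  then have DW: "D \<le> 2 ^ W" using D(2) by linarith
  have entry: "frac_le D S 1 (M $$ (i, j))"
    if M: "M = A \<or> M = B" and ij: "i < n" "j < n" for M i j
  proof -
    have "rat_bits (M $$ (i, j)) \<le> W" using M bA(2)[OF ij] bB(2)[OF ij] W by auto
    then have "(2 :: rat) ^ rat_bits (M $$ (i, j)) \<le> S" unfolding S_def by (rule power_increasing) simp
    then have "\<bar>M $$ (i, j)\<bar> \<le> S" using rat_abs_le[of "M $$ (i, j)"] by linarith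
    moreover have "M $$ (i, j) \<in> set (concat (mat_to_list A) @ concat (mat_to_list B))"
      using M mat_to_list_mem[OF A ij] mat_to_list_mem[OF B ij] by auto
    ultimately show ?thesis using Dq by (simp add: frac_le_def)
  qed
  have bits_small: "rat_bits q \<le> w" if "size_le q s" "2 * s \<le> 4 * W + 6" for q s
    using size_le_imp_rat_bits[OF that(1)] that(2) small_numbers_fit[OF W4] w20 by linarith
  interpret game_machine w V n k l D \<sigma> S
  proof
    have "1 \<le> l ^ (k * l)" using l by simp
    then have "2 * 1 \<le> (n + 1) * l ^ (k * l)" "n * 1 \<le> (n + 1) * l ^ (k * l)" using n by (intro mult_mono; simp)+
    then show "2 \<le> V" "n \<le> V" by (simp_all add: V_def)
    show "rat_bits (of_nat m) \<le> w" if "m \<le> 2 * n + 2" for m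
    proof (rule bits_small[OF size_le_of_nat])
      \<comment> \<open>This crude bound is enough: \<open>n\<close> is at most the input length, so
        a length linear in \<open>n\<close> is affordable.\<close>
      have "m < 2 ^ m" by (rule less_exp)
      also have "\<dots> \<le> 2 ^ (2 * n + 3)" using that by (intro power_increasing) auto
      finally show "m < 2 ^ (2 * n + 3)" .
      show "2 * (2 * n + 3) \<le> 4 * W + 6" using nW by simp
    qed simp
    show "1 \<le> S" by (simp add: S_def)
    show "size_le q \<sigma>" if "frac_le D ((of_nat n * S) ^ (n + 3)) (n + 3) q" for q
    proof -
      have "n \<le> 2 ^ W" using nW less_exp[of W] by linarith
      then have "(of_nat n :: rat) \<le> of_nat (2 ^ W)" by (simp only: of_nat_le_iff)
      then have "of_nat n * S \<le> 2 ^ W * 2 ^ W" unfolding S_def by (intro mult_mono) auto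
      also have "\<dots> = 2 ^ (2 * W)" by (simp add: mult_2 power_add)
      finally have "(of_nat n * S) ^ (n + 3) \<le> (2 ^ (2 * W)) ^ (n + 3)"
        by (rule power_mono) (simp add: S_def)
      also have "\<dots> = 2 ^ (2 * W * (n + 3))" by (rule power_mult[symmetric])
      finally have "size_le q (2 * W * (n + 3) + W * (n + 3) + 1)" by (rule frac_le_size_le[OF that D(1) DW])
      then show ?thesis by (simp add: \<sigma>_def algebra_simps)
    qed
    show "rat_bits q \<le> w" if "size_le q (n * (2 * \<sigma> + n * (3 * \<sigma> + 1) + 2) + 1)" for q
      using size_le_imp_rat_bits[OF that] precision_bound[OF W4 nW, folded \<sigma>_def] w20 by linarith
    \<comment> \<open>\<open>k\<close> may be much larger than \<open>n\<close>, but its bits and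
      those of \<open>l\<close> belong to the input length, so \<open>2 * k\<close> and
      \<open>k * l\<close> fit.\<close>
    have "size_le (of_nat 2 * of_nat k) (2 + rat_bits (of_nat k))" by (intro size_le_mult size_le_rat_bits size_le_of_nat) auto
    then show "rat_bits (of_nat (2 * k)) \<le> w" unfolding of_nat_mult
      by (rule bits_small) (use kW in simp)
    have "size_le (of_nat k * of_nat l) (rat_bits (of_nat k) + rat_bits (of_nat l))" by (intro size_le_mult size_le_rat_bits)
    then show "rat_bits (of_nat (k * l)) \<le> w" unfolding of_nat_mult
      by (rule bits_small) (use kW in simp)
    show "V = (n + 1) * l ^ (k * l)" by (rule V_def)
  qed (use k l n in auto)
  let ?AL = "mat_to_list A" and ?BL = "mat_to_list B"
  let ?At = "transp idx ?AL" and ?Bt = "transp idx ?BL"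
  have okA: "valid_mat ?AL" "valid_mat ?At" by (rule valid_mat_mat_list[OF A sA entry]; simp)+
  have okB: "valid_mat ?BL" "valid_mat ?Bt" by (rule valid_mat_mat_list[OF B sB entry]; simp)+
  have inp: "instance_val k l A B =
      Cell (Num (of_nat k)) (Cell (Num (of_nat l)) (Cell (enc_mat ?AL) (Cell (enc_mat ?BL) Null)))"
    by (simp add: instance_val_def mat_val_def enc_list_def[abs_def])
  have "ev prog w [instance_val k l A B] (Call 0 (Var 0)) (enc_ans (answer ?AL ?BL)) (1 + 1 + V ^ 135)"
    unfolding inp by (rule ev_Call[OF ev_Var0 calls_main[OF okA(1) okB(1) okA(2) okB(2)]])
  then obtain t where t: "t \<le> 1 + 1 + V ^ 135" and run: "run prog w (instance_val k l A B) (enc_ans (answer ?AL ?BL)) t"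
    unfolding ev_def run_def by blast
  have "correct_answer k n A B (enc_ans (answer ?AL ?BL))"
  proof -
    note AL = mat_to_list_nth[OF A] and BL = mat_to_list_nth[OF B]
    note At = transp_nth[OF AL(1)] and Bt = transp_nth[OF BL(1)]
    have AtA: "?At ! j ! i = A $$ (i, j)" and BtB: "?Bt ! j ! i = B $$ (i, j)" if "i < n" "j < n" for i j
      using At(3)[OF that] AL(3)[OF that] Bt(3)[OF that] BL(3)[OF that] by simp_all
    have ans: "answer ?AL ?BL = search (check k idx ?AL ?Bt) (cands k l idx ?AL ?At ?BL ?Bt) (cands k l idx ?Bt ?BL ?At ?AL)"
      by (simp add: answer_def Let_def)
    show ?thesis
    proof (cases "answer ?AL ?BL")
      case (Some p)
      obtain x y where p: "p = (x, y)" by (cases p)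
      have s: "x \<in> set (cands k l idx ?Bt ?BL ?At ?AL)" "y \<in> set (cands k l idx ?AL ?At ?BL ?Bt)" "check k idx ?AL ?Bt x y"
        using search_Some[OF Some[unfolded ans p]] by auto
      have len: "length x = n" "length y = n"
        using cands_elem(1)[OF okB(2,1) okA(2,1) s(1)] cands_elem(1)[OF okA okB s(2)] by auto
      have "small_nash k n A B (map_vec real_of_rat (vec_of_list x)) (map_vec real_of_rat (vec_of_list y))"
        by (rule check_imp_small_nash[OF A B AL(1) Bt(1) AL(3) BtB s(3) len])
      moreover have "enc_ans (Some (x, y)) = Cell (vec_val (vec_of_list x)) (vec_val (vec_of_list y))"
        by (simp add: enc_row_vec)
      ultimately show ?thesis unfolding correct_answer_def Some p by auto
    next
      case None
      have "\<not> small_nash k n A B x y" for x y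
        using small_nash_imp_candidates[OF A B l sA sB AL(1) Bt(1) AL(3) AtA BL(3) BtB] None[unfolded ans search_None] by blast
      then show ?thesis unfolding correct_answer_def None by simp
    qed
  qed
  moreover have "t \<le> c * l ^ (c * k * l) * n ^ c"
  proof -
    have "t \<le> V ^ 135 + V ^ 135" using t V_ge'[of 135] by linarith
    also have "\<dots> \<le> V ^ 136" using V_double[of 135] by simp
    also have "\<dots> \<le> (2 * n * l ^ (k * l)) ^ 136" unfolding V_def using n by (intro power_mono mult_right_mono) auto
    also have "\<dots> = 2 ^ 136 * l ^ (k * l * 136) * n ^ 136" by (simp only: power_mult_distrib power_mult mult_ac)
    also have "\<dots> \<le> c * l ^ (c * k * l) * n ^ c"
    proof (intro mult_mono)
      have "k * l * 136 \<le> k * l * c" using c by (rule mult_left_mono) simp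
      then show "l ^ (k * l * 136) \<le> l ^ (c * k * l)" using l by (intro power_increasing) (simp_all add: mult_ac)
      show "n ^ 136 \<le> n ^ c" using n c by (intro power_increasing)
    qed (simp_all add: c_def)
    finally show ?thesis .
  qed
  ultimately show "\<exists>out t. run prog (2 ^ 136 * instance_bits k l A B ^ 2 ^ 136) (instance_val k l A B) out t \<and>
      correct_answer k n A B out \<and> t \<le> 2 ^ 136 * l ^ (2 ^ 136 * k * l) * n ^ 2 ^ 136"
    using run unfolding w_def W_def c_def[symmetric] by blast
qed

end
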